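(* The maximal relation $T_{\max}$ is a closed linear relation in $H^1(a,b)$, and its adjoint is \[ T_{\max}^\ast=\{f\in T_{\max} \,:\, V(f,g)(a)=V(f,g)(b)=0 \text{ for all } g\in T_{\max}\}. \]
   Context: Let $-\infty\le a<b\le\infty$ and let $\varrho,\varsigma,\chi$ be complex Borel measures on $(a,b)$, finite on compact subintervals, such that $\varrho$ is real-valued, $\varsigma$ is positive with support all of $(a,b)$, $\chi$ is positive and not identically zero, and $\varsigma(\{x\})\chi(\{x\})=\varsigma(\{x\})\varrho(\{x\})=0$ for all $x\in(a,b)$. For such a measure $\mu$ and $c,x\in(a,b)$ write $\int_c^x h\,d\mu=\int_{[c,x)}h\,d\mu$ if $x>c$, $0$ if $x=c$, and $-\int_{[x,c)}h\,d\mu$ if $x<c$. $AC_{\mathrm{loc}}((a,b);\mu)$ is the set of functions $f(x)=f(c)+\int_c^x h\,d\mu$ with $h\in L^1_{\mathrm{loc}}((a,b);\mu)$, and $df/d\mu:=h$. Let $\mathfrak D_\tau$ be the set of $f\in AC_{\mathrm{loc}}((a,b);\varsigma)$ such that the function $x\mapsto -\frac{df}{d\varsigma}(x)+\int_c^x f\,d\chi$ has a (necessarily unique) representative in $AC_{\mathrm{loc}}((a,b);\varrho)$. For such $f$, $\tau f\in L^1_{\mathrm{loc}}((a,b);\varrho)$ is the Radon–Nikodym derivative of that representative with respect to $\varrho$, and $f^{[1]}:=df/d\varsigma$. $T_{\mathrm{loc}}$ is the set of pairs $(f,f_\tau)\in AC_{\mathrm{loc}}((a,b);\varsigma)^2$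 with $f\in\mathfrak D_\tau$ and $\tau f=f_\tau$ in $L^1_{\mathrm{loc}}((a,b);\varrho)$. For $f,g\in T_{\mathrm{loc}}$ set $V(f,g)(x)=f_\tau(x)g^{[1]}(x)-f^{[1]}(x)g_\tau(x)$. $H^1(a,b)$ is the Hilbert space of all $f\in AC_{\mathrm{loc}}((a,b);\varsigma)$ with $\int_a^b|f|^2d\chi<\infty$ and $\int_a^b|f^{[1]}|^2d\varsigma<\infty$, with inner product $\langle f,g\rangle=\int_a^b f g^\ast d\chi+\int_a^b f^{[1]}(g^{[1]})^\ast d\varsigma$. $T_{\max}=\{(f,f_\tau)\in T_{\mathrm{loc}}: f,f_\tau\in H^1(a,b)\}$, regarded as a linear relation in $H^1(a,b)$. For $f,g\in T_{\max}$ the limits $V(f,g)(a):=\lim_{x\to a}V(f,g)(x)$ and $V(f,g)(b):=\lim_{x\to b}V(f,g)(x)$ exist and are finite. *)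

theory Defs
  imports "HOL-Analysis.Analysis"
begin

definition Ioo_e :: "ereal \<Rightarrow> ereal \<Rightarrow> real set" where
  "Ioo_e a b = {x. a < ereal x \<and> ereal x < b}"

definition at_lend :: "ereal \<Rightarrow> real filter" where
  "at_lend a = (if a = -\<infinity> then at_bot else at_right (real_of_ereal a))"

definition at_rend :: "ereal \<Rightarrow> real filter" where
  "at_rend b = (if b = \<infinity> then at_top else at_left (real_of_ereal b))"

definition mint :: "real measure \<Rightarrow> real \<Rightarrow> real \<Rightarrow> (real \<Rightarrow> complex) \<Rightarrow> complex" where
  "mint M c x h = (if c < x then set_lebesgue_integral M {c..<x} h
                   else if x = c then 0 else - set_lebesgue_integral M {x..<c} h)"

definition L1loc :: "ereal \<Rightarrow> ereal \<Rightarrow> real measure \<Rightarrow> (real \<Rightarrow> complex) set" where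
  "L1loc a b M = {h. \<forall>c d. a < ereal c \<and> ereal d < b \<longrightarrow> set_integrable M {c..d} h}"

(* AC_loc((a,b); \<mu>) for the (real) measure \<mu> = s \<cdot> M, where M = |\<mu>| and s is a sign
   function (polar decomposition).  For positive measures s = (\<lambda>_. 1).
   Functions are normalised to vanish outside (a,b). *)
definition ACloc :: "ereal \<Rightarrow> ereal \<Rightarrow> real \<Rightarrow> real measure \<Rightarrow> (real \<Rightarrow> real)
    \<Rightarrow> (real \<Rightarrow> complex) set" where
  "ACloc a b c M s = {f. (\<forall>x. x \<notin> Ioo_e a b \<longrightarrow> f x = 0) \<and>
     (\<exists>h\<in>L1loc a b M. \<forall>x\<in>Ioo_e a b. f x = f c + mint M c x (\<lambda>t. complex_of_real (s t) * h t))}"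

definition rnd :: "ereal \<Rightarrow> ereal \<Rightarrow> real \<Rightarrow> real measure \<Rightarrow> (real \<Rightarrow> real)
    \<Rightarrow> (real \<Rightarrow> complex) \<Rightarrow> (real \<Rightarrow> complex)" where
  "rnd a b c M s f = (SOME h. h \<in> L1loc a b M \<and>
     (\<forall>x\<in>Ioo_e a b. f x = f c + mint M c x (\<lambda>t. complex_of_real (s t) * h t)))"

(* F is the representative in AC_loc((a,b);\<varrho>) of  x \<mapsto> -df/d\<varsigma>(x) + \<int>_c^x f d\<chi>.
   Here \<varrho> = sr \<cdot> mr. *)
definition is_rep :: "ereal \<Rightarrow> ereal \<Rightarrow> real \<Rightarrow> real measure \<Rightarrow> real measure \<Rightarrow> real measure
    \<Rightarrow> (real \<Rightarrow> real) \<Rightarrow> (real \<Rightarrow> complex) \<Rightarrow> (real \<Rightarrow> complex) \<Rightarrow> bool" where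
  "is_rep a b c vs chi mr sr f F \<longleftrightarrow> F \<in> ACloc a b c mr sr \<and>
     (\<exists>h\<in>L1loc a b vs. (\<forall>x\<in>Ioo_e a b. f x = f c + mint vs c x h) \<and>
        (AE x in vs. x \<in> Ioo_e a b \<longrightarrow> F x = - h x + mint chi c x f))"

definition Dtau :: "ereal \<Rightarrow> ereal \<Rightarrow> real \<Rightarrow> real measure \<Rightarrow> real measure \<Rightarrow> real measure
    \<Rightarrow> (real \<Rightarrow> real) \<Rightarrow> (real \<Rightarrow> complex) set" where
  "Dtau a b c vs chi mr sr = {f \<in> ACloc a b c vs (\<lambda>_. 1). \<exists>F. is_rep a b c vs chi mr sr f F}"

definition tau :: "ereal \<Rightarrow> ereal \<Rightarrow> real \<Rightarrow> real measure \<Rightarrow> real measure \<Rightarrow> real measure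
    \<Rightarrow> (real \<Rightarrow> real) \<Rightarrow> (real \<Rightarrow> complex) \<Rightarrow> (real \<Rightarrow> complex)" where
  "tau a b c vs chi mr sr f = rnd a b c mr sr (THE F. is_rep a b c vs chi mr sr f F)"

(* the quasi-derivative f^[1] = df/d\<varsigma>, pointwise canonical representative:
   f^[1](x) = \<int>_c^x f d\<chi> - (representative in AC_loc(\<varrho>))(x) *)
definition qd :: "ereal \<Rightarrow> ereal \<Rightarrow> real \<Rightarrow> real measure \<Rightarrow> real measure \<Rightarrow> real measure
    \<Rightarrow> (real \<Rightarrow> real) \<Rightarrow> (real \<Rightarrow> complex) \<Rightarrow> (real \<Rightarrow> complex)" where
  "qd a b c vs chi mr sr f x = mint chi c x f - (THE F. is_rep a b c vs chi mr sr f F) x"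

definition Tloc :: "ereal \<Rightarrow> ereal \<Rightarrow> real \<Rightarrow> real measure \<Rightarrow> real measure \<Rightarrow> real measure
    \<Rightarrow> (real \<Rightarrow> real) \<Rightarrow> ((real \<Rightarrow> complex) \<times> (real \<Rightarrow> complex)) set" where
  "Tloc a b c vs chi mr sr = {(f, g). f \<in> ACloc a b c vs (\<lambda>_. 1) \<and> g \<in> ACloc a b c vs (\<lambda>_. 1) \<and>
      f \<in> Dtau a b c vs chi mr sr \<and> g \<in> L1loc a b mr \<and>
      (AE x in mr. x \<in> Ioo_e a b \<longrightarrow> tau a b c vs chi mr sr f x = g x)}"

definition H1 :: "ereal \<Rightarrow> ereal \<Rightarrow> real \<Rightarrow> real measure \<Rightarrow> real measure \<Rightarrow> (real \<Rightarrow> complex) set" where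
  "H1 a b c vs chi = {f \<in> ACloc a b c vs (\<lambda>_. 1).
      set_integrable chi (Ioo_e a b) (\<lambda>x. (cmod (f x))\<^sup>2) \<and>
      set_integrable vs (Ioo_e a b) (\<lambda>x. (cmod (rnd a b c vs (\<lambda>_. 1) f x))\<^sup>2)}"

definition H1_inner :: "ereal \<Rightarrow> ereal \<Rightarrow> real \<Rightarrow> real measure \<Rightarrow> real measure
    \<Rightarrow> (real \<Rightarrow> complex) \<Rightarrow> (real \<Rightarrow> complex) \<Rightarrow> complex" where
  "H1_inner a b c vs chi f g =
     set_lebesgue_integral chi (Ioo_e a b) (\<lambda>x. f x * cnj (g x)) +
     set_lebesgue_integral vs (Ioo_e a b)
       (\<lambda>x. rnd a b c vs (\<lambda>_. 1) f x * cnj (rnd a b c vs (\<lambda>_. 1) g x))"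

definition H1_norm :: "ereal \<Rightarrow> ereal \<Rightarrow> real \<Rightarrow> real measure \<Rightarrow> real measure
    \<Rightarrow> (real \<Rightarrow> complex) \<Rightarrow> real" where
  "H1_norm a b c vs chi f = sqrt (Re (H1_inner a b c vs chi f f))"

definition Tmax :: "ereal \<Rightarrow> ereal \<Rightarrow> real \<Rightarrow> real measure \<Rightarrow> real measure \<Rightarrow> real measure
    \<Rightarrow> (real \<Rightarrow> real) \<Rightarrow> ((real \<Rightarrow> complex) \<times> (real \<Rightarrow> complex)) set" where
  "Tmax a b c vs chi mr sr = {(f, g) \<in> Tloc a b c vs chi mr sr. f \<in> H1 a b c vs chi \<and> g \<in> H1 a b c vs chi}"

definition Vw :: "ereal \<Rightarrow> ereal \<Rightarrow> real \<Rightarrow> real measure \<Rightarrow> real measure \<Rightarrow> real measure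
    \<Rightarrow> (real \<Rightarrow> real) \<Rightarrow> (real \<Rightarrow> complex) \<times> (real \<Rightarrow> complex)
    \<Rightarrow> (real \<Rightarrow> complex) \<times> (real \<Rightarrow> complex) \<Rightarrow> real \<Rightarrow> complex" where
  "Vw a b c vs chi mr sr p q x =
     snd p x * qd a b c vs chi mr sr (fst q) x - qd a b c vs chi mr sr (fst p) x * snd q x"

type_synonym cfun = "real \<Rightarrow> complex"

definition linear_relation :: "cfun set \<Rightarrow> (cfun \<times> cfun) set \<Rightarrow> bool" where
  "linear_relation H T \<longleftrightarrow> T \<subseteq> H \<times> H \<and> ((\<lambda>_. 0), (\<lambda>_. 0)) \<in> T \<and>
     (\<forall>p\<in>T. \<forall>q\<in>T. (\<lambda>x. fst p x + fst q x, \<lambda>x. snd p x + snd q x) \<in> T) \<and>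
     (\<forall>p\<in>T. \<forall>k::complex. (\<lambda>x. k * fst p x, \<lambda>x. k * snd p x) \<in> T)"

definition closed_relation :: "(cfun \<Rightarrow> real) \<Rightarrow> cfun set \<Rightarrow> (cfun \<times> cfun) set \<Rightarrow> bool" where
  "closed_relation nrm H T \<longleftrightarrow> (\<forall>F G u v. (\<forall>n. (F n, G n) \<in> T) \<and> u \<in> H \<and> v \<in> H \<and>
     (\<lambda>n. nrm (\<lambda>x. F n x - u x)) \<longlonglongrightarrow> 0 \<and> (\<lambda>n. nrm (\<lambda>x. G n x - v x)) \<longlonglongrightarrow> 0 \<longrightarrow> (u, v) \<in> T)"

definition adjoint_rel :: "(cfun \<Rightarrow> cfun \<Rightarrow> complex) \<Rightarrow> cfun set \<Rightarrow> (cfun \<times> cfun) set \<Rightarrow> (cfun \<times> cfun) set" where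
  "adjoint_rel ip H T = {(u, v). u \<in> H \<and> v \<in> H \<and> (\<forall>(f, g)\<in>T. ip v f = ip u g)}"

end

theory Submission
  imports Defs
begin

text \<open>Integration by parts (no cross term, since \<open>vs\<close> shares no atoms with \<open>chi\<close> and \<open>mr\<close>) and the
  lemma of du Bois-Reymond identify \<open>Tmax\<close> with the set of pairs \<open>(f, g)\<close> in \<open>H1 \<times> H1\<close> such that
  \<open>\<langle>f, h\<rangle> = \<integral> g h\<^sup>* d\<rho>\<close> for all compactly supported \<open>h\<close> in \<open>H1\<close>. Both sides are continuous in
  \<open>(f, g)\<close>, so \<open>Tmax\<close> is closed. By Riesz, \<open>v \<mapsto> \<integral> v h\<^sup>* d\<rho>\<close> is represented by some \<open>k\<close>, and then
  \<open>(k, h) \<in> Tmax\<close>; testing the adjoint against these pairs gives \<open>Tmax\<^sup>* \<subseteq> Tmax\<close>. Lagrange's identity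
  turns the adjoint condition into \<open>V(a) = V(b)\<close>. That both values vanish separately follows from a
  Riesz representative of the functional \<open>(u, v) \<mapsto> V((u, v), (g, g\<tau>))(b)\<close>, which again lies in \<open>Tmax\<close>;
  this replaces a patching argument, which can fail where \<open>\<rho>\<close> vanishes.\<close>

section \<open>Semi-inner product spaces and completeness of square-integrable functions\<close>

text \<open>Patching would need a pair in \<open>Tmax\<close> that agrees with a given one near one
  endpoint and is zero near the other. If \<rho> is zero, first components solve a homogeneous
  equation and cannot vanish near an endpoint without vanishing altogether. Second components obey
  no equation and can be cut off freely; Riesz representation then supplies a matching first
  component. The measure \<rho> does not enter the norm. It is controlled only on compact intervals,
  through bounded point evaluations, and this is why the test functions have compact support.
  Integrals run over \<open>[c, x)\<close>, so all primitives are left-continuous. Together with the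
  full support of \<open>vs\<close> this turns almost-everywhere identities into pointwise ones,
  which boundary values require. \<open>V\<close> is bilinear while the inner product is
  sesquilinear; passing between the two uses that \<open>Tmax\<close> is invariant under
  conjugation, a consequence of \<rho> being real.\<close>

lemma quadratic_nonneg_bound:
  fixes A B P :: real
  assumes *: "\<And>s. 0 \<le> A - 2 * s * P + s\<^sup>2 * P * B" and "0 \<le> P" "0 \<le> B"
  shows "P \<le> A * B"
proof (cases "P = 0 \<or> B = 0")
  case True
  then show ?thesis
  proof
    assume "P = 0"
    with *[of 0] \<open>0 \<le> B\<close> show ?thesis by simp
  next
    assume B: "B = 0"
    have "P = 0"
    proof (rule ccontr)
      assume "P \<noteq> 0"
      \<comment> \<open>With \<open>B = 0\<close> this \<open>s\<close> turns the right-hand side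
        into A - (A + 1) = -1.\<close>
      with *[of "(A + 1) / (2 * P)"] B show False by (simp add: field_simps)
    qed
    with B show ?thesis by simp
  qed
next
  case False
  with assms have "P > 0" "B > 0" by auto
  \<comment> \<open>The value 1/B minimises the quadratic in \<open>s\<close>.\<close>
  have "0 \<le> A - 2 * (1/B) * P + (1/B)\<^sup>2 * P * B" by (rule *)
  also have "\<dots> = A - P / B" using \<open>B > 0\<close> by (simp add: field_simps power2_eq_square)
  finally show ?thesis using \<open>B > 0\<close> by (simp add: field_simps)
qed

lemma four_mult_le_square_add: "4 * (B * A) \<le> (A + B)\<^sup>2" for A B :: real
proof -
  have "0 \<le> (A - B)\<^sup>2" by simp
  then show ?thesis by (simp add: power2_eq_square algebra_simps)
qed

lemma tendsto_zero_square_bound: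
  fixes x :: "nat \<Rightarrow> complex"
  assumes "s \<longlonglongrightarrow> 0" "\<And>n. (cmod (x n))\<^sup>2 \<le> K * s n"
  shows "x \<longlonglongrightarrow> 0"
proof -
  have "(\<lambda>n. (cmod (x n))\<^sup>2) \<longlonglongrightarrow> 0"
    by (rule tendsto_sandwich[OF _ _ tendsto_const])
      (use assms(2) tendsto_mult[OF tendsto_const assms(1), of K] in auto)
  then show ?thesis by (simp add: tendsto_norm_zero_iff)
qed

text \<open>Vectors are functions, not classes, so a nonzero vector may have norm zero: one instance
  is integration over a subset \<open>A\<close>, which does not see functions carried by the
  complement of \<open>A\<close>.\<close>

locale semi_inner_space =
  fixes H :: "('i \<Rightarrow> complex) set" and ip :: "('i \<Rightarrow> complex) \<Rightarrow> ('i \<Rightarrow> complex) \<Rightarrow> complex"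
  assumes add_mem: "\<And>f g. f \<in> H \<Longrightarrow> g \<in> H \<Longrightarrow> (\<lambda>x. f x + g x) \<in> H"
    and scale_mem: "\<And>f k. f \<in> H \<Longrightarrow> (\<lambda>x. k * f x) \<in> H"
    and zero_mem: "(\<lambda>x. 0) \<in> H"
    and ip_add: "\<And>f g h. f \<in> H \<Longrightarrow> g \<in> H \<Longrightarrow> h \<in> H \<Longrightarrow> ip (\<lambda>x. f x + g x) h = ip f h + ip g h"
    and ip_scale: "\<And>f h k. f \<in> H \<Longrightarrow> h \<in> H \<Longrightarrow> ip (\<lambda>x. k * f x) h = k * ip f h"
    and ip_cnj: "\<And>f g. f \<in> H \<Longrightarrow> g \<in> H \<Longrightarrow> ip g f = cnj (ip f g)"
    and ip_nonneg: "\<And>f. f \<in> H \<Longrightarrow> 0 \<le> Re (ip f f)"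
begin

definition sqn :: "('i \<Rightarrow> complex) \<Rightarrow> real" where
  "sqn f = Re (ip f f)"

lemma diff_mem: "f \<in> H \<Longrightarrow> g \<in> H \<Longrightarrow> (\<lambda>x. f x - g x) \<in> H"
  using add_mem[OF _ scale_mem[of g "-1"], of f] by simp

lemma ip_diff: "f \<in> H \<Longrightarrow> g \<in> H \<Longrightarrow> h \<in> H \<Longrightarrow> ip (\<lambda>x. f x - g x) h = ip f h - ip g h"
  using ip_add[OF _ scale_mem[of g "-1"], of f h] ip_scale[of g h "-1"] by simp

lemma ip_add_right: "f \<in> H \<Longrightarrow> g \<in> H \<Longrightarrow> h \<in> H \<Longrightarrow> ip h (\<lambda>x. f x + g x) = ip h f + ip h g"
  by (subst (1 2 3) ip_cnj[of _ h]) (auto simp: ip_add add_mem)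

lemma ip_scale_right: "f \<in> H \<Longrightarrow> h \<in> H \<Longrightarrow> ip h (\<lambda>x. k * f x) = cnj k * ip h f"
  by (subst (1 2) ip_cnj[of _ h]) (auto simp: ip_scale scale_mem)

lemma ip_diff_right: "f \<in> H \<Longrightarrow> g \<in> H \<Longrightarrow> h \<in> H \<Longrightarrow> ip h (\<lambda>x. f x - g x) = ip h f - ip h g"
  by (subst (1 2 3) ip_cnj[of _ h]) (auto simp: ip_diff diff_mem)

lemma sqn_nonneg: "f \<in> H \<Longrightarrow> 0 \<le> sqn f"
  by (simp add: sqn_def ip_nonneg)

lemma sqn_add_scale:
  assumes "f \<in> H" "g \<in> H"
  shows "sqn (\<lambda>x. f x + k * g x) = sqn f + 2 * Re (k * ip g f) + (cmod k)\<^sup>2 * sqn g"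
proof -
  have "ip (\<lambda>x. f x + k * g x) (\<lambda>x. f x + k * g x) =
      ip f f + k * ip g f + cnj (k * ip g f) + k * cnj k * ip g g"
    using assms by (simp add: ip_add ip_add_right ip_scale ip_scale_right add_mem scale_mem
        ip_cnj[of g f] algebra_simps)
  then show ?thesis
    by (simp add: sqn_def complex_norm_square[symmetric] flip: of_real_power)
qed

lemma Cauchy_Schwarz:
  assumes "f \<in> H" "g \<in> H"
  shows "(cmod (ip f g))\<^sup>2 \<le> sqn f * sqn g"
proof (rule quadratic_nonneg_bound)
  fix s :: real
  have "0 \<le> sqn (\<lambda>x. f x + (- s * ip f g) * g x)"
    using assms by (intro sqn_nonneg add_mem scale_mem)
  also have "\<dots> = sqn f - 2 * s * (cmod (ip f g))\<^sup>2 + s\<^sup>2 * (cmod (ip f g))\<^sup>2 * sqn g"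
    unfolding sqn_add_scale[OF assms] ip_cnj[OF assms]
    by (simp add: norm_mult power_mult_distrib complex_norm_square[symmetric] mult.assoc
        cmod_power2 power2_eq_square algebra_simps)
  finally show "0 \<le> \<dots>" .
qed (use assms in \<open>auto intro: sqn_nonneg\<close>)

text \<open>The midpoint is isolated because it stays in \<open>H\<close>, so the infimum of a
  functional bounds its value there from below.\<close>

lemma sqn_parallelogram:
  assumes "f \<in> H" "g \<in> H"
  shows "sqn (\<lambda>x. f x - g x) = 2 * sqn f + 2 * sqn g - 4 * sqn (\<lambda>x. f x / 2 + g x / 2)"
proof -
  have h: "(\<lambda>x. f x / 2) \<in> H" "(\<lambda>x. g x / 2) \<in> H"
    using scale_mem[of f "1/2"] scale_mem[of g "1/2"] assms by auto
  have *: "ip (\<lambda>x. f x / 2) k = ip f k / 2" "ip (\<lambda>x. g x / 2) k = ip g k / 2"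
       "ip k (\<lambda>x. f x / 2) = ip k f / 2" "ip k (\<lambda>x. g x / 2) = ip k g / 2" if "k \<in> H" for k
    using ip_scale[of f k "1/2"] ip_scale[of g k "1/2"] ip_scale_right[of f k "1/2"]
      ip_scale_right[of g k "1/2"] assms that by auto
  have **: "ip (\<lambda>x. f x / 2) (\<lambda>x. f x / 2) = ip f f / 4"
      "ip (\<lambda>x. f x / 2) (\<lambda>x. g x / 2) = ip f g / 4"
      "ip (\<lambda>x. g x / 2) (\<lambda>x. f x / 2) = ip g f / 4"
      "ip (\<lambda>x. g x / 2) (\<lambda>x. g x / 2) = ip g g / 4"
    by (simp_all add: * h assms)
  show ?thesis
    unfolding sqn_def
    by (simp add: ** assms h ip_add ip_diff ip_add_right ip_diff_right add_mem diff_mem)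
qed

end

locale complete_semi_inner_space = semi_inner_space +
  assumes complete: "\<And>F. (\<And>n. F n \<in> H) \<Longrightarrow>
      (\<And>e. 0 < e \<Longrightarrow> \<exists>N. \<forall>m\<ge>N. \<forall>n\<ge>N. sqn (\<lambda>x. F m x - F n x) < e) \<Longrightarrow>
      \<exists>l\<in>H. (\<lambda>n. sqn (\<lambda>x. F n x - l x)) \<longlonglongrightarrow> 0"
begin

text \<open>The representing vector minimises \<open>sqn f - 2 Re (\<phi> f)\<close>; a minimising sequence is Cauchy
  by the parallelogram law.\<close>

lemma riesz_representation:
  fixes \<phi> :: "('a \<Rightarrow> complex) \<Rightarrow> complex"
  assumes add: "\<And>f g. f \<in> H \<Longrightarrow> g \<in> H \<Longrightarrow> \<phi> (\<lambda>x. f x + g x) = \<phi> f + \<phi> g"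
    and scale: "\<And>f k. f \<in> H \<Longrightarrow> \<phi> (\<lambda>x. k * f x) = k * \<phi> f"
    and bound: "\<And>f. f \<in> H \<Longrightarrow> (cmod (\<phi> f))\<^sup>2 \<le> K * sqn f"
  obtains w where "w \<in> H" "\<And>f. f \<in> H \<Longrightarrow> \<phi> f = ip f w"
proof -
  define J where "J f = sqn f - 2 * Re (\<phi> f)" for f
  have lower: "- (\<bar>K\<bar> + 1) \<le> J f" if f: "f \<in> H" for f
  proof -
    have "(2 * Re (\<phi> f))\<^sup>2 \<le> 4 * (cmod (\<phi> f))\<^sup>2"
      by (simp add: power_mult_distrib cmod_power2)
    also have "\<dots> \<le> 4 * (K * sqn f)" using bound[OF f] by simp
    \<comment> \<open>\<open>K\<close> carries no sign assumption; \<open>\<bar>K\<bar> + 1\<close>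
      is a nonnegative upper bound, as the square root below requires.\<close>
    also have "\<dots> \<le> 4 * ((\<bar>K\<bar> + 1) * sqn f)"
      using sqn_nonneg[OF f] by (intro mult_left_mono mult_right_mono) auto
    also have "\<dots> \<le> (sqn f + (\<bar>K\<bar> + 1))\<^sup>2"
      by (rule four_mult_le_square_add)
    finally have "2 * Re (\<phi> f) \<le> sqn f + (\<bar>K\<bar> + 1)"
      by (rule power2_le_imp_le) (use sqn_nonneg[OF f] in linarith)
    then show ?thesis by (simp add: J_def)
  qed
  define m where "m = Inf (J ` H)"
  have bdd: "bdd_below (J ` H)" using lower by (auto simp: bdd_below_def)
  have ne: "J ` H \<noteq> {}" using zero_mem by auto
  have m_le: "m \<le> J f" if "f \<in> H" for f
    unfolding m_def using bdd that by (intro cInf_lower) auto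
  have "\<exists>f\<in>H. J f < m + 1 / real (Suc n)" for n
    using cInf_lessD[OF ne, of "m + 1 / real (Suc n)"] by (auto simp: m_def)
  then obtain F where F: "\<And>n. F n \<in> H" and JF: "\<And>n. J (F n) < m + 1 / real (Suc n)" by metis
  have half: "\<phi> (\<lambda>x. f x / 2) = \<phi> f / 2" if "f \<in> H" for f
    using scale[OF that, of "1/2"] by simp
  have halfm: "(\<lambda>x. f x / 2) \<in> H" if "f \<in> H" for f
    using scale_mem[OF that, of "1/2"] by simp
  have cauchy: "sqn (\<lambda>x. F p x - F q x) \<le> 2 / real (Suc p) + 2 / real (Suc q)" for p q
  proof -
    have "sqn (\<lambda>x. F p x - F q x) = 2 * J (F p) + 2 * J (F q) - 4 * J (\<lambda>x. F p x / 2 + F q x / 2)"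
      unfolding sqn_parallelogram[OF F F] J_def
      using add[OF halfm halfm, of "F p" "F q"] half F by simp
    also have "\<dots> \<le> 2 * (m + 1 / real (Suc p)) + 2 * (m + 1 / real (Suc q)) - 4 * m"
      using JF[of p] JF[of q] m_le[of "\<lambda>x. F p x / 2 + F q x / 2"] add_mem[OF halfm halfm, OF F F]
      by (simp only: diff_conv_add_uminus) (intro add_mono, auto)
    finally show ?thesis by (simp add: algebra_simps)
  qed
  have "\<exists>w\<in>H. (\<lambda>n. sqn (\<lambda>x. F n x - w x)) \<longlonglongrightarrow> 0"
  proof (rule complete[OF F])
    fix e :: real assume "0 < e"
    then obtain N where N: "1 / real (Suc N) < e / 4"
      using reals_Archimedean[of "e/4"] by (auto simp: inverse_eq_divide)
    have "sqn (\<lambda>x. F p x - F q x) < e" if "N \<le> p" "N \<le> q" for p q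
    proof -
      have "1 / real (Suc p) \<le> 1 / real (Suc N)" "1 / real (Suc q) \<le> 1 / real (Suc N)"
        using that by (auto intro!: divide_left_mono)
      then show ?thesis using cauchy[of p q] N by simp
    qed
    then show "\<exists>N. \<forall>m\<ge>N. \<forall>n\<ge>N. sqn (\<lambda>x. F m x - F n x) < e" by blast
  qed
  then obtain w where w: "w \<in> H" and lim: "(\<lambda>n. sqn (\<lambda>x. F n x - w x)) \<longlonglongrightarrow> 0" by blast
  have "\<phi> h = ip h w" if h: "h \<in> H" for h
  proof -
    \<comment> \<open>Almost-minimality of \<open>F n\<close> against the perturbations
      \<open>k * h\<close> is a quadratic inequality in \<open>s\<close>. The factor
      \<open>cnj D\<close> in \<open>k\<close> aligns the phase, and the defect in the Euler
      equation at \<open>F n\<close> is bounded by the gap 1/(n+1).\<close>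
    have near: "(cmod (\<phi> h - ip h (F n)))\<^sup>2 \<le> 1 / real (Suc n) * sqn h" for n
    proof (rule quadratic_nonneg_bound)
      fix s :: real
      define D where "D = \<phi> h - ip h (F n)"
      define k where "k = s * cnj D"
      have "J (F n) - 1 / real (Suc n) \<le> J (\<lambda>x. F n x + k * h x)"
        using JF[of n] m_le[OF add_mem[OF F scale_mem[OF h]], of n k] by simp
      also have "\<dots> = J (F n) + (cmod k)\<^sup>2 * sqn h - 2 * Re (k * D)"
        unfolding J_def sqn_add_scale[OF F h] D_def
        using add[OF F scale_mem[OF h], of n k] scale[OF h, of k] by (simp add: algebra_simps)
      also have "(cmod k)\<^sup>2 = s\<^sup>2 * (cmod D)\<^sup>2"
        by (simp add: k_def norm_mult power_mult_distrib)
      also have "Re (k * D) = s * (cmod D)\<^sup>2"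
        by (simp add: k_def cmod_power2) (simp add: power2_eq_square algebra_simps)
      finally show "0 \<le> 1 / real (Suc n) - 2 * s * (cmod (\<phi> h - ip h (F n)))\<^sup>2 +
          s\<^sup>2 * (cmod (\<phi> h - ip h (F n)))\<^sup>2 * sqn h"
        by (simp add: D_def)
    qed (use h in \<open>auto intro: sqn_nonneg\<close>)
    have "(\<lambda>n. \<phi> h - ip h (F n)) \<longlonglongrightarrow> 0"
      by (rule tendsto_zero_square_bound[OF LIMSEQ_inverse_real_of_nat, of _ "sqn h"])
        (use near in \<open>simp add: divide_inverse mult.commute\<close>)
    moreover have "(\<lambda>n. ip h (F n) - ip h w) \<longlonglongrightarrow> 0"
      by (rule tendsto_zero_square_bound[OF lim, of _ "sqn h"])
        (use Cauchy_Schwarz[OF h diff_mem[OF F w]] ip_diff_right[OF F w h] in simp)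
    ultimately have "(\<lambda>n. (\<phi> h - ip h (F n)) + (ip h (F n) - ip h w)) \<longlonglongrightarrow> 0 + 0" by (rule tendsto_add)
    then show ?thesis by (simp add: LIMSEQ_const_iff)
  qed
  with w that show ?thesis by blast
qed

end

section \<open>Square-integrable functions: Fatou's lemma and completeness\<close>

lemma L2_Fatou:
  fixes w :: "nat \<Rightarrow> 'a \<Rightarrow> complex"
  assumes [measurable]: "\<And>n. w n \<in> borel_measurable M" "v \<in> borel_measurable M"
    and int: "\<And>n. integrable M (\<lambda>x. (cmod (w n x))\<^sup>2)"
    and lim: "AE x in M. (\<lambda>n. w n x) \<longlonglongrightarrow> v x"
    and le: "eventually (\<lambda>n. (\<integral>x. (cmod (w n x))\<^sup>2 \<partial>M) \<le> e) sequentially"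
  shows "integrable M (\<lambda>x. (cmod (v x))\<^sup>2)" "(\<integral>x. (cmod (v x))\<^sup>2 \<partial>M) \<le> e"
proof -
  have e: "0 \<le> e"
    using eventually_happens[OF le] by (auto intro: order_trans[rotated] integral_nonneg)
  have "(\<integral>\<^sup>+x. ennreal ((cmod (v x))\<^sup>2) \<partial>M) = (\<integral>\<^sup>+x. liminf (\<lambda>n. ennreal ((cmod (w n x))\<^sup>2)) \<partial>M)"
  proof (rule nn_integral_cong_AE)
    show "AE x in M. ennreal ((cmod (v x))\<^sup>2) = liminf (\<lambda>n. ennreal ((cmod (w n x))\<^sup>2))"
      using lim
    proof eventually_elim
      case (elim x)
      have "(\<lambda>n. ennreal ((cmod (w n x))\<^sup>2)) \<longlonglongrightarrow> ennreal ((cmod (v x))\<^sup>2)"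
        using elim by (intro tendsto_ennrealI tendsto_intros)
      then show ?case by (intro lim_imp_Liminf[symmetric]) auto
    qed
  qed
  also have "\<dots> \<le> liminf (\<lambda>n. \<integral>\<^sup>+x. ennreal ((cmod (w n x))\<^sup>2) \<partial>M)"
    by (rule nn_integral_liminf) simp
  also have "\<dots> = liminf (\<lambda>n. ennreal (\<integral>x. (cmod (w n x))\<^sup>2 \<partial>M))"
    using int by (subst nn_integral_eq_integral) auto
  also have "\<dots> \<le> liminf (\<lambda>n. ennreal e)"
    by (rule Liminf_mono) (use le in \<open>auto elim!: eventually_mono intro: ennreal_leI\<close>)
  finally have *: "(\<integral>\<^sup>+x. ennreal ((cmod (v x))\<^sup>2) \<partial>M) \<le> ennreal e"
    by (simp add: Liminf_const)
  then show int: "integrable M (\<lambda>x. (cmod (v x))\<^sup>2)"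
    by (intro integrableI_bounded) (auto intro: le_less_trans[OF _ ennreal_less_top])
  show "(\<integral>x. (cmod (v x))\<^sup>2 \<partial>M) \<le> e"
    using * e by (subst (asm) nn_integral_eq_integral[OF int]) auto
qed

lemma cmod_add_square_le: "(cmod (z + w))\<^sup>2 \<le> 2 * (cmod z)\<^sup>2 + 2 * (cmod w)\<^sup>2"
proof -
  have "(cmod (z + w))\<^sup>2 \<le> (cmod z + cmod w)\<^sup>2"
    by (intro power_mono norm_triangle_ineq) auto
  then show ?thesis using sum_squares_ge_zero[of "cmod z - cmod w" 0]
    by (simp add: power2_eq_square algebra_simps)
qed

lemma cmod_diff_square_le: "(cmod (z - w))\<^sup>2 \<le> 2 * (cmod z)\<^sup>2 + 2 * (cmod w)\<^sup>2"
  using cmod_add_square_le[of z "- w"] by simp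

lemma integrable_cmod_square_diff:
  fixes u v :: "'a \<Rightarrow> complex"
  assumes [measurable]: "u \<in> borel_measurable M" "v \<in> borel_measurable M"
    and "integrable M (\<lambda>x. (cmod (u x))\<^sup>2)" "integrable M (\<lambda>x. (cmod (v x))\<^sup>2)"
  shows "integrable M (\<lambda>x. (cmod (u x - v x))\<^sup>2)"
proof (rule Bochner_Integration.integrable_bound)
  show "integrable M (\<lambda>x. 2 * (cmod (u x))\<^sup>2 + 2 * (cmod (v x))\<^sup>2)"
    using assms by auto
qed (auto intro: cmod_diff_square_le)

text \<open>Along a subsequence whose consecutive distances decay like \<open>4\<^sup>-\<^sup>n\<close>, the weighted sum
  \<open>\<Sum> 2\<^sup>n |u\<^sub>n\<^sub>+\<^sub>1 - u\<^sub>n|\<^sup>2\<close> is integrable, hence finite almost everywhere, and the increments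
  decay geometrically at almost every point.\<close>

lemma L2_complete:
  fixes u :: "nat \<Rightarrow> 'a \<Rightarrow> complex"
  assumes meas [measurable]: "\<And>n. u n \<in> borel_measurable M"
    and int: "\<And>n. integrable M (\<lambda>x. (cmod (u n x))\<^sup>2)"
    and cauchy: "\<And>e. 0 < e \<Longrightarrow> \<exists>N. \<forall>m\<ge>N. \<forall>n\<ge>N. (\<integral>x. (cmod (u m x - u n x))\<^sup>2 \<partial>M) < e"
  obtains v where "v \<in> borel_measurable M" "integrable M (\<lambda>x. (cmod (v x))\<^sup>2)"
    "(\<lambda>n. \<integral>x. (cmod (u n x - v x))\<^sup>2 \<partial>M) \<longlonglongrightarrow> 0"
proof -
  have intd: "integrable M (\<lambda>x. (cmod (u m x - u n x))\<^sup>2)" for m n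
    by (rule integrable_cmod_square_diff[OF meas meas int int])
  have "\<exists>r. \<forall>n. (\<forall>i\<ge>r n. \<forall>j\<ge>r n. (\<integral>x. (cmod (u i x - u j x))\<^sup>2 \<partial>M) < (1/4) ^ n) \<and> r (Suc n) > r n"
  proof (intro dependent_nat_choice, goal_cases)
    case 1
    then show ?case using cauchy[of "(1/4) ^ 0"] by auto
  next
    case (2 x n)
    obtain N where "\<forall>i\<ge>N. \<forall>j\<ge>N. (\<integral>x. (cmod (u i x - u j x))\<^sup>2 \<partial>M) < (1/4) ^ Suc n"
      using cauchy[of "(1/4) ^ Suc n"] by auto
    then show ?case by (intro exI[of _ "max N (Suc x)"]) auto
  qed
  then obtain r where r: "\<And>n i j. r n \<le> i \<Longrightarrow> r n \<le> j \<Longrightarrow>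
        (\<integral>x. (cmod (u i x - u j x))\<^sup>2 \<partial>M) < (1/4) ^ n" and "\<And>n. r n < r (Suc n)"
    by metis
  then have "strict_mono r" by (simp add: strict_mono_Suc_iff)
  define d where "d n x = u (r (Suc n)) x - u (r n) x" for n x
  have [measurable]: "d n \<in> borel_measurable M" for n unfolding d_def by simp
  have dn: "(\<integral>\<^sup>+x. ennreal (2 ^ n * (cmod (d n x))\<^sup>2) \<partial>M) \<le> ennreal ((1/2) ^ n)" for n
  proof -
    have "(\<integral>x. (cmod (d n x))\<^sup>2 \<partial>M) \<le> (1/4) ^ n"
      unfolding d_def using r[of n "r (Suc n)" "r n"] \<open>\<And>n. r n < r (Suc n)\<close>[of n] by simp
    then have "2 ^ n * (\<integral>x. (cmod (d n x))\<^sup>2 \<partial>M) \<le> 2 ^ n * (1/4) ^ n" by simp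
    also have "\<dots> = (1/2::real) ^ n" by (simp flip: power_mult_distrib)
    finally have "(\<integral>x. 2 ^ n * (cmod (d n x))\<^sup>2 \<partial>M) \<le> (1/2) ^ n" by simp
    then show ?thesis
      unfolding d_def using intd by (subst nn_integral_eq_integral) (auto intro: ennreal_leI)
  qed
  have "(\<integral>\<^sup>+x. (\<Sum>n. ennreal (2 ^ n * (cmod (d n x))\<^sup>2)) \<partial>M)
      = (\<Sum>n. \<integral>\<^sup>+x. ennreal (2 ^ n * (cmod (d n x))\<^sup>2) \<partial>M)"
    by (rule nn_integral_suminf) simp
  also have "\<dots> \<le> (\<Sum>n. ennreal ((1/2) ^ n))" by (intro suminf_le dn) auto
  also have "\<dots> = ennreal (\<Sum>n. (1/2) ^ n)" by (intro suminf_ennreal2) (auto intro: summable_geometric)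
  finally have "(\<integral>\<^sup>+x. (\<Sum>n. ennreal (2 ^ n * (cmod (d n x))\<^sup>2)) \<partial>M) \<noteq> \<infinity>"
    by (auto simp: top_unique)
  then have "AE x in M. (\<Sum>n. ennreal (2 ^ n * (cmod (d n x))\<^sup>2)) \<noteq> \<infinity>"
    by (intro nn_integral_PInf_AE) auto
  then have conv: "AE x in M. convergent (\<lambda>n. u (r n) x)"
  proof eventually_elim
    case (elim x)
    have "summable (\<lambda>n. 2 ^ n * (cmod (d n x))\<^sup>2)"
      using elim by (intro summable_suminf_not_top) auto
    then have "Bseq (\<lambda>n. 2 ^ n * (cmod (d n x))\<^sup>2)"
      using summable_LIMSEQ_zero convergent_imp_Bseq convergentI by blast
    then obtain C where "C > 0" and C: "\<And>n. 2 ^ n * (cmod (d n x))\<^sup>2 \<le> C"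
      by (elim BseqE) (auto simp: abs_mult)
    have dle: "cmod (d n x) \<le> sqrt C * (1 / sqrt 2) ^ n" for n
    proof -
      have "(cmod (d n x))\<^sup>2 \<le> C * (1/2) ^ n" using C[of n] by (simp add: field_simps)
      then have "sqrt ((cmod (d n x))\<^sup>2) \<le> sqrt (C * (1/2) ^ n)" by (rule real_sqrt_le_mono)
      then show ?thesis by (simp add: real_sqrt_mult real_sqrt_power real_sqrt_divide)
    qed
    have "summable (\<lambda>n. sqrt C * (1 / sqrt 2) ^ n)"
      by (intro summable_mult summable_geometric) simp
    from summable_comparison_test'[OF this dle] have "summable (\<lambda>n. d n x)" .
    then have "convergent (\<lambda>n. \<Sum>i<n. d i x)" by (simp add: summable_iff_convergent)
    then obtain l where "(\<lambda>n. \<Sum>i<n. d i x) \<longlonglongrightarrow> l" by (auto simp: convergent_def)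
    moreover have "(\<Sum>i<n. d i x) = u (r n) x - u (r 0) x" for n
      unfolding d_def by (rule sum_lessThan_telescope)
    ultimately have "(\<lambda>n. (u (r n) x - u (r 0) x) + u (r 0) x) \<longlonglongrightarrow> l + u (r 0) x"
      by (intro tendsto_intros) simp
    then show ?case by (auto simp: convergent_def)
  qed
  define v where "v x = lim (\<lambda>n. u (r n) x)" for x
  have [measurable]: "v \<in> borel_measurable M"
    unfolding v_def by (intro borel_measurable_lim_metric) simp
  have lim: "AE x in M. (\<lambda>n. u (r n) x) \<longlonglongrightarrow> v x"
    using conv by eventually_elim (simp add: v_def convergent_LIMSEQ_iff)
  \<comment> \<open>Letting the second index run along the subsequence and applying Fatou transfers
    a Cauchy bound to the limit, so the full sequence converges as well.\<close>
  have near: "integrable M (\<lambda>x. (cmod (u n x - v x))\<^sup>2) \<and> (\<integral>x. (cmod (u n x - v x))\<^sup>2 \<partial>M) \<le> e"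
    if "\<And>j. j \<ge> N \<Longrightarrow> (\<integral>x. (cmod (u n x - u j x))\<^sup>2 \<partial>M) \<le> e" for n N e
  proof -
    have "eventually (\<lambda>j. (\<integral>x. (cmod (u n x - u (r j) x))\<^sup>2 \<partial>M) \<le> e) sequentially"
      unfolding eventually_at_top_linorder
      using that le_trans[OF _ seq_suble[OF \<open>strict_mono r\<close>]] by blast
    moreover have "AE x in M. (\<lambda>j. u n x - u (r j) x) \<longlonglongrightarrow> u n x - v x"
      using lim by eventually_elim (intro tendsto_intros)
    ultimately show ?thesis
      using L2_Fatou[of "\<lambda>j x. u n x - u (r j) x" M "\<lambda>x. u n x - v x" e] intd by auto
  qed
  obtain N0 where "\<And>m n. m \<ge> N0 \<Longrightarrow> n \<ge> N0 \<Longrightarrow> (\<integral>x. (cmod (u m x - u n x))\<^sup>2 \<partial>M) < 1"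
    using cauchy[of 1] by auto
  then have int0: "integrable M (\<lambda>x. (cmod (u N0 x - v x))\<^sup>2)"
    using near[of N0 N0 1] less_imp_le by blast
  \<comment> \<open>The integrand is the squared modulus of \<open>v\<close>, written as a
    difference of two square-integrable functions.\<close>
  have "integrable M (\<lambda>x. (cmod (u N0 x - (u N0 x - v x)))\<^sup>2)"
    by (rule integrable_cmod_square_diff[OF meas _ int int0]) simp
  moreover have "(\<lambda>n. \<integral>x. (cmod (u n x - v x))\<^sup>2 \<partial>M) \<longlonglongrightarrow> 0"
  proof (rule LIMSEQ_I)
    fix e :: real assume "0 < e"
    then obtain N where N: "\<And>m n. m \<ge> N \<Longrightarrow> n \<ge> N \<Longrightarrow> (\<integral>x. (cmod (u m x - u n x))\<^sup>2 \<partial>M) < e / 2"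
      using cauchy[of "e/2"] by auto
    have "norm ((\<integral>x. (cmod (u n x - v x))\<^sup>2 \<partial>M) - 0) < e" if "n \<ge> N" for n
      using near[of N n "e/2"] N[OF that] \<open>0 < e\<close> by (force simp: less_imp_le)
    then show "\<exists>no. \<forall>n\<ge>no. norm ((\<integral>x. (cmod (u n x - v x))\<^sup>2 \<partial>M) - 0) < e" by blast
  qed
  ultimately show ?thesis using that[of v] by auto
qed

section \<open>Locally finite measures on an interval\<close>

lemma Ioo_e_eq_einterval: "Ioo_e a b = einterval a b"
  by (simp add: Ioo_e_def einterval_def)

lemma borel_Ioo_e [measurable]: "Ioo_e a b \<in> sets borel"
  by (simp add: Ioo_e_eq_einterval)

lemma Ioo_e_convex: "x \<in> Ioo_e a b \<Longrightarrow> y \<in> Ioo_e a b \<Longrightarrow> x \<le> t \<Longrightarrow> t \<le> y \<Longrightarrow> t \<in> Ioo_e a b"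
  using less_le_trans[of a "ereal x" "ereal t"] le_less_trans[of "ereal t" "ereal y" b]
  by (auto simp: Ioo_e_def)

lemma Ioo_e_less: "x \<in> Ioo_e a b \<Longrightarrow> \<exists>p\<in>Ioo_e a b. p < x"
proof -
  assume x: "x \<in> Ioo_e a b"
  then obtain z where "a < ereal z" "ereal z < ereal x"
    using ereal_dense2[of a "ereal x"] by (auto simp: Ioo_e_def)
  then show ?thesis using x less_trans[of "ereal z" "ereal x" b]
    by (intro bexI[of _ z]) (auto simp: Ioo_e_def)
qed

lemma Ioo_e_greater: "x \<in> Ioo_e a b \<Longrightarrow> \<exists>q\<in>Ioo_e a b. x < q"
proof -
  assume x: "x \<in> Ioo_e a b"
  then obtain z where "ereal x < ereal z" "ereal z < b"
    using ereal_dense2[of "ereal x" b] by (auto simp: Ioo_e_def)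
  then show ?thesis using x less_trans[of a "ereal x" "ereal z"]
    by (intro bexI[of _ z]) (auto simp: Ioo_e_def)
qed

lemma Ioo_e_min_max:
  "x \<in> Ioo_e a b \<Longrightarrow> y \<in> Ioo_e a b \<Longrightarrow> min x y \<in> Ioo_e a b"
  "x \<in> Ioo_e a b \<Longrightarrow> y \<in> Ioo_e a b \<Longrightarrow> max x y \<in> Ioo_e a b"
  by (auto simp: min_def max_def)

section \<open>The filters at the two endpoints\<close>

lemma eventually_at_rend:
  assumes "\<beta> \<in> Ioo_e a b"
  shows "eventually (\<lambda>x. \<beta> < x \<and> x \<in> Ioo_e a b) (at_rend b)"
proof (cases b)
  case (real r)
  with assms have "\<beta> < r" by (auto simp: Ioo_e_def)
  then show ?thesis using assms real
    by (auto simp: at_rend_def eventually_at_left[of \<beta>] Ioo_e_def intro!: exI[of _ \<beta>]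
        intro: less_trans[of a "ereal \<beta>"])
next
  case PInf
  with assms show ?thesis
    by (auto simp: at_rend_def Ioo_e_def intro: less_trans[of a "ereal \<beta>"]
        intro!: eventually_mono[OF eventually_gt_at_top[of \<beta>]])
qed (use assms in \<open>auto simp: Ioo_e_def\<close>)

lemma eventually_at_lend:
  assumes "\<alpha> \<in> Ioo_e a b"
  shows "eventually (\<lambda>x. x < \<alpha> \<and> x \<in> Ioo_e a b) (at_lend a)"
proof (cases a)
  case (real r)
  with assms have "r < \<alpha>" by (auto simp: Ioo_e_def)
  then show ?thesis using assms real
    by (auto simp: at_lend_def eventually_at_right[of _ \<alpha>] Ioo_e_def intro!: exI[of _ \<alpha>]
        intro: less_trans[of _ "ereal \<alpha>" b])
next
  case MInf
  with assms show ?thesis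
    by (auto simp: at_lend_def Ioo_e_def intro: less_trans[of _ "ereal \<alpha>" b]
        intro!: eventually_mono[OF eventually_gt_at_bot[of \<alpha>]])
qed (use assms in \<open>auto simp: Ioo_e_def\<close>)

lemma at_rend_neq_bot: "at_rend b \<noteq> bot"
  by (simp add: at_rend_def trivial_limit_at_left_real)

lemma at_lend_neq_bot: "at_lend a \<noteq> bot"
  by (simp add: at_lend_def trivial_limit_at_right_real)

lemma L1loc_iff:
  "h \<in> L1loc a b M \<longleftrightarrow> (\<forall>x\<in>Ioo_e a b. \<forall>y\<in>Ioo_e a b. set_integrable M {x..y} h)"
proof
  assume *: "\<forall>x\<in>Ioo_e a b. \<forall>y\<in>Ioo_e a b. set_integrable M {x..y} h"
  have "set_integrable M {x..y} h" if "a < ereal x" "ereal y < b" for x y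
  \<comment> \<open>\<open>L1loc\<close> constrains each endpoint on one side only; for
    \<open>y < x\<close> the interval is empty.\<close>
  proof (cases "x \<le> y")
    case True
    then show ?thesis using * that less_le_trans[of a "ereal x" "ereal y"] le_less_trans[of "ereal x" "ereal y" b]
      by (auto simp: Ioo_e_def)
  qed simp
  then show "h \<in> L1loc a b M" by (auto simp: L1loc_def)
qed (auto simp: L1loc_def Ioo_e_def)

text \<open>Primitives with respect to one measure get integrated against another. This class is the
  common ground: it is independent of the measure, contains all primitives, and multiplies
  \<open>L1loc\<close> into itself for every locally finite measure.\<close>

definition locbdd :: "ereal \<Rightarrow> ereal \<Rightarrow> (real \<Rightarrow> complex) set" where
  "locbdd a b = {F. (\<lambda>x. indicator (Ioo_e a b) x *\<^sub>R F x) \<in> borel_measurable borel \<and>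
     (\<forall>\<alpha>\<in>Ioo_e a b. \<forall>\<beta>\<in>Ioo_e a b. \<exists>C. \<forall>x\<in>{\<alpha>..\<beta>}. cmod (F x) \<le> C)}"

lemma locbdd_bound:
  assumes "F \<in> locbdd a b" "\<alpha> \<in> Ioo_e a b" "\<beta> \<in> Ioo_e a b"
  obtains C where "0 \<le> C" "\<And>x. x \<in> {\<alpha>..\<beta>} \<Longrightarrow> cmod (F x) \<le> C"
proof -
  obtain C where "\<forall>x\<in>{\<alpha>..\<beta>}. cmod (F x) \<le> C" using assms unfolding locbdd_def by blast
  then show ?thesis using that[of "max C 0"] by (force intro: max.coboundedI1)
qed

lemma locbdd_meas: "F \<in> locbdd a b \<Longrightarrow> (\<lambda>x. indicator (Ioo_e a b) x *\<^sub>R F x) \<in> borel_measurable borel"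
  by (simp add: locbdd_def)

lemma locbddI:
  assumes "(\<lambda>x. indicator (Ioo_e a b) x *\<^sub>R F x) \<in> borel_measurable borel"
    and "\<And>\<alpha> \<beta>. \<alpha> \<in> Ioo_e a b \<Longrightarrow> \<beta> \<in> Ioo_e a b \<Longrightarrow> \<exists>C. \<forall>x\<in>{\<alpha>..\<beta>}. cmod (F x) \<le> C"
  shows "F \<in> locbdd a b"
  using assms by (auto simp: locbdd_def)

lemma locbdd_cong:
  assumes "\<And>x. x \<in> Ioo_e a b \<Longrightarrow> F x = G x"
  shows "F \<in> locbdd a b \<longleftrightarrow> G \<in> locbdd a b"
proof -
  have "(\<lambda>x. indicator (Ioo_e a b) x *\<^sub>R F x) = (\<lambda>x. indicator (Ioo_e a b) x *\<^sub>R G x)"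
    using assms by (auto simp: indicator_def fun_eq_iff)
  moreover have "(\<forall>x\<in>{\<alpha>..\<beta>}. cmod (F x) \<le> C) \<longleftrightarrow> (\<forall>x\<in>{\<alpha>..\<beta>}. cmod (G x) \<le> C)"
    if "\<alpha> \<in> Ioo_e a b" "\<beta> \<in> Ioo_e a b" for \<alpha> \<beta> C
    using assms Ioo_e_convex[OF that] by (intro ball_cong) auto
  ultimately show ?thesis by (simp add: locbdd_def)
qed

lemma locbdd_const: "(\<lambda>_. k) \<in> locbdd a b"
  by (auto intro!: locbddI exI[of _ "cmod k"])

lemma locbdd_add:
  assumes "F \<in> locbdd a b" "G \<in> locbdd a b"
  shows "(\<lambda>x. F x + G x) \<in> locbdd a b"
proof (rule locbddI)
  have "(\<lambda>x. indicator (Ioo_e a b) x *\<^sub>R F x + indicator (Ioo_e a b) x *\<^sub>R G x) \<in> borel_measurable borel"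
    using assms[THEN locbdd_meas] by measurable
  then show "(\<lambda>x. indicator (Ioo_e a b) x *\<^sub>R (F x + G x)) \<in> borel_measurable borel"
    by (simp add: scaleR_add_right)
  fix \<alpha> \<beta> assume ab: "\<alpha> \<in> Ioo_e a b" "\<beta> \<in> Ioo_e a b"
  obtain C where "\<And>x. x \<in> {\<alpha>..\<beta>} \<Longrightarrow> cmod (F x) \<le> C" using locbdd_bound[OF assms(1) ab] by metis
  moreover obtain D where "\<And>x. x \<in> {\<alpha>..\<beta>} \<Longrightarrow> cmod (G x) \<le> D" using locbdd_bound[OF assms(2) ab] by metis
  ultimately show "\<exists>C. \<forall>x\<in>{\<alpha>..\<beta>}. cmod (F x + G x) \<le> C"
    by (intro exI[of _ "C + D"]) (auto intro: norm_triangle_mono)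
qed

lemma locbdd_mult:
  assumes "F \<in> locbdd a b" "G \<in> locbdd a b"
  shows "(\<lambda>x. F x * G x) \<in> locbdd a b"
proof (rule locbddI)
  have "(\<lambda>x. (indicator (Ioo_e a b) x *\<^sub>R F x) * (indicator (Ioo_e a b) x *\<^sub>R G x)) \<in> borel_measurable borel"
    using assms[THEN locbdd_meas] by measurable
  also have "(\<lambda>x. (indicator (Ioo_e a b) x *\<^sub>R F x) * (indicator (Ioo_e a b) x *\<^sub>R G x)) =
      (\<lambda>x. indicator (Ioo_e a b) x *\<^sub>R (F x * G x))"
    by (auto simp: indicator_def)
  finally show "(\<lambda>x. indicator (Ioo_e a b) x *\<^sub>R (F x * G x)) \<in> borel_measurable borel" .
  fix \<alpha> \<beta> assume ab: "\<alpha> \<in> Ioo_e a b" "\<beta> \<in> Ioo_e a b"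
  obtain C where "0 \<le> C" "\<And>x. x \<in> {\<alpha>..\<beta>} \<Longrightarrow> cmod (F x) \<le> C" using locbdd_bound[OF assms(1) ab] by metis
  moreover obtain D where "\<And>x. x \<in> {\<alpha>..\<beta>} \<Longrightarrow> cmod (G x) \<le> D" using locbdd_bound[OF assms(2) ab] by metis
  ultimately show "\<exists>C. \<forall>x\<in>{\<alpha>..\<beta>}. cmod (F x * G x) \<le> C"
    by (intro exI[of _ "C * D"]) (auto simp: norm_mult intro: mult_mono)
qed

lemma locbdd_cnj:
  assumes "F \<in> locbdd a b"
  shows "(\<lambda>x. cnj (F x)) \<in> locbdd a b"
proof (rule locbddI)
  have "(\<lambda>x. cnj (indicator (Ioo_e a b) x *\<^sub>R F x)) \<in> borel_measurable borel"
    using assms[THEN locbdd_meas] by (intro borel_measurable_continuous_on[OF continuous_on_cnj]) auto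
  also have "(\<lambda>x. cnj (indicator (Ioo_e a b) x *\<^sub>R F x)) = (\<lambda>x. indicator (Ioo_e a b) x *\<^sub>R cnj (F x))"
    by (auto simp: indicator_def)
  finally show "(\<lambda>x. indicator (Ioo_e a b) x *\<^sub>R cnj (F x)) \<in> borel_measurable borel" .
qed (use assms in \<open>auto simp: locbdd_def\<close>)

lemma locbdd_of_real:
  assumes "s \<in> borel_measurable borel" "\<And>x. \<bar>s x\<bar> \<le> K"
  shows "(\<lambda>x. complex_of_real (s x)) \<in> locbdd a b"
  using assms by (intro locbddI) (auto intro!: exI[of _ K])

lemma locbdd_diff:
  assumes "F \<in> locbdd a b" "G \<in> locbdd a b"
  shows "(\<lambda>x. F x - G x) \<in> locbdd a b"
  using locbdd_add[OF assms(1) locbdd_mult[OF locbdd_const[of "-1"] assms(2)]] by simp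

section \<open>Primitives with respect to a locally finite measure\<close>

lemma Int_stable_Ico: "Int_stable (range (\<lambda>(a, b). {a ..< b :: real}))"
proof (rule Int_stableI)
  fix A B :: "real set"
  assume "A \<in> range (\<lambda>(a, b). {a ..< b})" "B \<in> range (\<lambda>(a, b). {a ..< b})"
  then obtain p q r s where "A = {p..<q}" "B = {r..<s}" by auto
  then have "A \<inter> B = (\<lambda>(a, b). {a ..< b}) (max p r, min q s)" by auto
  then show "A \<inter> B \<in> range (\<lambda>(a, b). {a ..< b})" by (rule range_eqI)
qed

text \<open>One locale for all three measures. Since the complement of the interval is null,
  almost-everywhere statements need not restrict to it.\<close>

locale locally_finite_on =
  fixes a b :: ereal and c :: real and M :: "real measure"
  assumes c_mem: "c \<in> Ioo_e a b"
    and sets_M [measurable_cong]: "sets M = sets borel"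
    and null_outside: "emeasure M (- Ioo_e a b) = 0"
    and finite_on_compact: "\<And>x y. a < ereal x \<Longrightarrow> ereal y < b \<Longrightarrow> emeasure M {x..y} < \<infinity>"
begin

abbreviation "J \<equiv> Ioo_e a b"

lemma space_M [simp]: "space M = UNIV"
  using sets_eq_imp_space_eq[OF sets_M] by simp

lemma AE_J: "AE x in M. x \<in> J"
  by (rule AE_I[of _ _ "- J"]) (auto simp: null_outside)

lemma finite_Icc: "x \<in> J \<Longrightarrow> y \<in> J \<Longrightarrow> emeasure M {x..y} < \<infinity>"
  using finite_on_compact by (auto simp: Ioo_e_def)

lemma exhaustion:
  obtains l u :: "nat \<Rightarrow> real" where "J = (\<Union>i. {l i..u i})" "incseq u" "decseq l"
    "\<And>i. l i \<in> J" "\<And>i. u i \<in> J" "\<And>i. l i < u i"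
proof -
  have "a < b" using c_mem by (auto simp: Ioo_e_def intro: less_trans)
  then obtain u l :: "nat \<Rightarrow> real" where *: "einterval a b = (\<Union>i. {l i .. u i})"
    "incseq u" "decseq l" "\<And>i. l i < u i" "\<And>i. a < l i" "\<And>i. u i < b"
    "l \<longlonglongrightarrow> a" "u \<longlonglongrightarrow> b"
    by (rule einterval_Icc_approximation) (rule that)
  have "l i \<in> J \<and> u i \<in> J" for i
    unfolding Ioo_e_eq_einterval *(1) using *(4)[of i] by (auto intro!: exI[of _ i])
  then show ?thesis using that[of l u] * by (auto simp: Ioo_e_eq_einterval)
qed

lemma sigma_finite: "sigma_finite_measure M"
proof -
  obtain l u :: "nat \<Rightarrow> real" where lu: "J = (\<Union>i. {l i..u i})" "\<And>i. l i \<in> J" "\<And>i. u i \<in> J"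
    by (rule exhaustion) (rule that)
  show ?thesis
  proof
    let ?A = "insert (- J) (range (\<lambda>i. {l i..u i}))"
    have "\<Union> ?A = UNIV" unfolding Union_insert using lu(1) by auto
    moreover have "\<forall>A\<in>?A. emeasure M A \<noteq> \<infinity>"
      using null_outside finite_Icc[OF lu(2,3)] by (auto simp: less_top)
    ultimately show "\<exists>A. countable A \<and> A \<subseteq> sets M \<and> \<Union> A = space M \<and> (\<forall>a\<in>A. emeasure M a \<noteq> \<infinity>)"
      by (intro exI[of _ ?A]) (auto simp: sets_M)
  qed
qed

lemma L1locD: "h \<in> L1loc a b M \<Longrightarrow> x \<in> J \<Longrightarrow> y \<in> J \<Longrightarrow> A \<in> sets borel \<Longrightarrow> A \<subseteq> {x..y} \<Longrightarrow> set_integrable M A h"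
  using set_integrable_subset[of M "{x..y}" h A] by (auto simp: L1loc_iff sets_M)

lemma L1loc_Ico: "h \<in> L1loc a b M \<Longrightarrow> x \<in> J \<Longrightarrow> y \<in> J \<Longrightarrow> set_integrable M {x..<y} h"
  by (rule L1locD[where x = x and y = y]) auto

text \<open>Members of \<open>L1loc\<close> are arbitrary outside the interval, so only the
  truncation can be measurable. It is the pointwise limit, eventually constant at each point, of
  truncations to exhausting compact intervals.\<close>

lemma L1loc_meas:
  assumes "h \<in> L1loc a b M"
  shows "(\<lambda>x. indicator J x *\<^sub>R h x) \<in> borel_measurable M"
proof -
  obtain l u :: "nat \<Rightarrow> real" where lu: "J = (\<Union>i. {l i..u i})" "incseq u" "decseq l"
    "\<And>i. l i \<in> J" "\<And>i. u i \<in> J"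
    by (rule exhaustion) (rule that)
  show ?thesis
  proof (rule borel_measurable_LIMSEQ_metric)
    show "(\<lambda>x. indicator {l i..u i} x *\<^sub>R h x) \<in> borel_measurable M" for i
      using assms lu(4,5) unfolding L1loc_iff set_integrable_def by (intro borel_measurable_integrable) blast
    show "(\<lambda>i. indicator {l i..u i} x *\<^sub>R h x) \<longlonglongrightarrow> indicator J x *\<^sub>R h x" for x
    proof (cases "x \<in> J")
      case True
      then obtain n where n: "l n \<le> x" "x \<le> u n" using lu(1) by auto
      have "eventually (\<lambda>i. indicator {l i..u i} x *\<^sub>R h x = indicator J x *\<^sub>R h x) sequentially"
        using eventually_ge_at_top[of n]
      proof eventually_elim
        case (elim i)
        then have "l i \<le> x" "x \<le> u i"
          using n incseqD[OF lu(2) elim] decseqD[OF lu(3) elim] by auto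
        then show ?case using True by simp
      qed
      then show ?thesis by (rule tendsto_eventually)
    next
      case False
      then have "indicator {l i..u i} x = (0::real)" for i using lu(1) by (simp add: indicator_def)
      with False show ?thesis by simp
    qed
  qed
qed

lemma L1locI:
  assumes "\<And>x y. x \<in> J \<Longrightarrow> y \<in> J \<Longrightarrow> x \<le> y \<Longrightarrow> set_integrable M {x..y} h"
  shows "h \<in> L1loc a b M"
  unfolding L1loc_iff
proof (intro ballI)
  fix x y assume "x \<in> J" "y \<in> J"
  then show "set_integrable M {x..y} h" using assms by (cases "x \<le> y") auto
qed

lemma L1loc_add: "f \<in> L1loc a b M \<Longrightarrow> g \<in> L1loc a b M \<Longrightarrow> (\<lambda>x. f x + g x) \<in> L1loc a b M"
  by (auto simp: L1loc_iff)

lemma L1loc_diff: "f \<in> L1loc a b M \<Longrightarrow> g \<in> L1loc a b M \<Longrightarrow> (\<lambda>x. f x - g x) \<in> L1loc a b M"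
  by (auto simp: L1loc_iff)

lemma L1loc_cmult: "f \<in> L1loc a b M \<Longrightarrow> (\<lambda>x. k * f x) \<in> L1loc a b M"
  by (auto simp: L1loc_iff)

lemma L1loc_cnj:
  assumes "f \<in> L1loc a b M"
  shows "(\<lambda>x. cnj (f x)) \<in> L1loc a b M"
proof -
  have *: "(\<lambda>x. indicator A x *\<^sub>R cnj (f x)) = (\<lambda>x. cnj (indicator A x *\<^sub>R f x))" for A
    by (auto simp: indicator_def)
  show ?thesis using assms unfolding L1loc_iff set_integrable_def *
    by (auto simp del: complex_cnj_scaleR)
qed

lemma L1loc_mult_locbdd:
  assumes h: "h \<in> L1loc a b M" and F: "F \<in> locbdd a b"
  shows "(\<lambda>x. h x * F x) \<in> L1loc a b M"
proof (rule L1locI)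
  fix x y assume xy: "x \<in> J" "y \<in> J" "x \<le> y"
  obtain C where C: "0 \<le> C" "\<And>t. t \<in> {x..y} \<Longrightarrow> cmod (F t) \<le> C" using locbdd_bound[OF F xy(1,2)] by metis
  show "set_integrable M {x..y} (\<lambda>x. h x * F x)"
  proof (rule set_integrable_bound)
    show "set_integrable M {x..y} (\<lambda>t. complex_of_real C * h t)"
      using h xy by (auto simp: L1loc_iff)
    have "(\<lambda>t. indicator {x..y} t *\<^sub>R ((indicator J t *\<^sub>R h t) * (indicator J t *\<^sub>R F t))) \<in> borel_measurable M"
      using L1loc_meas[OF h] locbdd_meas[OF F] by measurable
    also have "(\<lambda>t. indicator {x..y} t *\<^sub>R ((indicator J t *\<^sub>R h t) * (indicator J t *\<^sub>R F t))) =
        (\<lambda>t. indicator {x..y} t *\<^sub>R (h t * F t))"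
      using Ioo_e_convex[OF xy(1,2)] by (auto simp: indicator_def)
    finally show "set_borel_measurable M {x..y} (\<lambda>x. h x * F x)"
      by (simp add: set_borel_measurable_def)
    show "AE t in M. t \<in> {x..y} \<longrightarrow> norm (h t * F t) \<le> norm (complex_of_real C * h t)"
      using C by (auto simp: norm_mult mult.commute[of C] intro!: mult_left_mono)
  qed
qed

lemma L1loc_one: "(\<lambda>_. 1) \<in> L1loc a b M"
proof (rule L1locI)
  fix x y assume "x \<in> J" "y \<in> J"
  then show "set_integrable M {x..y} (\<lambda>_. 1::complex)"
    unfolding set_integrable_def using finite_Icc
    by (intro integrable_scaleR_left integrable_real_indicator) (auto simp: sets_M)
qed

lemma locbdd_L1loc: "F \<in> locbdd a b \<Longrightarrow> F \<in> L1loc a b M"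
  using L1loc_mult_locbdd[OF L1loc_one] by simp

text \<open>Signed indicator that writes \<open>mint\<close> as a single integral over the line. It
  removes the case distinction on the position of \<open>x\<close> relative to \<open>c\<close> and
  is jointly measurable in both variables.\<close>

definition kern :: "real \<Rightarrow> real \<Rightarrow> real" where
  "kern x t = indicator {c..<x} t - indicator {x..<c} t"

lemma mint_kern:
  assumes h: "h \<in> L1loc a b M" and x: "x \<in> J"
  shows "integrable M (\<lambda>t. kern x t *\<^sub>R h t)" "mint M c x h = (\<integral>t. kern x t *\<^sub>R h t \<partial>M)"
proof -
  have 1: "integrable M (\<lambda>t. indicator {c..<x} t *\<^sub>R h t)"
    using L1loc_Ico[OF h c_mem x] by (simp add: set_integrable_def)
  have 2: "integrable M (\<lambda>t. indicator {x..<c} t *\<^sub>R h t)"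
    using L1loc_Ico[OF h x c_mem] by (simp add: set_integrable_def)
  show "integrable M (\<lambda>t. kern x t *\<^sub>R h t)"
    unfolding kern_def scaleR_diff_left using 1 2 by (rule Bochner_Integration.integrable_diff)
  show "mint M c x h = (\<integral>t. kern x t *\<^sub>R h t \<partial>M)"
    unfolding kern_def scaleR_diff_left Bochner_Integration.integral_diff[OF 1 2]
    by (auto simp: mint_def set_lebesgue_integral_def)
qed

lemma mint_diff_Ico:
  assumes h: "h \<in> L1loc a b M" and "x \<in> J" "y \<in> J" "x \<le> y"
  shows "mint M c y h - mint M c x h = (LINT t:{x..<y}|M. h t)"
proof -
  have "mint M c y h - mint M c x h = (\<integral>t. kern y t *\<^sub>R h t - kern x t *\<^sub>R h t \<partial>M)"
    using mint_kern[OF h] assms by (simp add: Bochner_Integration.integral_diff)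
  also have "(\<lambda>t. kern y t *\<^sub>R h t - kern x t *\<^sub>R h t) = (\<lambda>t. indicator {x..<y} t *\<^sub>R h t)"
    using \<open>x \<le> y\<close> by (auto simp: kern_def indicator_def fun_eq_iff)
  finally show ?thesis by (simp add: set_lebesgue_integral_def)
qed

lemma mint_base [simp]: "mint M c c h = 0"
  by (simp add: mint_def)

lemma mint_add:
  "f \<in> L1loc a b M \<Longrightarrow> g \<in> L1loc a b M \<Longrightarrow> x \<in> J \<Longrightarrow>
    mint M c x (\<lambda>t. f t + g t) = mint M c x f + mint M c x g"
  by (simp add: mint_kern L1loc_add scaleR_add_right)

lemma mint_diff:
  "f \<in> L1loc a b M \<Longrightarrow> g \<in> L1loc a b M \<Longrightarrow> x \<in> J \<Longrightarrow>
    mint M c x (\<lambda>t. f t - g t) = mint M c x f - mint M c x g"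
  by (simp add: mint_kern L1loc_diff scaleR_diff_right)

lemma mint_cmult: "mint M c x (\<lambda>t. k * f t) = k * mint M c x f"
  by (simp add: mint_def)

lemma mint_cnj: "mint M c x (\<lambda>t. cnj (f t)) = cnj (mint M c x f)"
proof -
  have "(LINT t:A|M. cnj (f t)) = cnj (LINT t:A|M. f t)" for A
    unfolding set_lebesgue_integral_def by (simp flip: integral_cnj complex_cnj_scaleR)
  then show ?thesis by (simp add: mint_def)
qed

lemma mint_cong_AE:
  assumes f: "f \<in> L1loc a b M" and g: "g \<in> L1loc a b M" and ae: "AE x in M. f x = g x" and x: "x \<in> J"
  shows "mint M c x f = mint M c x g"
  unfolding mint_kern(2)[OF f x] mint_kern(2)[OF g x]
  by (rule integral_cong_AE) (use mint_kern(1)[OF f x] mint_kern(1)[OF g x] ae in auto)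

lemma mint_cong:
  assumes "\<And>t. t \<in> J \<Longrightarrow> f t = g t" "x \<in> J"
  shows "mint M c x f = mint M c x g"
proof -
  have "(LINT t:{p..<q}|M. f t) = (LINT t:{p..<q}|M. g t)" if "p \<in> J" "q \<in> J" for p q
    using assms Ioo_e_convex[OF that] by (intro set_lebesgue_integral_cong) (auto simp: sets_M)
  then show ?thesis using assms c_mem by (simp add: mint_def)
qed

text \<open>Half-open intervals form an intersection-stable generator of the Borel sets, so Dynkin
  induction extends the vanishing of the integrals from them to all Borel sets. This is the
  uniqueness behind every Radon-Nikodym derivative below.\<close>

lemma density_unique_Ico:
  assumes h: "h \<in> L1loc a b M" and zero: "\<And>x. x \<in> J \<Longrightarrow> mint M c x h = 0"
  shows "AE x in M. h x = 0"
proof -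
  have Ico: "(LINT t:{x..<y}|M. h t) = 0" if "x \<in> J" "y \<in> J" for x y
    using mint_diff_Ico[OF h that] zero that by (cases "x \<le> y") (auto simp: set_lebesgue_integral_def)
  have on_Ico: "AE t in M. indicator {x..<y} t *\<^sub>R h t = 0" if xy: "x \<in> J" "y \<in> J" for x y
  proof -
    \<comment> \<open>\<open>h\<close> is only locally integrable; truncation to one window makes
      the integral over every Borel set meaningful, as the complement step requires.\<close>
    define k where "k t = indicator {x..<y} t *\<^sub>R h t" for t
    have int: "integrable M k"
      using L1loc_Ico[OF h xy] unfolding k_def by (simp add: set_integrable_def)
    then have sint: "set_integrable M A k" if "A \<in> sets borel" for A
      using that integrable_mult_indicator[of A M k] by (simp add: set_integrable_def sets_M)
    have total: "integral\<^sup>L M k = 0"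
      using Ico[OF xy] unfolding k_def by (simp add: set_lebesgue_integral_def)
    have "(LINT t:A|M. k t) = 0" if "A \<in> sets M" for A
    proof -
      have A: "A \<in> sigma_sets UNIV (range (\<lambda>(a, b). {a ..< b :: real}))"
        using that sets_M borel_eq_atLeastLessThan by (metis UNIV_I sets_measure_of subset_UNIV top_greatest Pow_UNIV)
      have sub: "range (\<lambda>(a, b). {a ..< b :: real}) \<subseteq> Pow UNIV" by simp
      from Int_stable_Ico sub A show ?thesis
      proof (induct rule: sigma_sets_induct_disjoint)
        case (basic B)
        then obtain p q where B: "B = {p..<q}" by auto
        have "indicator B t *\<^sub>R k t = indicator {max p x..<min q y} t *\<^sub>R h t" for t
          unfolding k_def B by (auto simp: indicator_def)
        then have eq: "(LINT t:B|M. k t) = (LINT t:{max p x..<min q y}|M. h t)"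
          by (simp add: set_lebesgue_integral_def)
        show ?case
        proof (cases "max p x < min q y")
          case True
          then show ?thesis unfolding eq
            by (intro Ico Ioo_e_convex[OF xy]) auto
        next
          case False
          then show ?thesis unfolding eq by (auto simp: set_lebesgue_integral_def)
        qed
      next
        case (compl B)
        have B: "B \<in> sets borel"
          using compl(1) by (metis borel_eq_atLeastLessThan sets_measure_of subset_UNIV Pow_UNIV)
        have "(LINT t:B \<union> (UNIV - B)|M. k t) = (LINT t:B|M. k t) + (LINT t:UNIV - B|M. k t)"
          by (rule set_integral_Un) (use B in \<open>auto intro: sint\<close>)
        then show ?case using compl total by (simp add: set_lebesgue_integral_def)
      next
        case (union B)
        then have B: "B i \<in> sets borel" for i
          by (metis borel_eq_atLeastLessThan sets_measure_of subset_UNIV Pow_UNIV rangeI subsetD)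
        have "(LINT t:(\<Union>i. B i)|M. k t) = (\<Sum>i. LINT t:B i|M. k t)"
          by (rule lebesgue_integral_countable_add)
            (use B union in \<open>auto intro!: sint simp: sets_M disjoint_family_on_def\<close>)
        then show ?case using union by simp
      qed (simp add: set_lebesgue_integral_def)
    qed
    from sigma_finite_measure.density_zero[OF sigma_finite int this] show ?thesis by (simp add: k_def)
  qed
  \<comment> \<open>Rational windows are countably many and still surround every point of
    \<open>J\<close>, which yields one common null set.\<close>
  have "AE t in M. \<forall>p\<in>\<rat> \<inter> J. \<forall>q\<in>\<rat> \<inter> J. indicator {p..<q} t *\<^sub>R h t = 0"
    unfolding AE_ball_countable[OF countable_Int1[OF countable_rat]] using on_Ico by blast
  with AE_J show ?thesis
  proof eventually_elim
    case (elim t)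
    obtain p q where pq: "p \<in> J" "p < t" "q \<in> J" "t < q"
      using Ioo_e_less[OF elim(1)] Ioo_e_greater[OF elim(1)] by blast
    obtain r where r: "r \<in> \<rat>" "p < r" "r < t" using Rats_dense_in_real[OF pq(2)] by blast
    obtain s where s: "s \<in> \<rat>" "t < s" "s < q" using Rats_dense_in_real[OF pq(4)] by blast
    have "r \<in> J" "s \<in> J" using pq r s by (auto intro: Ioo_e_convex[OF pq(1,3)])
    then have "indicator {r..<s} t *\<^sub>R h t = 0" using elim(2) r s by blast
    then show ?case using r s by auto
  qed
qed

end

context locally_finite_on
begin

lemma kern_cases: "kern x t = (if c \<le> t \<and> t < x then 1 else 0) - (if x \<le> t \<and> t < c then 1 else 0)"
  by (auto simp: kern_def indicator_def)

lemma kern_outside: "x \<in> J \<Longrightarrow> t \<notin> J \<Longrightarrow> kern x t = 0"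
  using Ioo_e_convex[OF c_mem, of x t] Ioo_e_convex[OF _ c_mem, of x t] by (auto simp: kern_cases)

lemma mint_bound:
  assumes h: "h \<in> L1loc a b M" and "\<alpha> \<in> J" "\<beta> \<in> J" "\<alpha> \<le> c" "c \<le> \<beta>" "x \<in> {\<alpha>..\<beta>}"
  shows "cmod (mint M c x h) \<le> (LINT t:{\<alpha>..<\<beta>}|M. cmod (h t))"
proof -
  have x: "x \<in> J" using assms by (auto intro: Ioo_e_convex[of \<alpha> a b \<beta>])
  have "integrable M (\<lambda>t. norm (indicator {\<alpha>..<\<beta>} t *\<^sub>R h t))"
    using L1loc_Ico[OF h \<open>\<alpha> \<in> J\<close> \<open>\<beta> \<in> J\<close>] unfolding set_integrable_def by (rule integrable_norm)
  then have int: "integrable M (\<lambda>t. indicator {\<alpha>..<\<beta>} t *\<^sub>R cmod (h t))" by simp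
  show ?thesis
    unfolding mint_kern(2)[OF h x] set_lebesgue_integral_def
    by (rule Bochner_Integration.integral_norm_bound_integral[OF mint_kern(1)[OF h x] int])
      (use assms in \<open>auto simp: kern_cases indicator_def\<close>)
qed

text \<open>Measurability of a primitive is that of a parametrised integral with the jointly
  measurable kernel \<open>kern\<close>. For boundedness the interval is first enlarged to contain
  the base point.\<close>

lemma mint_locbdd:
  assumes h: "h \<in> L1loc a b M"
  shows "(\<lambda>x. mint M c x h) \<in> locbdd a b"
proof (rule locbddI)
  interpret sigma_finite_measure M by (rule sigma_finite)
  have [measurable]: "(\<lambda>x. indicator J x *\<^sub>R h x) \<in> borel_measurable M" by (rule L1loc_meas[OF h])
  have [measurable]: "(\<lambda>p. kern (fst p) (snd p)) \<in> borel_measurable (borel \<Otimes>\<^sub>M M)"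
    unfolding kern_cases by measurable
  have "(\<lambda>p. kern (fst p) (snd p) *\<^sub>R (indicator J (snd p) *\<^sub>R h (snd p))) \<in> borel_measurable (borel \<Otimes>\<^sub>M M)"
    by measurable
  then have [measurable]: "(\<lambda>(x, t). kern x t *\<^sub>R (indicator J t *\<^sub>R h t)) \<in> borel_measurable (borel \<Otimes>\<^sub>M M)"
    by (simp add: split_beta)
  have "(\<lambda>x. \<integral>t. kern x t *\<^sub>R (indicator J t *\<^sub>R h t) \<partial>M) \<in> borel_measurable borel"
    by (rule borel_measurable_lebesgue_integral) measurable
  then have "(\<lambda>x. indicator J x *\<^sub>R (\<integral>t. kern x t *\<^sub>R (indicator J t *\<^sub>R h t) \<partial>M)) \<in> borel_measurable borel"
    by measurable
  also have "(\<lambda>x. indicator J x *\<^sub>R (\<integral>t. kern x t *\<^sub>R (indicator J t *\<^sub>R h t) \<partial>M)) =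
      (\<lambda>x. indicator J x *\<^sub>R mint M c x h)"
  proof
    fix x
    have "(\<integral>t. kern x t *\<^sub>R (indicator J t *\<^sub>R h t) \<partial>M) = (\<integral>t. kern x t *\<^sub>R h t \<partial>M)" if "x \<in> J"
    proof (rule Bochner_Integration.integral_cong[OF refl])
      show "kern x t *\<^sub>R (indicator J t *\<^sub>R h t) = kern x t *\<^sub>R h t" for t
        using kern_outside[OF that, of t] by (cases "t \<in> J") auto
    qed
    then show "indicator J x *\<^sub>R (\<integral>t. kern x t *\<^sub>R (indicator J t *\<^sub>R h t) \<partial>M) = indicator J x *\<^sub>R mint M c x h"
      using mint_kern(2)[OF h] by (cases "x \<in> J") simp_all
  qed
  finally show "(\<lambda>x. indicator J x *\<^sub>R mint M c x h) \<in> borel_measurable borel" .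
next
  fix \<alpha> \<beta> assume "\<alpha> \<in> J" "\<beta> \<in> J"
  then show "\<exists>C. \<forall>x\<in>{\<alpha>..\<beta>}. cmod (mint M c x h) \<le> C"
    using c_mem by (intro exI[of _ "LINT t:{min \<alpha> c..<max \<beta> c}|M. cmod (h t)"] ballI
        mint_bound[OF h, of "min \<alpha> c" "max \<beta> c"])
      (auto simp: Ioo_e_min_max min_le_iff_disj le_max_iff_disj)
qed

section \<open>Tails, limits at the endpoints and compactly supported integrands\<close>

lemma integral_tails:
  assumes w: "set_integrable M J w" and e: "0 < e"
  obtains \<alpha> \<beta> where "\<alpha> \<in> J" "\<beta> \<in> J"
    "\<And>A. A \<in> sets borel \<Longrightarrow> A \<subseteq> J \<Longrightarrow> A \<inter> {\<alpha>..\<beta>} = {} \<Longrightarrow> norm (LINT x:A|M. w x :: complex) < e"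
proof -
  obtain l u :: "nat \<Rightarrow> real" where lu: "J = (\<Union>i. {l i..u i})" "incseq u" "decseq l"
    "\<And>i. l i \<in> J" "\<And>i. u i \<in> J"
    by (rule exhaustion) (rule that)
  define v where "v x = norm (w x)" for x
  have v: "set_integrable M J v"
    using integrable_norm[OF w[unfolded set_integrable_def]] by (simp add: set_integrable_def v_def)
  have vi: "set_integrable M A v" if "A \<in> sets borel" "A \<subseteq> J" for A
    by (rule set_integrable_subset[OF v]) (use that in \<open>auto simp: sets_M\<close>)
  have wi: "set_integrable M A w" if "A \<in> sets borel" "A \<subseteq> J" for A
    by (rule set_integrable_subset[OF w]) (use that in \<open>auto simp: sets_M\<close>)
  have "incseq (\<lambda>i. {l i..u i})"
    using lu(2,3) by (fastforce simp: incseq_def decseq_def intro: order_trans)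
  then have "(\<lambda>i. LINT x:{l i..u i}|M. v x) \<longlonglongrightarrow> (LINT x:(\<Union>i. {l i..u i})|M. v x)"
    using v lu(1) by (intro set_integral_cont_up) (auto simp: sets_M)
  then have "eventually (\<lambda>i. (LINT x:J|M. v x) - e < (LINT x:{l i..u i}|M. v x)) sequentially"
    unfolding lu(1)[symmetric] using e by (intro order_tendstoD(1)) auto
  then obtain i where i: "(LINT x:J|M. v x) - e < (LINT x:{l i..u i}|M. v x)"
    by (auto simp: eventually_at_top_linorder)
  show ?thesis
  proof (rule that[OF lu(4)[of i] lu(5)[of i]])
    fix A assume A: "A \<in> sets borel" "A \<subseteq> J" "A \<inter> {l i..u i} = {}"
    have sub: "{l i..u i} \<subseteq> J" using lu(1) by blast
    have "norm (LINT x:A|M. w x) \<le> (LINT x:A|M. v x)"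
      unfolding set_lebesgue_integral_def
      by (rule Bochner_Integration.integral_norm_bound_integral)
        (use wi[OF A(1,2)] vi[OF A(1,2)] in \<open>auto simp: set_integrable_def v_def\<close>)
    also have "\<dots> = (LINT x:A \<union> {l i..u i}|M. v x) - (LINT x:{l i..u i}|M. v x)"
      using A vi[OF A(1,2)] vi[OF _ sub] by (simp add: set_integral_Un)
    also have "(LINT x:A \<union> {l i..u i}|M. v x) \<le> (LINT x:J|M. v x)"
      unfolding set_lebesgue_integral_def
      by (rule integral_mono)
        (use v vi[of "A \<union> {l i..u i}"] A sub in \<open>auto simp: set_integrable_def v_def indicator_def\<close>)
    finally show "norm (LINT x:A|M. w x) < e" using i by simp
  qed
qed

lemma set_integrable_J_subset:
  fixes w :: "real \<Rightarrow> 'z :: {banach, second_countable_topology}"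
  shows "set_integrable M J w \<Longrightarrow> A \<in> sets borel \<Longrightarrow> A \<subseteq> J \<Longrightarrow> set_integrable M A w"
  by (erule set_integrable_subset) (auto simp: sets_M)

lemma set_integrable_J_L1loc:
  assumes "set_integrable M J w"
  shows "w \<in> L1loc a b M"
proof (rule L1locI)
  fix x y assume "x \<in> J" "y \<in> J"
  from Ioo_e_convex[OF this] show "set_integrable M {x..y} w"
    by (intro set_integrable_J_subset[OF assms]) auto
qed

text \<open>Since \<open>mint\<close> runs over \<open>[c, x)\<close>, an atom at \<open>c\<close>
  belongs to the right half; the left limit accordingly runs over \<open>t < c\<close>, with the
  sign of the reversed orientation.\<close>

lemma mint_tendsto_rend:
  assumes w: "set_integrable M J w"
  shows "((\<lambda>x. mint M c x w) \<longlongrightarrow> (LINT t:{t\<in>J. c \<le> t}|M. w t)) (at_rend b)"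
proof (rule tendstoI)
  fix e :: real assume "0 < e"
  obtain \<alpha> \<beta> where ab: "\<alpha> \<in> J" "\<beta> \<in> J" and small: "\<And>A. A \<in> sets borel \<Longrightarrow> A \<subseteq> J \<Longrightarrow>
      A \<inter> {\<alpha>..\<beta>} = {} \<Longrightarrow> norm (LINT x:A|M. w x) < e"
    by (rule integral_tails[OF w \<open>0 < e\<close>]) (rule that)
  have "max \<beta> c \<in> J" using ab c_mem by (simp add: Ioo_e_min_max)
  from eventually_at_rend[OF this]
  show "eventually (\<lambda>x. dist (mint M c x w) (LINT t:{t\<in>J. c \<le> t}|M. w t) < e) (at_rend b)"
  proof eventually_elim
    case (elim x)
    then have x: "x \<in> J" "c \<le> x" "\<beta> < x" by auto
    have "{t\<in>J. c \<le> t} = {c..<x} \<union> {t\<in>J. x \<le> t}"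
      using Ioo_e_convex[OF c_mem x(1)] x(2) by (auto simp: less_imp_le)
    moreover have "(LINT t:{c..<x} \<union> {t\<in>J. x \<le> t}|M. w t) = (LINT t:{c..<x}|M. w t) + (LINT t:{t\<in>J. x \<le> t}|M. w t)"
      by (rule set_integral_Un) (auto intro!: set_integrable_J_subset[OF w] intro: Ioo_e_convex[OF c_mem x(1)])
    ultimately have "(LINT t:{t\<in>J. c \<le> t}|M. w t) = mint M c x w + (LINT t:{t\<in>J. x \<le> t}|M. w t)"
      using mint_diff_Ico[OF set_integrable_J_L1loc[OF w] c_mem x(1,2)] by simp
    moreover have "{t\<in>J. x \<le> t} \<inter> {\<alpha>..\<beta>} = {}" using x by auto
    ultimately show ?case using small[of "{t\<in>J. x \<le> t}"] by (auto simp: dist_norm)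
  qed
qed

lemma mint_tendsto_lend:
  assumes w: "set_integrable M J w"
  shows "((\<lambda>x. mint M c x w) \<longlongrightarrow> - (LINT t:{t\<in>J. t < c}|M. w t)) (at_lend a)"
proof (rule tendstoI)
  fix e :: real assume "0 < e"
  obtain \<alpha> \<beta> where ab: "\<alpha> \<in> J" "\<beta> \<in> J" and small: "\<And>A. A \<in> sets borel \<Longrightarrow> A \<subseteq> J \<Longrightarrow>
      A \<inter> {\<alpha>..\<beta>} = {} \<Longrightarrow> norm (LINT x:A|M. w x) < e"
    by (rule integral_tails[OF w \<open>0 < e\<close>]) (rule that)
  have "min \<alpha> c \<in> J" using ab c_mem by (simp add: Ioo_e_min_max)
  from eventually_at_lend[OF this]
  show "eventually (\<lambda>x. dist (mint M c x w) (- (LINT t:{t\<in>J. t < c}|M. w t)) < e) (at_lend a)"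
  proof eventually_elim
    case (elim x)
    then have x: "x \<in> J" "x \<le> c" "x < \<alpha>" by auto
    have "{t\<in>J. t < c} = {t\<in>J. t < x} \<union> {x..<c}"
      using Ioo_e_convex[OF x(1) c_mem] x(2) by (auto simp: less_imp_le)
    moreover have "(LINT t:{t\<in>J. t < x} \<union> {x..<c}|M. w t) = (LINT t:{t\<in>J. t < x}|M. w t) + (LINT t:{x..<c}|M. w t)"
      by (rule set_integral_Un) (auto intro!: set_integrable_J_subset[OF w] intro: Ioo_e_convex[OF x(1) c_mem])
    ultimately have "(LINT t:{t\<in>J. t < c}|M. w t) = (LINT t:{t\<in>J. t < x}|M. w t) - mint M c x w"
      using mint_diff_Ico[OF set_integrable_J_L1loc[OF w] x(1) c_mem x(2)] by simp
    moreover have "{t\<in>J. t < x} \<inter> {\<alpha>..\<beta>} = {}" using x by auto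
    ultimately show ?case using small[of "{t\<in>J. t < x}"] by (auto simp: dist_norm)
  qed
qed

lemma integral_split_at_base:
  fixes w :: "real \<Rightarrow> complex"
  assumes w: "set_integrable M J w"
  shows "(LINT t:{t\<in>J. t < c}|M. w t) + (LINT t:{t\<in>J. c \<le> t}|M. w t) = (LINT t:J|M. w t)"
proof -
  have J: "J = {t\<in>J. t < c} \<union> {t\<in>J. c \<le> t}" by auto
  show ?thesis
    by (subst (3) J, rule set_integral_Un[symmetric]) (auto intro!: set_integrable_J_subset[OF w])
qed

text \<open>Writes a global integral as a difference of two \<open>mint\<close> values, so that an
  integration by parts formula can be evaluated at both ends of the support and subtracted.\<close>

lemma integral_compact_support:
  assumes w: "w \<in> L1loc a b M" and ab: "\<alpha> \<in> J" "\<beta> \<in> J" "\<alpha> \<le> \<beta>"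
    and zero: "AE t in M. t \<notin> {\<alpha>..<\<beta>} \<longrightarrow> w t = 0"
  shows "set_integrable M J w" "(LINT t:J|M. w t) = mint M c \<beta> w - mint M c \<alpha> w"
proof -
  have int: "integrable M (\<lambda>t. indicator {\<alpha>..<\<beta>} t *\<^sub>R w t)"
    using L1loc_Ico[OF w ab(1,2)] by (simp add: set_integrable_def)
  have meas: "(\<lambda>t. indicator J t *\<^sub>R w t) \<in> borel_measurable M" by (rule L1loc_meas[OF w])
  have eq: "AE t in M. indicator {\<alpha>..<\<beta>} t *\<^sub>R w t = indicator J t *\<^sub>R w t"
    using zero by eventually_elim (use Ioo_e_convex[OF ab(1,2)] in \<open>auto simp: indicator_def\<close>)
  show "set_integrable M J w"
    unfolding set_integrable_def using int meas eq by (subst integrable_cong_AE) (auto elim!: eventually_mono)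
  show "(LINT t:J|M. w t) = mint M c \<beta> w - mint M c \<alpha> w"
    unfolding mint_diff_Ico[OF w ab] set_lebesgue_integral_def
    using int meas eq by (intro integral_cong_AE) (auto elim!: eventually_mono)
qed

section \<open>Square-integrable functions on the interval and Cauchy-Schwarz\<close>

definition L2on :: "(real \<Rightarrow> complex) set" where
  "L2on = {f \<in> L1loc a b M. set_integrable M J (\<lambda>x. (cmod (f x))\<^sup>2)}"

lemma L2on_L1loc: "f \<in> L2on \<Longrightarrow> f \<in> L1loc a b M"
  by (simp add: L2on_def)

lemma L2on_square: "f \<in> L2on \<Longrightarrow> set_integrable M J (\<lambda>x. (cmod (f x))\<^sup>2)"
  by (simp add: L2on_def)

lemma L1loc_set_meas:
  assumes "h \<in> L1loc a b M" "A \<in> sets borel" "A \<subseteq> J"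
  shows "set_borel_measurable M A h"
proof (rule set_borel_measurable_subset)
  show "set_borel_measurable M J h"
    using L1loc_meas[OF assms(1)] by (simp add: set_borel_measurable_def)
qed (use assms in \<open>auto simp: sets_M\<close>)

lemma set_meas_mult:
  fixes f g :: "real \<Rightarrow> complex"
  assumes "set_borel_measurable M A f" "set_borel_measurable M A g"
  shows "set_borel_measurable M A (\<lambda>x. f x * g x)"
proof -
  have "(\<lambda>x. indicator A x *\<^sub>R (f x * g x)) = (\<lambda>x. (indicator A x *\<^sub>R f x) * (indicator A x *\<^sub>R g x))"
    by (auto simp: indicator_def)
  with borel_measurable_times[OF assms[unfolded set_borel_measurable_def]] show ?thesis
    by (simp only: set_borel_measurable_def)
qed

lemma set_meas_cmod_square:
  fixes f :: "real \<Rightarrow> complex"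
  assumes "set_borel_measurable M A f"
  shows "set_borel_measurable M A (\<lambda>x. (cmod (f x))\<^sup>2)"
proof -
  have "(\<lambda>x. indicator A x *\<^sub>R (cmod (f x))\<^sup>2) = (\<lambda>x. (cmod (indicator A x *\<^sub>R f x))\<^sup>2)"
    by (auto simp: indicator_def)
  moreover have "(\<lambda>x. (cmod (indicator A x *\<^sub>R f x))\<^sup>2) \<in> borel_measurable M"
    using assms unfolding set_borel_measurable_def by measurable
  ultimately show ?thesis by (simp only: set_borel_measurable_def)
qed

lemma L2on_add:
  assumes "f \<in> L2on" "g \<in> L2on"
  shows "(\<lambda>x. f x + g x) \<in> L2on"
proof -
  have L: "(\<lambda>x. f x + g x) \<in> L1loc a b M" using assms by (intro L1loc_add L2on_L1loc)
  have "set_integrable M J (\<lambda>x. (cmod (f x + g x))\<^sup>2)"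
  proof (rule set_integrable_bound)
    show "set_integrable M J (\<lambda>x. 2 * (cmod (f x))\<^sup>2 + 2 * (cmod (g x))\<^sup>2)"
      using assms[THEN L2on_square] by (intro set_integral_add) auto
    show "set_borel_measurable M J (\<lambda>x. (cmod (f x + g x))\<^sup>2)"
      by (rule set_meas_cmod_square, rule L1loc_set_meas[OF L]) auto
  qed (auto intro: cmod_add_square_le)
  with L show ?thesis by (simp add: L2on_def)
qed

lemma L2on_cmult: "f \<in> L2on \<Longrightarrow> (\<lambda>x. k * f x) \<in> L2on"
  by (auto simp: L2on_def L1loc_cmult norm_mult power_mult_distrib)

lemma L2on_cnj: "f \<in> L2on \<Longrightarrow> (\<lambda>x. cnj (f x)) \<in> L2on"
  by (auto simp: L2on_def L1loc_cnj)

lemma L2on_zero: "(\<lambda>x. 0) \<in> L2on"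
  using locbdd_L1loc[OF locbdd_const[of 0]] by (simp add: L2on_def set_integrable_def)

lemma L2on_mult_integrable:
  assumes f: "f \<in> L2on" and g: "g \<in> L2on" and A: "A \<in> sets borel" "A \<subseteq> J"
  shows "set_integrable M A (\<lambda>x. f x * g x)"
proof (rule set_integrable_bound)
  show "set_integrable M A (\<lambda>x. (cmod (f x))\<^sup>2 + (cmod (g x))\<^sup>2)"
    by (intro set_integral_add set_integrable_J_subset[OF L2on_square[OF f] A]
        set_integrable_J_subset[OF L2on_square[OF g] A])
  have "cmod (f x * g x) \<le> (cmod (f x))\<^sup>2 + (cmod (g x))\<^sup>2" for x
    using sum_squares_bound[of "cmod (f x)" "cmod (g x)"]
      mult_nonneg_nonneg[OF norm_ge_zero norm_ge_zero, of "f x" "g x"] unfolding norm_mult by linarith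
  then show "AE x in M. x \<in> A \<longrightarrow> norm (f x * g x) \<le> norm ((cmod (f x))\<^sup>2 + (cmod (g x))\<^sup>2)"
    by simp
qed (intro set_meas_mult L1loc_set_meas L2on_L1loc f g A)

lemma semi_inner_space_L2on:
  assumes A: "A \<in> sets borel" "A \<subseteq> J"
  shows "semi_inner_space L2on (\<lambda>f g. LINT x:A|M. f x * cnj (g x))"
proof
  fix f g h :: "real \<Rightarrow> complex" and k
  assume f: "f \<in> L2on"
  show "(\<lambda>x. k * f x) \<in> L2on" by (rule L2on_cmult[OF f])
  have "(LINT x:A|M. f x * cnj (f x)) = (LINT x:A|M. complex_of_real ((cmod (f x))\<^sup>2))"
    by (simp only: complex_norm_square)
  also have "\<dots> = complex_of_real (LINT x:A|M. (cmod (f x))\<^sup>2)" by (rule set_integral_complex_of_real)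
  finally show "0 \<le> Re (LINT x:A|M. f x * cnj (f x))"
    by (simp add: set_lebesgue_integral_def)
  assume g: "g \<in> L2on"
  show "(\<lambda>x. f x + g x) \<in> L2on" by (rule L2on_add[OF f g])
  show "(LINT x:A|M. g x * cnj (f x)) = cnj (LINT x:A|M. f x * cnj (g x))"
  proof -
    have "(\<lambda>x. indicator A x *\<^sub>R (g x * cnj (f x))) = (\<lambda>x. cnj (indicator A x *\<^sub>R (f x * cnj (g x))))"
      by (auto simp: mult.commute)
    then show ?thesis unfolding set_lebesgue_integral_def by (simp del: complex_cnj_scaleR complex_cnj_mult)
  qed
  assume h: "h \<in> L2on"
  show "(LINT x:A|M. (f x + g x) * cnj (h x)) = (LINT x:A|M. f x * cnj (h x)) + (LINT x:A|M. g x * cnj (h x))"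
    unfolding distrib_right by (intro set_integral_add L2on_mult_integrable f g L2on_cnj h A)
next
  fix f h :: "real \<Rightarrow> complex" and k
  show "(LINT x:A|M. k * f x * cnj (h x)) = k * (LINT x:A|M. f x * cnj (h x))"
    by (simp add: mult.assoc)
qed (rule L2on_zero)

lemma set_integral_cmod_square:
  "Re (LINT x:A|M. f x * cnj (f x)) = (LINT x:A|M. (cmod (f x))\<^sup>2)"
proof -
  have "(LINT x:A|M. f x * cnj (f x)) = (LINT x:A|M. complex_of_real ((cmod (f x))\<^sup>2))"
    by (simp only: complex_norm_square)
  then show ?thesis unfolding set_integral_complex_of_real by simp
qed

text \<open>The norms run over the whole interval although the integral runs over \<open>A\<close>:
  this is what makes one-sided integrals bounded functionals on H1.\<close>

lemma L2on_Cauchy_Schwarz: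
  assumes f: "f \<in> L2on" and g: "g \<in> L2on" and A: "A \<in> sets borel" "A \<subseteq> J"
  shows "(cmod (LINT x:A|M. f x * g x))\<^sup>2 \<le> (LINT x:J|M. (cmod (f x))\<^sup>2) * (LINT x:J|M. (cmod (g x))\<^sup>2)"
proof -
  interpret semi_inner_space L2on "\<lambda>f g. LINT x:A|M. f x * cnj (g x)"
    by (rule semi_inner_space_L2on[OF A])
  have mono: "(LINT x:A|M. (cmod (f x))\<^sup>2) \<le> (LINT x:J|M. (cmod (f x))\<^sup>2)" if "f \<in> L2on" for f
    unfolding set_lebesgue_integral_def
    by (rule integral_mono)
      (use set_integrable_J_subset[OF L2on_square[OF that] A] L2on_square[OF that] A in
        \<open>auto simp: set_integrable_def indicator_def\<close>)
  have nonneg: "0 \<le> (LINT x:A|M. (cmod (f x))\<^sup>2)" for f A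
    by (simp add: set_lebesgue_integral_def)
  have "(cmod (LINT x:A|M. f x * g x))\<^sup>2 \<le> (LINT x:A|M. (cmod (f x))\<^sup>2) * (LINT x:A|M. (cmod (g x))\<^sup>2)"
    using Cauchy_Schwarz[OF f L2on_cnj[OF g]] set_integral_cmod_square[of A f]
      set_integral_cmod_square[of A "\<lambda>x. cnj (g x)"] by (simp add: sqn_def)
  also have "\<dots> \<le> (LINT x:J|M. (cmod (f x))\<^sup>2) * (LINT x:J|M. (cmod (g x))\<^sup>2)"
    by (intro mult_mono mono f g nonneg)
  finally show ?thesis .
qed

text \<open>Cauchy-Schwarz against the kernel \<open>kern x\<close>, whose squared modulus is at
  most the indicator of \<open>[\<alpha>, \<beta>]\<close>. The measure of that interval is the
  resulting constant.\<close>

lemma mint_L2on_bound: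
  assumes d: "d \<in> L2on" and ab: "\<alpha> \<in> J" "\<beta> \<in> J" "\<alpha> \<le> c" "c \<le> \<beta>" "x \<in> {\<alpha>..\<beta>}"
  shows "(cmod (mint M c x d))\<^sup>2 \<le> measure M {\<alpha>..\<beta>} * (LINT x:J|M. (cmod (d x))\<^sup>2)"
proof -
  have x: "x \<in> J" using ab by (auto intro: Ioo_e_convex[of \<alpha> a b \<beta>])
  have fin: "integrable M (indicator {\<alpha>..\<beta>} :: real \<Rightarrow> real)"
    using finite_Icc[OF ab(1,2)] by (auto simp: sets_M)
  define k where "k t = complex_of_real (kern x t)" for t
  have "kern x \<in> borel_measurable borel" unfolding kern_cases by measurable
  then have k1: "k \<in> L1loc a b M" unfolding k_def
    by (intro locbdd_L1loc locbdd_of_real[where K=1]) (auto simp: kern_cases)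
  have le: "indicator J t *\<^sub>R (cmod (k t))\<^sup>2 \<le> indicator {\<alpha>..\<beta>} t" for t
    using ab by (auto simp: k_def kern_cases indicator_def)
  have k2: "set_integrable M J (\<lambda>t. (cmod (k t))\<^sup>2)"
    unfolding set_integrable_def
  proof (rule Bochner_Integration.integrable_bound[OF fin])
    show "(\<lambda>x. indicator J x *\<^sub>R (cmod (k x))\<^sup>2) \<in> borel_measurable M"
      using set_meas_cmod_square[OF L1loc_set_meas[OF k1, of J]] by (simp add: set_borel_measurable_def)
  qed (use le in auto)
  have k: "k \<in> L2on" using k1 k2 by (simp add: L2on_def)
  have "(LINT x:J|M. (cmod (k x))\<^sup>2) \<le> integral\<^sup>L M (indicator {\<alpha>..\<beta>})"
    unfolding set_lebesgue_integral_def
    using k2 fin le by (intro integral_mono) (auto simp: set_integrable_def)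
  then have kle: "(LINT x:J|M. (cmod (k x))\<^sup>2) \<le> measure M {\<alpha>..\<beta>}" by simp
  have "mint M c x d = (LINT t:J|M. k t * d t)"
    unfolding mint_kern(2)[OF L2on_L1loc[OF d] x] set_lebesgue_integral_def
    by (intro Bochner_Integration.integral_cong refl)
      (auto simp: k_def scaleR_conv_of_real kern_outside[OF x] indicator_def)
  then have "(cmod (mint M c x d))\<^sup>2 \<le> (LINT x:J|M. (cmod (k x))\<^sup>2) * (LINT x:J|M. (cmod (d x))\<^sup>2)"
    using L2on_Cauchy_Schwarz[OF k d, of J] by simp
  also have "\<dots> \<le> measure M {\<alpha>..\<beta>} * (LINT x:J|M. (cmod (d x))\<^sup>2)"
    by (intro mult_right_mono kle) (simp add: set_lebesgue_integral_def)
  finally show ?thesis .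
qed

end

section \<open>Integration by parts\<close>

text \<open>Serves to show that the diagonal is null for a product of two measures without common
  atoms.\<close>

lemma (in locally_finite_on) countable_atoms:
  assumes "x \<in> J" "y \<in> J"
  shows "countable {s\<in>{x..<y}. emeasure M {s} \<noteq> 0}"
proof -
  let ?D = "density M (indicator {x..<y})"
  have [simp]: "{x..<y} \<in> sets M" "{s} \<in> sets M" for s by (auto simp: sets_M)
  have "emeasure M {x..<y} \<le> emeasure M {x..y}" by (intro emeasure_mono) (auto simp: sets_M)
  then have fin: "emeasure M {x..<y} < \<infinity>" using finite_Icc[OF assms] by (rule le_less_trans)
  interpret finite_measure ?D
    by (rule finite_measureI) (use fin in \<open>simp add: emeasure_restricted\<close>)
  have "{s\<in>{x..<y}. emeasure M {s} \<noteq> 0} \<subseteq> {s. measure ?D {s} \<noteq> 0}"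
  proof (intro subsetI CollectI, elim CollectE conjE)
    fix s assume s: "s \<in> {x..<y}" "emeasure M {s} \<noteq> 0"
    then have "{x..<y} \<inter> {s} = {s}" by auto
    then have "emeasure ?D {s} = emeasure M {s}"
      by (simp add: emeasure_restricted)
    then show "measure ?D {s} \<noteq> 0"
      using s emeasure_eq_measure[of "{s}"] by (metis ennreal_0)
  qed
  then show ?thesis using countable_support countable_subset by blast
qed

text \<open>Fubini on the square \<open>[x, y)\<close> times \<open>[x, y)\<close>, split into the
  two open triangles and the diagonal. The triangles give the two iterated integrals; the diagonal
  contributes nothing.\<close>

lemma product_of_integrals_Ico:
  assumes M: "locally_finite_on a b c M" and N: "locally_finite_on a b c N"
    and atoms: "\<And>x. x \<in> Ioo_e a b \<Longrightarrow> emeasure M {x} = 0 \<or> emeasure N {x} = 0"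
    and p: "p \<in> L1loc a b M" and q: "q \<in> L1loc a b N"
    and x: "x \<in> Ioo_e a b" and y: "y \<in> Ioo_e a b"
  shows "(LINT s:{x..<y}|M. p s) * (LINT t:{x..<y}|N. q t) =
    (LINT s:{x..<y}|M. p s * (LINT t:{x..<s}|N. q t)) +
    (LINT t:{x..<y}|N. (LINT s:{x..<t}|M. p s) * q t)"
proof -
  interpret M: locally_finite_on a b c M by (rule M)
  interpret N: locally_finite_on a b c N by (rule N)
  interpret M1: sigma_finite_measure M by (rule M.sigma_finite)
  interpret N1: sigma_finite_measure N by (rule N.sigma_finite)
  interpret MN: pair_sigma_finite M N ..
  note [measurable_cong] = M.sets_M N.sets_M
  define P where "P s = indicator {x..<y} s *\<^sub>R p s" for s
  define Q where "Q t = indicator {x..<y} t *\<^sub>R q t" for t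
  have P: "integrable M P" using M.L1loc_Ico[OF p x y] by (simp add: P_def[abs_def] set_integrable_def)
  have Q: "integrable N Q" using N.L1loc_Ico[OF q x y] by (simp add: Q_def[abs_def] set_integrable_def)
  have [measurable]: "P \<in> borel_measurable M" "Q \<in> borel_measurable N" using P Q by auto
  have K: "integrable (M \<Otimes>\<^sub>M N) (\<lambda>(s, t). P s * Q t)"
  proof (rule MN.Fubini_integrable)
    show "integrable M (\<lambda>s. \<integral>t. norm (case (s, t) of (s, t) \<Rightarrow> P s * Q t) \<partial>N)"
      using P by (simp add: norm_mult)
    show "AE s in M. integrable N (\<lambda>t. case (s, t) of (s, t) \<Rightarrow> P s * Q t)"
      using Q by simp
  qed measurable
  have KR: "integrable (M \<Otimes>\<^sub>M N) (\<lambda>(s, t). if R s t then P s * Q t else 0)"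
    if [measurable]: "Measurable.pred (M \<Otimes>\<^sub>M N) (\<lambda>z. R (fst z) (snd z))" for R
    by (rule Bochner_Integration.integrable_bound[OF K]) (auto simp: split_beta')
  have ltM[measurable]: "Measurable.pred (M \<Otimes>\<^sub>M N) (\<lambda>z. snd z < fst z)" by measurable
  have gtM[measurable]: "Measurable.pred (M \<Otimes>\<^sub>M N) (\<lambda>z. fst z < snd z)" by measurable
  have eqM[measurable]: "Measurable.pred (M \<Otimes>\<^sub>M N) (\<lambda>z. fst z = snd z)" by measurable
  note K1 = KR[of "\<lambda>s t. t < s", OF ltM] and K2 = KR[of "\<lambda>s t. s < t", OF gtM] and K3 = KR[of "\<lambda>s t. s = t", OF eqM]
  let ?IK = "\<integral>z. (case z of (s, t) \<Rightarrow> P s * Q t) \<partial>(M \<Otimes>\<^sub>M N)"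
  let ?IK1 = "\<integral>z. (case z of (s, t) \<Rightarrow> if t < s then P s * Q t else 0) \<partial>(M \<Otimes>\<^sub>M N)"
  let ?IK2 = "\<integral>z. (case z of (s, t) \<Rightarrow> if s < t then P s * Q t else 0) \<partial>(M \<Otimes>\<^sub>M N)"
  let ?IK3 = "\<integral>z. (case z of (s, t) \<Rightarrow> if s = t then P s * Q t else 0) \<partial>(M \<Otimes>\<^sub>M N)"
  have "?IK =
      (\<integral>z. (case z of (s, t) \<Rightarrow> if t < s then P s * Q t else 0) + (case z of (s, t) \<Rightarrow> if s < t then P s * Q t else 0)
         + (case z of (s, t) \<Rightarrow> if s = t then P s * Q t else 0) \<partial>(M \<Otimes>\<^sub>M N))"
    by (rule Bochner_Integration.integral_cong) auto
  also have "\<dots> = ?IK1 +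
       ?IK2 +
       ?IK3"
    using K1 K2 K3 by (simp add: Bochner_Integration.integral_add)
  finally have split: "?IK = \<dots>" .
  have "?IK = (\<integral>s. P s \<partial>M) * (\<integral>t. Q t \<partial>N)"
    by (subst MN.integral_fst'[OF K, symmetric]) simp
  moreover have "?IK1 =
      (LINT s:{x..<y}|M. p s * (LINT t:{x..<s}|N. q t))"
  proof -
    have "(\<integral>t. (if t < s then P s * Q t else 0) \<partial>N) = indicator {x..<y} s *\<^sub>R (p s * (LINT t:{x..<s}|N. q t))" for s
    proof (cases "s \<in> {x..<y}")
      case True
      have "(\<integral>t. (if t < s then P s * Q t else 0) \<partial>N) = (\<integral>t. p s * (indicator {x..<s} t *\<^sub>R q t) \<partial>N)"
        using True by (intro Bochner_Integration.integral_cong) (auto simp: P_def Q_def indicator_def)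
      also have "\<dots> = p s * (LINT t:{x..<s}|N. q t)"
        unfolding set_lebesgue_integral_def by (rule integral_mult_right_zero)
      finally show ?thesis using True by simp
    qed (simp add: P_def cong: if_cong)
    then show ?thesis
      by (subst MN.integral_fst'[OF K1, symmetric]) (simp add: set_lebesgue_integral_def)
  qed
  moreover have "?IK2 =
      (LINT t:{x..<y}|N. (LINT s:{x..<t}|M. p s) * q t)"
  proof -
    have "(\<integral>s. (if s < t then P s * Q t else 0) \<partial>M) = indicator {x..<y} t *\<^sub>R ((LINT s:{x..<t}|M. p s) * q t)" for t
    proof (cases "t \<in> {x..<y}")
      case True
      have "(\<integral>s. (if s < t then P s * Q t else 0) \<partial>M) = (\<integral>s. (indicator {x..<t} s *\<^sub>R p s) * q t \<partial>M)"
        using True by (intro Bochner_Integration.integral_cong) (auto simp: P_def Q_def indicator_def)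
      also have "\<dots> = (LINT s:{x..<t}|M. p s) * q t"
        unfolding set_lebesgue_integral_def by (rule integral_mult_left_zero)
      finally show ?thesis using True by simp
    qed (simp add: Q_def cong: if_cong)
    then show ?thesis
      by (subst MN.integral_snd[OF K2, symmetric]) (simp add: set_lebesgue_integral_def)
  qed
  moreover have "?IK3 = 0"
  proof -
    let ?D = "{s\<in>{x..<y}. emeasure N {s} \<noteq> 0}"
    \<comment> \<open>The section of the diagonal at \<open>s\<close> has \<open>N\<close>-mass that
      of \<open>{s}\<close>, nonzero only at the countably many atoms of \<open>N\<close>, and these
      are null for \<open>M\<close>.\<close>
    have "(\<Union>s\<in>?D. {s}) \<in> null_sets M"
    proof (rule null_sets_UN')
      show "countable ?D" by (rule N.countable_atoms[OF x y])
      show "{s} \<in> null_sets M" if "s \<in> ?D" for s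
        using that atoms[of s] Ioo_e_convex[OF x y, of s] by (auto simp: null_sets_def M.sets_M)
    qed
    then have "AE s in M. s \<notin> (\<Union>s\<in>?D. {s})" by (rule AE_not_in)
    then have "AE s in M. (\<integral>t. (if s = t then P s * Q t else 0) \<partial>N) = 0"
    proof eventually_elim
      case (elim s)
      show ?case
      proof (cases "s \<in> {x..<y}")
        case True
        then have "{s} \<in> null_sets N" using elim by (auto simp: null_sets_def N.sets_M)
        from AE_not_in[OF this] show ?thesis
          by (intro integral_eq_zero_AE) (auto elim!: eventually_mono)
      next
        case False
        then have "P s = 0" by (simp add: P_def)
        then have "(if s = t then P s * Q t else 0) = 0" for t by auto
        then show ?thesis by (simp only: Bochner_Integration.integral_zero)
      qed
    qed
    then show ?thesis
      by (subst MN.integral_fst'[OF K3, symmetric]) (simp add: integral_eq_zero_AE)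
  qed
  ultimately show ?thesis
    using split by (simp add: set_lebesgue_integral_def P_def Q_def)
qed

text \<open>The product formula is applied to the increments of \<open>F\<close> and
  \<open>G\<close> from the lower endpoint. Without common atoms both factors may be evaluated at
  \<open>t\<close> itself, with no one-sided limits.\<close>

lemma integration_by_parts:
  assumes M: "locally_finite_on a b c M" and N: "locally_finite_on a b c N"
    and atoms: "\<And>x. x \<in> Ioo_e a b \<Longrightarrow> emeasure M {x} = 0 \<or> emeasure N {x} = 0"
    and p: "p \<in> L1loc a b M" and q: "q \<in> L1loc a b N"
    and F: "\<And>x. x \<in> Ioo_e a b \<Longrightarrow> F x = F c + mint M c x p"
    and G: "\<And>x. x \<in> Ioo_e a b \<Longrightarrow> G x = G c + mint N c x q"
    and y: "y \<in> Ioo_e a b"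
  shows "F y * G y = F c * G c + mint M c y (\<lambda>t. p t * G t) + mint N c y (\<lambda>t. F t * q t)"
proof -
  interpret M: locally_finite_on a b c M by (rule M)
  interpret N: locally_finite_on a b c N by (rule N)
  have "(\<lambda>x. F c + mint M c x p) \<in> locbdd a b"
    by (rule locbdd_add[OF locbdd_const M.mint_locbdd[OF p]])
  then have FL: "F \<in> locbdd a b" using F by (subst locbdd_cong) auto
  have "(\<lambda>x. G c + mint N c x q) \<in> locbdd a b"
    by (rule locbdd_add[OF locbdd_const N.mint_locbdd[OF q]])
  then have GL: "G \<in> locbdd a b" using G by (subst locbdd_cong) auto
  have pG: "(\<lambda>t. p t * G t) \<in> L1loc a b M" by (rule M.L1loc_mult_locbdd[OF p GL])
  have Fq: "(\<lambda>t. F t * q t) \<in> L1loc a b N" using N.L1loc_mult_locbdd[OF q FL] by (simp add: mult.commute)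
  have main: "F y * G y - F x * G x = (LINT t:{x..<y}|M. p t * G t) + (LINT t:{x..<y}|N. F t * q t)"
    if x: "x \<in> Ioo_e a b" and y: "y \<in> Ioo_e a b" and "x \<le> y" for x y
  proof -
    have dF: "(LINT s:{x..<t}|M. p s) = F t - F x" if "t \<in> {x..y}" for t
      using that F[of t] F[of x] Ioo_e_convex[OF x y, of t] x M.mint_diff_Ico[OF p x, of t] by simp
    have dG: "(LINT s:{x..<t}|N. q s) = G t - G x" if "t \<in> {x..y}" for t
      using that G[of t] G[of x] Ioo_e_convex[OF x y, of t] x N.mint_diff_Ico[OF q x, of t] by simp
    have "(F y - F x) * (G y - G x) = (LINT s:{x..<y}|M. p s * (LINT t:{x..<s}|N. q t)) +
        (LINT t:{x..<y}|N. (LINT s:{x..<t}|M. p s) * q t)"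
      using product_of_integrals_Ico[OF M N atoms p q x y] dF[of y] dG[of y] \<open>x \<le> y\<close> by simp
    also have "(LINT s:{x..<y}|M. p s * (LINT t:{x..<s}|N. q t)) = (LINT s:{x..<y}|M. p s * G s - p s * G x)"
      by (intro set_lebesgue_integral_cong) (auto simp: M.sets_M dG algebra_simps)
    also have "\<dots> = (LINT s:{x..<y}|M. p s * G s) - (F y - F x) * G x"
      using M.L1loc_Ico[OF pG x y] M.L1loc_Ico[OF p x y] dF[of y] \<open>x \<le> y\<close>
      by (subst set_integral_diff) auto
    also have "(LINT t:{x..<y}|N. (LINT s:{x..<t}|M. p s) * q t) = (LINT s:{x..<y}|N. F s * q s - F x * q s)"
      by (intro set_lebesgue_integral_cong) (auto simp: N.sets_M dF algebra_simps)
    also have "\<dots> = (LINT s:{x..<y}|N. F s * q s) - F x * (G y - G x)"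
      using N.L1loc_Ico[OF Fq x y] N.L1loc_Ico[OF q x y] dG[of y] \<open>x \<le> y\<close>
      by (subst set_integral_diff) auto
    finally show ?thesis by (simp add: algebra_simps)
  qed
  show ?thesis
  proof (cases "c \<le> y")
    case True
    then show ?thesis
      using main[OF M.c_mem y True] M.mint_diff_Ico[OF pG M.c_mem y True] N.mint_diff_Ico[OF Fq M.c_mem y True]
      by (simp add: algebra_simps)
  next
    case False
    then have le: "y \<le> c" by simp
    have "(LINT t:{y..<c}|M. p t * G t) = - mint M c y (\<lambda>t. p t * G t)"
      "(LINT t:{y..<c}|N. F t * q t) = - mint N c y (\<lambda>t. F t * q t)"
      using M.mint_diff_Ico[OF pG y M.c_mem le] N.mint_diff_Ico[OF Fq y M.c_mem le] by simp_all
    then show ?thesis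
      using main[OF y M.c_mem le] by (simp add: algebra_simps)
  qed
qed

section \<open>The form domain\<close>

context locally_finite_on
begin

lemma set_integral_cong_L1loc:
  assumes "f \<in> L1loc a b M" "g \<in> L1loc a b M" "AE x in M. f x = g x" "A \<in> sets borel" "A \<subseteq> J"
  shows "(LINT x:A|M. f x) = (LINT x:A|M. g x)"
  unfolding set_lebesgue_integral_def
  by (rule integral_cong_AE)
    (use assms L1loc_set_meas[OF assms(1,4,5)] L1loc_set_meas[OF assms(2,4,5)] in
      \<open>auto simp: set_borel_measurable_def elim!: eventually_mono\<close>)

text \<open>The inequality |h| \<le> 1 + |h|^2 and the finite mass of compact intervals give local
  integrability, so membership reduces to measurability and the square.\<close>

lemma L2onI:
  assumes meas: "set_borel_measurable M J h" and int: "set_integrable M J (\<lambda>x. (cmod (h x))\<^sup>2)"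
  shows "h \<in> L2on"
proof -
  have "h \<in> L1loc a b M"
  proof (rule L1locI)
    fix x y assume xy: "x \<in> J" "y \<in> J"
    then have sub: "{x..y} \<subseteq> J" using Ioo_e_convex[OF xy] by auto
    have one: "set_integrable M {x..y} (\<lambda>_. 1 :: real)"
      unfolding set_integrable_def using finite_Icc[OF xy]
      by (intro integrable_scaleR_left integrable_real_indicator) (auto simp: sets_M)
    show "set_integrable M {x..y} h"
    proof (rule set_integrable_bound)
      show "set_integrable M {x..y} (\<lambda>t. 1 + (cmod (h t))\<^sup>2)"
        by (intro set_integral_add one set_integrable_J_subset[OF int] sub) auto
      show "set_borel_measurable M {x..y} h"
        by (rule set_borel_measurable_subset[OF meas]) (use sub in \<open>auto simp: sets_M\<close>)
      have "cmod (h t) \<le> 1 + (cmod (h t))\<^sup>2" for t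
      proof -
        have "2 * cmod (h t) \<le> 1 + (cmod (h t))\<^sup>2" using sum_squares_bound[of 1 "cmod (h t)"] by simp
        with norm_ge_zero[of "h t"] show ?thesis by linarith
      qed
      then show "AE t in M. t \<in> {x..y} \<longrightarrow> norm (h t) \<le> norm (1 + (cmod (h t))\<^sup>2)" by simp
    qed
  qed
  with int show ?thesis by (simp add: L2on_def)
qed

lemma set_integrable_cong_AE_J:
  assumes "set_borel_measurable M J f" "set_borel_measurable M J g" "AE x in M. f x = g x"
  shows "set_integrable M J f \<longleftrightarrow> set_integrable M J g"
  unfolding set_integrable_def
  by (rule integrable_cong_AE)
    (use assms in \<open>auto simp: set_borel_measurable_def elim!: eventually_mono\<close>)

lemma L2on_cong_AE:
  assumes "f \<in> L2on" "g \<in> L1loc a b M" "AE x in M. f x = g x"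
  shows "g \<in> L2on"
proof -
  have "set_integrable M J (\<lambda>x. (cmod (f x))\<^sup>2) \<longleftrightarrow> set_integrable M J (\<lambda>x. (cmod (g x))\<^sup>2)"
  proof -
    have m: "(\<lambda>x. indicator J x *\<^sub>R (cmod (h x))\<^sup>2) \<in> borel_measurable M" if "h \<in> L1loc a b M" for h
      using set_meas_cmod_square[OF L1loc_set_meas[OF that, of J]] by (simp add: set_borel_measurable_def)
    show ?thesis unfolding set_integrable_def
      by (rule integrable_cong_AE[OF m m]) (use assms in \<open>auto simp: L2on_def elim!: eventually_mono\<close>)
  qed
  with assms show ?thesis by (simp add: L2on_def)
qed

lemma L2on_diff: "f \<in> L2on \<Longrightarrow> g \<in> L2on \<Longrightarrow> (\<lambda>x. f x - g x) \<in> L2on"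
  using L2on_add[OF _ L2on_cmult[of g "-1"], of f] by simp

end

section \<open>The space H1 and its point evaluations\<close>

locale left_definite =
  fixes a b :: ereal and c :: real
    and vs chi mr :: "real measure" and sr :: "real \<Rightarrow> real"
  assumes ab: "a < b" and c: "c \<in> Ioo_e a b"
    and sets: "sets vs = sets borel" "sets chi = sets borel" "sets mr = sets borel"
    and on_ab: "emeasure vs (- Ioo_e a b) = 0" "emeasure chi (- Ioo_e a b) = 0"
               "emeasure mr (- Ioo_e a b) = 0"
    and locfin: "\<And>x y. a < ereal x \<Longrightarrow> ereal y < b \<Longrightarrow>
                   emeasure vs {x..y} < \<infinity> \<and> emeasure chi {x..y} < \<infinity> \<and> emeasure mr {x..y} < \<infinity>"
    and sign: "sr \<in> borel_measurable borel" "\<And>x. sr x = 1 \<or> sr x = -1"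
    and supp: "\<And>x y. a < ereal x \<Longrightarrow> x < y \<Longrightarrow> ereal y < b \<Longrightarrow> emeasure vs {x<..<y} > 0"
    and chi_nz: "emeasure chi (Ioo_e a b) \<noteq> 0"
    and atoms: "\<And>x. x \<in> Ioo_e a b \<Longrightarrow> emeasure vs {x} = 0 \<or> emeasure chi {x} = 0"
               "\<And>x. x \<in> Ioo_e a b \<Longrightarrow> emeasure vs {x} = 0 \<or> emeasure mr {x} = 0"
begin

sublocale S: locally_finite_on a b c vs
  by standard (use c sets on_ab locfin in auto)

sublocale X: locally_finite_on a b c chi
  by standard (use c sets on_ab locfin in auto)

sublocale R: locally_finite_on a b c mr
  by standard (use c sets on_ab locfin in auto)

abbreviation "I \<equiv> Ioo_e a b"
abbreviation "AC \<equiv> ACloc a b c vs (\<lambda>_. 1)"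
abbreviation "Der \<equiv> rnd a b c vs (\<lambda>_. 1)"
abbreviation "HH \<equiv> H1 a b c vs chi"
abbreviation "ip \<equiv> H1_inner a b c vs chi"

lemma AC_outside: "f \<in> AC \<Longrightarrow> x \<notin> I \<Longrightarrow> f x = 0"
  by (simp add: ACloc_def)

lemma Der:
  assumes "f \<in> AC"
  shows "Der f \<in> L1loc a b vs" "\<And>x. x \<in> I \<Longrightarrow> f x = f c + mint vs c x (Der f)"
proof -
  have "\<exists>h. h \<in> L1loc a b vs \<and> (\<forall>x\<in>I. f x = f c + mint vs c x (\<lambda>t. complex_of_real 1 * h t))"
    using assms by (auto simp: ACloc_def)
  from someI_ex[OF this] show "Der f \<in> L1loc a b vs" "\<And>x. x \<in> I \<Longrightarrow> f x = f c + mint vs c x (Der f)"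
    by (auto simp: rnd_def)
qed

text \<open>\<open>Der f\<close> is a choice, so identities for it hold only
  \<open>vs\<close>-almost everywhere and are obtained by exhibiting some density of
  \<open>f\<close>.\<close>

lemma ACI:
  assumes "h \<in> L1loc a b vs" "\<And>x. x \<in> I \<Longrightarrow> f x = f c + mint vs c x h" "\<And>x. x \<notin> I \<Longrightarrow> f x = 0"
  shows "f \<in> AC" "AE x in vs. Der f x = h x"
proof -
  show AC: "f \<in> AC" using assms by (auto simp: ACloc_def intro!: bexI[of _ h])
  have "mint vs c x (\<lambda>t. Der f t - h t) = 0" if "x \<in> I" for x
    using Der(2)[OF AC that] assms(2)[OF that] S.mint_diff[OF Der(1)[OF AC] assms(1) that] by simp
  from S.density_unique_Ico[OF S.L1loc_diff[OF Der(1)[OF AC] assms(1)] this]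
  show "AE x in vs. Der f x = h x" by simp
qed

lemma AC_locbdd: "f \<in> AC \<Longrightarrow> f \<in> locbdd a b"
  using locbdd_add[OF locbdd_const[of "f c"] S.mint_locbdd[OF Der(1)]] Der(2)
  by (subst locbdd_cong[where G="\<lambda>x. f c + mint vs c x (Der f)"]) auto

lemma H1_iff: "f \<in> HH \<longleftrightarrow> f \<in> AC \<and> f \<in> X.L2on \<and> Der f \<in> S.L2on"
  using X.locbdd_L1loc[OF AC_locbdd] Der(1) by (auto simp: H1_def X.L2on_def S.L2on_def)

lemma H1_AC: "f \<in> HH \<Longrightarrow> f \<in> AC" and H1_L2: "f \<in> HH \<Longrightarrow> f \<in> X.L2on"
  and H1_Der: "f \<in> HH \<Longrightarrow> Der f \<in> S.L2on"
  by (simp_all add: H1_iff)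

lemma H1_L1loc: "f \<in> HH \<Longrightarrow> f \<in> L1loc a b chi" "f \<in> HH \<Longrightarrow> f \<in> L1loc a b mr"
  using AC_locbdd[OF H1_AC] X.locbdd_L1loc R.locbdd_L1loc by blast+

lemma H1I:
  assumes d: "d \<in> S.L2on" and f: "\<And>x. x \<in> I \<Longrightarrow> f x = f c + mint vs c x d" "\<And>x. x \<notin> I \<Longrightarrow> f x = 0"
    and sq: "f \<in> X.L2on"
  shows "f \<in> HH" "AE x in vs. Der f x = d x"
proof -
  note * = ACI[OF S.L2on_L1loc[OF d] f]
  show "AE x in vs. Der f x = d x" by (rule *(2))
  then have "Der f \<in> S.L2on"
    by (intro S.L2on_cong_AE[OF d Der(1)[OF *(1)]]) (auto elim!: eventually_mono)
  with * sq show "f \<in> HH" by (simp add: H1_iff)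
qed

lemma H1_add:
  assumes "f \<in> HH" "g \<in> HH"
  shows "(\<lambda>x. f x + g x) \<in> HH" "AE x in vs. Der (\<lambda>x. f x + g x) x = Der f x + Der g x"
proof -
  note AC = assms[THEN H1_AC] and D = assms[THEN H1_Der]
  have *: "f x + g x = f c + g c + mint vs c x (\<lambda>x. Der f x + Der g x)" if "x \<in> I" for x
    using Der(2)[OF AC(1) that] Der(2)[OF AC(2) that] S.mint_add[OF Der(1)[OF AC(1)] Der(1)[OF AC(2)] that]
    by simp
  note r = H1I[OF S.L2on_add[OF D], where f = "\<lambda>x. f x + g x"]
  show "(\<lambda>x. f x + g x) \<in> HH"
    by (rule r(1)) (use * AC_outside[OF AC(1)] AC_outside[OF AC(2)] X.L2on_add assms[THEN H1_L2] in simp_all)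
  show "AE x in vs. Der (\<lambda>x. f x + g x) x = Der f x + Der g x"
    by (rule r(2)) (use * AC_outside[OF AC(1)] AC_outside[OF AC(2)] X.L2on_add assms[THEN H1_L2] in simp_all)
qed

lemma H1_cmult:
  assumes "f \<in> HH"
  shows "(\<lambda>x. k * f x) \<in> HH" "AE x in vs. Der (\<lambda>x. k * f x) x = k * Der f x"
proof -
  note AC = assms[THEN H1_AC] and D = assms[THEN H1_Der]
  have *: "k * f x = k * f c + mint vs c x (\<lambda>x. k * Der f x)" if "x \<in> I" for x
    using Der(2)[OF AC that] by (simp add: S.mint_cmult algebra_simps)
  note r = H1I[OF S.L2on_cmult[OF D], where f = "\<lambda>x. k * f x"]
  show "(\<lambda>x. k * f x) \<in> HH"
    by (rule r(1)) (use * AC_outside AC X.L2on_cmult assms[THEN H1_L2] in simp_all)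
  show "AE x in vs. Der (\<lambda>x. k * f x) x = k * Der f x"
    by (rule r(2)) (use * AC_outside AC X.L2on_cmult assms[THEN H1_L2] in simp_all)
qed

lemma H1_cnj:
  assumes "f \<in> HH"
  shows "(\<lambda>x. cnj (f x)) \<in> HH" "AE x in vs. Der (\<lambda>x. cnj (f x)) x = cnj (Der f x)"
proof -
  note AC = assms[THEN H1_AC] and D = assms[THEN H1_Der]
  have *: "cnj (f x) = cnj (f c) + mint vs c x (\<lambda>x. cnj (Der f x))" if "x \<in> I" for x
    using Der(2)[OF AC that] by (simp add: S.mint_cnj)
  note r = H1I[OF S.L2on_cnj[OF D], where f = "\<lambda>x. cnj (f x)"]
  show "(\<lambda>x. cnj (f x)) \<in> HH"
    by (rule r(1)) (use * AC_outside AC X.L2on_cnj assms[THEN H1_L2] in simp_all)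
  show "AE x in vs. Der (\<lambda>x. cnj (f x)) x = cnj (Der f x)"
    by (rule r(2)) (use * AC_outside AC X.L2on_cnj assms[THEN H1_L2] in simp_all)
qed

lemma ip_Der_cong:
  assumes "d \<in> S.L2on" "e \<in> S.L2on" "f \<in> HH" "g \<in> HH"
    and "AE x in vs. Der f x = d x" "AE x in vs. Der g x = e x"
  shows "ip f g = (LINT x:I|chi. f x * cnj (g x)) + (LINT x:I|vs. d x * cnj (e x))"
proof -
  have "(LINT x:I|vs. Der f x * cnj (Der g x)) = (LINT x:I|vs. d x * cnj (e x))"
  proof (rule S.set_integral_cong_L1loc)
    show "AE x in vs. Der f x * cnj (Der g x) = d x * cnj (e x)"
      using assms(5,6) by eventually_elim simp
  qed (intro S.set_integrable_J_L1loc S.L2on_mult_integrable S.L2on_cnj H1_Der assms borel_Ioo_e subset_refl)+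
  then show ?thesis by (simp add: H1_inner_def)
qed

lemma ip_eq:
  "ip f g = (LINT x:I|chi. f x * cnj (g x)) + (LINT x:I|vs. Der f x * cnj (Der g x))"
  by (simp add: H1_inner_def)

lemma zero_H1: "(\<lambda>x. 0) \<in> HH"
proof -
  have *: "mint vs c x (\<lambda>x. 0) = 0" for x by (simp add: mint_def)
  show ?thesis by (rule H1I[OF S.L2on_zero]) (auto simp: * X.L2on_zero)
qed

sublocale H: semi_inner_space HH ip
proof
  interpret SS: semi_inner_space S.L2on "\<lambda>f g. LINT x:I|vs. f x * cnj (g x)"
    by (rule S.semi_inner_space_L2on) auto
  interpret XX: semi_inner_space X.L2on "\<lambda>f g. LINT x:I|chi. f x * cnj (g x)"
    by (rule X.semi_inner_space_L2on) auto
  show "(\<lambda>x. 0) \<in> HH" by (rule zero_H1)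
  fix f g h :: "real \<Rightarrow> complex" and k
  assume f: "f \<in> HH"
  show "(\<lambda>x. k * f x) \<in> HH" by (rule H1_cmult[OF f])
  show "0 \<le> Re (ip f f)"
    unfolding ip_eq using SS.ip_nonneg[OF H1_Der[OF f]] XX.ip_nonneg[OF H1_L2[OF f]] by simp
  assume g: "g \<in> HH"
  show "(\<lambda>x. f x + g x) \<in> HH" by (rule H1_add[OF f g])
  show "ip g f = cnj (ip f g)"
    unfolding ip_eq using SS.ip_cnj[of "Der f" "Der g"] XX.ip_cnj[of f g] f g by (simp add: H1_Der H1_L2)
  assume h: "h \<in> HH"
  show "ip (\<lambda>x. f x + g x) h = ip f h + ip g h"
    using ip_Der_cong[OF SS.add_mem[OF H1_Der[OF f] H1_Der[OF g]] H1_Der[OF h] H1_add(1)[OF f g] h H1_add(2)[OF f g]]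
      SS.ip_add[OF H1_Der[OF f] H1_Der[OF g] H1_Der[OF h]] XX.ip_add[OF H1_L2[OF f] H1_L2[OF g] H1_L2[OF h]]
    by (simp add: ip_eq)
next
  fix f h :: "real \<Rightarrow> complex" and k
  assume f: "f \<in> HH" and h: "h \<in> HH"
  show "ip (\<lambda>x. k * f x) h = k * ip f h"
    using ip_Der_cong[OF S.L2on_cmult[OF H1_Der[OF f]] H1_Der[OF h] H1_cmult(1)[OF f] h H1_cmult(2)[OF f]]
    by (simp add: ip_eq algebra_simps)
qed

lemma sqn_eq: "H.sqn f = (LINT x:I|chi. (cmod (f x))\<^sup>2) + (LINT x:I|vs. (cmod (Der f x))\<^sup>2)"
  unfolding H.sqn_def ip_eq using S.set_integral_cmod_square[of I "Der f"] X.set_integral_cmod_square[of I f] by simp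

lemma sqn_ge:
  "(LINT x:I|chi. (cmod (f x))\<^sup>2) \<le> H.sqn f" "(LINT x:I|vs. (cmod (Der f x))\<^sup>2) \<le> H.sqn f"
  unfolding sqn_eq by (simp_all add: set_lebesgue_integral_def)

lemma chi_positive:
  obtains l u where "l \<in> I" "u \<in> I" "measure chi {l..u} > 0"
proof -
  obtain l u :: "nat \<Rightarrow> real" where lu: "I = (\<Union>i. {l i..u i})" "\<And>i. l i \<in> I" "\<And>i. u i \<in> I"
    by (rule S.exhaustion) (rule that)
  have "\<exists>i. emeasure chi {l i..u i} \<noteq> 0"
  proof (rule ccontr)
    assume "\<nexists>i. emeasure chi {l i..u i} \<noteq> 0"
    then have "(\<Union>i. {l i..u i}) \<in> null_sets chi" by (intro null_sets_UN) (auto simp: null_sets_def X.sets_M)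
    then show False using chi_nz lu(1) by (auto simp: null_sets_def)
  qed
  then obtain i where "emeasure chi {l i..u i} \<noteq> 0" by blast
  moreover have "emeasure chi {l i..u i} < \<infinity>" by (rule X.finite_Icc[OF lu(2,3)])
  ultimately have "measure chi {l i..u i} > 0"
    by (simp add: measure_def enn2real_positive_iff less_top[symmetric] zero_less_iff_neq_zero)
  then show ?thesis using that lu(2,3) by blast
qed

text \<open>Point evaluations are bounded: average \<open>f c = f y - \<integral>f'\<close> over \<open>y\<close> with respect to \<open>chi\<close>.\<close>

lemma evaluation_bound:
  assumes \<alpha>: "\<alpha> \<in> I" and \<beta>: "\<beta> \<in> I"
  obtains K where "0 \<le> K" "\<And>f x. f \<in> HH \<Longrightarrow> x \<in> {\<alpha>..\<beta>} \<Longrightarrow> (cmod (f x))\<^sup>2 \<le> K * H.sqn f"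
proof -
  obtain l u where lu: "l \<in> I" "u \<in> I" "measure chi {l..u} > 0" by (rule chi_positive) (rule that)
  \<comment> \<open>One window containing the base point, the target interval and a set of positive
    \<open>chi\<close>-mass to average over.\<close>
  define p where "p = min (min l \<alpha>) c"
  define q where "q = max (max u \<beta>) c"
  have pq: "p \<in> I" "q \<in> I" "p \<le> c" "c \<le> q" "{l..u} \<subseteq> {p..q}" "{\<alpha>..\<beta>} \<subseteq> {p..q}"
    unfolding p_def q_def using \<alpha> \<beta> lu c by (auto simp: Ioo_e_min_max)
  define m where "m = measure chi {p..q}"
  define s where "s = measure vs {p..q}"
  have fin: "emeasure chi {p..q} < \<infinity>" by (rule X.finite_Icc[OF pq(1,2)])
  have "measure chi {l..u} \<le> m"
    unfolding m_def using fin pq(5) by (intro measure_mono_fmeasurable) (auto simp: fmeasurable_def X.sets_M)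
  with lu(3) have m: "m > 0" by simp
  have s: "s \<ge> 0" by (simp add: s_def)
  \<comment> \<open>With F and D the \<open>chi\<close>- and \<open>vs\<close>-parts of the squared
    norm, averaging over the window gives |f(c)|^2 \<le> 2F/m + 2sD. Going from c to x gives 2(2F/m
    + 2sD) + 2sD, whence the constants 4 and 6.\<close>
  have "(cmod (f x))\<^sup>2 \<le> (4 / m + 6 * s) * H.sqn f" if f: "f \<in> HH" and x: "x \<in> {\<alpha>..\<beta>}" for f x
  proof -
    define D where "D = (LINT x:I|vs. (cmod (Der f x))\<^sup>2)"
    define F where "F = (LINT x:I|chi. (cmod (f x))\<^sup>2)"
    have DF: "0 \<le> D" "0 \<le> F" "H.sqn f = F + D"
      by (simp_all add: D_def F_def sqn_eq set_lebesgue_integral_def)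
    have mb: "(cmod (mint vs c y (Der f)))\<^sup>2 \<le> s * D" if "y \<in> {p..q}" for y
      unfolding s_def D_def by (rule S.mint_L2on_bound[OF H1_Der[OF f] pq(1-4) that])
    have fy: "f y = f c + mint vs c y (Der f)" if "y \<in> {p..q}" for y
      using Der(2)[OF H1_AC[OF f]] Ioo_e_convex[OF pq(1,2)] that by auto
    have le: "(cmod (f c))\<^sup>2 \<le> 2 * (cmod (f y))\<^sup>2 + 2 * (s * D)" if y: "y \<in> {p..q}" for y
      using cmod_diff_square_le[of "f y" "mint vs c y (Der f)"] mb[OF y] fy[OF y] by simp
    have int_f: "set_integrable chi {p..q} (\<lambda>y. (cmod (f y))\<^sup>2)"
      using Ioo_e_convex[OF pq(1,2)]
      by (intro X.set_integrable_J_subset[OF X.L2on_square[OF H1_L2[OF f]]]) auto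
    have const: "set_integrable chi {p..q} (\<lambda>y. k)" for k :: real
      unfolding set_integrable_def using fin
      by (intro integrable_scaleR_left integrable_real_indicator) (auto simp: X.sets_M)
    have cint: "(LINT y:{p..q}|chi. k) = m * k" for k :: real
      using fin by (simp add: m_def set_lebesgue_integral_def)
    have "m * (cmod (f c))\<^sup>2 = (LINT y:{p..q}|chi. (cmod (f c))\<^sup>2)" by (simp add: cint)
    also have "\<dots> \<le> (LINT y:{p..q}|chi. 2 * (cmod (f y))\<^sup>2 + 2 * (s * D))"
      by (rule set_integral_mono) (use const int_f le in auto)
    also have "\<dots> = 2 * (LINT y:{p..q}|chi. (cmod (f y))\<^sup>2) + m * (2 * (s * D))"
      using int_f const by (subst set_integral_add) (auto simp: cint)
    also have "(LINT y:{p..q}|chi. (cmod (f y))\<^sup>2) \<le> F"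
      unfolding F_def set_lebesgue_integral_def
      by (rule integral_mono)
        (use int_f X.L2on_square[OF H1_L2[OF f]] Ioo_e_convex[OF pq(1,2)] in
          \<open>auto simp: set_integrable_def indicator_def\<close>)
    finally have "(cmod (f c))\<^sup>2 \<le> 2 * F / m + 2 * (s * D)"
      using m by (simp add: field_simps)
    moreover have "(cmod (f x))\<^sup>2 \<le> 2 * (cmod (f c))\<^sup>2 + 2 * (s * D)"
      using cmod_add_square_le[of "f c" "mint vs c x (Der f)"] mb[of x] fy[of x] x pq(6) by auto
    ultimately have "(cmod (f x))\<^sup>2 \<le> 4 * F / m + 6 * (s * D)" by simp
    also have "\<dots> \<le> 4 * (F + D) / m + 6 * (s * (F + D))"
      using m s DF by (intro add_mono divide_right_mono mult_left_mono) auto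
    also have "\<dots> = (4 / m + 6 * s) * (F + D)"
      by (simp add: algebra_simps add_divide_distrib)
    finally show ?thesis by (simp add: DF)
  qed
  then show ?thesis using that[of "4 / m + 6 * s"] m s by simp
qed

end

section \<open>Completeness of H1\<close>

context left_definite
begin

lemma sqn_diff_eq:
  assumes "f \<in> HH" "d \<in> S.L2on" "g \<in> HH" "e \<in> S.L2on"
    and "AE x in vs. Der f x = d x" "AE x in vs. Der g x = e x"
  shows "H.sqn (\<lambda>x. f x - g x) = (LINT x:I|chi. (cmod (f x - g x))\<^sup>2) + (LINT x:I|vs. (cmod (d x - e x))\<^sup>2)"
proof -
  have D: "AE x in vs. Der (\<lambda>x. f x + (-1) * g x) x = d x - e x"
    using H1_add(2)[OF assms(1) H1_cmult(1)[OF assms(3)], of "-1"] H1_cmult(2)[OF assms(3), of "-1"] assms(5,6)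
    by eventually_elim simp
  have "ip (\<lambda>x. f x - g x) (\<lambda>x. f x - g x) = (LINT x:I|chi. (f x - g x) * cnj (f x - g x)) +
      (LINT x:I|vs. (d x - e x) * cnj (d x - e x))"
    by (rule ip_Der_cong) (use D assms S.L2on_diff H.diff_mem in simp_all)
  then show ?thesis
    unfolding H.sqn_def using S.set_integral_cmod_square[of I "\<lambda>x. d x - e x"]
      X.set_integral_cmod_square[of I "\<lambda>x. f x - g x"] by simp
qed

lemma set_integral_indicator_cmod:
  "(LINT x:I|M. (cmod (f x - g x))\<^sup>2) = (\<integral>x. (cmod (indicator I x *\<^sub>R f x - indicator I x *\<^sub>R g x))\<^sup>2 \<partial>M)"
  unfolding set_lebesgue_integral_def
  by (rule Bochner_Integration.integral_cong) (auto simp: indicator_def)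

text \<open>Bounded point evaluations make a Cauchy sequence converge pointwise to some
  \<open>l\<close>, and the derivatives have a square-integrable limit \<open>v\<close>;
  \<open>mint_L2on_bound\<close> shows that \<open>l\<close> is a primitive of \<open>v\<close>. For
  the \<open>chi\<close>-part the limit is already known pointwise, so Fatou suffices.\<close>

lemma H1_complete:
  assumes F: "\<And>n. F n \<in> HH"
    and cauchy: "\<And>e. 0 < e \<Longrightarrow> \<exists>N. \<forall>m\<ge>N. \<forall>n\<ge>N. H.sqn (\<lambda>x. F m x - F n x) < e"
  shows "\<exists>l\<in>HH. (\<lambda>n. H.sqn (\<lambda>x. F n x - l x)) \<longlonglongrightarrow> 0"
proof -
  note FAC = F[THEN H1_AC] and FD = F[THEN H1_Der] and FL = F[THEN H1_L2]
  have sqn_F: "H.sqn (\<lambda>x. F m x - F n x) = (LINT x:I|chi. (cmod (F m x - F n x))\<^sup>2) +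
      (LINT x:I|vs. (cmod (Der (F m) x - Der (F n) x))\<^sup>2)" for m n
    by (rule sqn_diff_eq) (use F FD in auto)
  have parts: "(LINT x:I|chi. (cmod (F m x - F n x))\<^sup>2) \<le> H.sqn (\<lambda>x. F m x - F n x)"
    "(LINT x:I|vs. (cmod (Der (F m) x - Der (F n) x))\<^sup>2) \<le> H.sqn (\<lambda>x. F m x - F n x)" for m n
    unfolding sqn_F by (simp_all add: set_lebesgue_integral_def)
  have "Cauchy (\<lambda>n. F n x)" if x: "x \<in> I" for x
  proof (rule metric_CauchyI)
    fix e :: real assume e: "0 < e"
    obtain K where K: "0 \<le> K" "\<And>f. f \<in> HH \<Longrightarrow> (cmod (f x))\<^sup>2 \<le> K * H.sqn f"
      by (rule evaluation_bound[OF x x]) (rule that, auto)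
    \<comment> \<open>Division by \<open>K + 1\<close> because \<open>K\<close> may be zero.\<close>
    obtain N where N: "\<And>m n. m \<ge> N \<Longrightarrow> n \<ge> N \<Longrightarrow> H.sqn (\<lambda>x. F m x - F n x) < e\<^sup>2 / (K + 1)"
      using cauchy[of "e\<^sup>2 / (K + 1)"] e K(1) by auto
    have "dist (F m x) (F n x) < e" if "m \<ge> N" "n \<ge> N" for m n
    proof -
      have "(cmod (F m x - F n x))\<^sup>2 \<le> (K + 1) * H.sqn (\<lambda>x. F m x - F n x)"
        using K(2)[OF H.diff_mem[OF F F], of m n] H.sqn_nonneg[OF H.diff_mem[OF F F], of m n]
        by (simp add: algebra_simps)
      also have "\<dots> < e\<^sup>2" using N[OF that] K(1) by (simp add: field_simps)
      finally show ?thesis using e by (simp add: dist_norm power_less_imp_less_base)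
    qed
    then show "\<exists>M. \<forall>m\<ge>M. \<forall>n\<ge>M. dist (F m x) (F n x) < e" by blast
  qed
  then have conv: "convergent (\<lambda>n. F n x)" if "x \<in> I" for x using that by (simp add: Cauchy_convergent_iff)
  define l where "l x = (if x \<in> I then lim (\<lambda>n. F n x) else 0)" for x
  have lim: "(\<lambda>n. F n x) \<longlonglongrightarrow> l x" if "x \<in> I" for x
    using conv[OF that] that by (simp add: l_def convergent_LIMSEQ_iff)
  define u where "u n x = indicator I x *\<^sub>R Der (F n) x" for n x
  obtain v where v: "v \<in> borel_measurable vs" "integrable vs (\<lambda>x. (cmod (v x))\<^sup>2)"
    "(\<lambda>n. \<integral>x. (cmod (u n x - v x))\<^sup>2 \<partial>vs) \<longlonglongrightarrow> 0"
  proof (rule L2_complete[of u vs])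
    show "u n \<in> borel_measurable vs" for n
      unfolding u_def[abs_def] by (rule S.L1loc_meas[OF S.L2on_L1loc[OF FD]])
    show "integrable vs (\<lambda>x. (cmod (u n x))\<^sup>2)" for n
    proof -
      have "(\<lambda>x. (cmod (u n x))\<^sup>2) = (\<lambda>x. indicator I x *\<^sub>R (cmod (Der (F n) x))\<^sup>2)"
        by (auto simp: u_def indicator_def)
      then show ?thesis using S.L2on_square[OF FD] by (simp add: set_integrable_def)
    qed
    fix e :: real assume "0 < e"
    then obtain N where "\<forall>m\<ge>N. \<forall>n\<ge>N. H.sqn (\<lambda>x. F m x - F n x) < e" using cauchy by blast
    then show "\<exists>N. \<forall>m\<ge>N. \<forall>n\<ge>N. (\<integral>x. (cmod (u m x - u n x))\<^sup>2 \<partial>vs) < e"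
      using parts(2) unfolding u_def set_integral_indicator_cmod[symmetric] by (meson le_less_trans)
  qed (rule that)
  have vL: "v \<in> S.L2on"
  proof (rule S.L2onI)
    show "set_borel_measurable vs I v" using v(1) S.sets_M unfolding set_borel_measurable_def by measurable
    show "set_integrable vs I (\<lambda>x. (cmod (v x))\<^sup>2)"
      unfolding set_integrable_def using v(2) S.sets_M by (intro integrable_mult_indicator) auto
  qed
  have vlim: "(\<lambda>n. LINT x:I|vs. (cmod (Der (F n) x - v x))\<^sup>2) \<longlonglongrightarrow> 0"
  proof -
    have "(LINT x:I|vs. (cmod (Der (F n) x - v x))\<^sup>2) = (\<integral>x. (cmod (u n x - v x))\<^sup>2 \<partial>vs)" for n
      unfolding set_lebesgue_integral_def u_def
    proof (rule integral_cong_AE)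
      have [measurable]: "(\<lambda>x. indicator I x *\<^sub>R Der (F n) x) \<in> borel_measurable vs" "I \<in> sets vs"
        using S.L1loc_meas[OF S.L2on_L1loc[OF FD]] S.sets_M by auto
      note [measurable] = v(1)
      show "(\<lambda>x. (cmod (indicator I x *\<^sub>R Der (F n) x - v x))\<^sup>2) \<in> borel_measurable vs" by measurable
      have "(\<lambda>x. indicator I x *\<^sub>R (cmod (indicator I x *\<^sub>R Der (F n) x - v x))\<^sup>2) \<in> borel_measurable vs" by measurable
      also have "(\<lambda>x. indicator I x *\<^sub>R (cmod (indicator I x *\<^sub>R Der (F n) x - v x))\<^sup>2) = (\<lambda>x. indicator I x *\<^sub>R (cmod (Der (F n) x - v x))\<^sup>2)"
        by (auto simp: indicator_def)
      finally show "(\<lambda>x. indicator I x *\<^sub>R (cmod (Der (F n) x - v x))\<^sup>2) \<in> borel_measurable vs" .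
      show "AE x in vs. indicator I x *\<^sub>R (cmod (Der (F n) x - v x))\<^sup>2 = (cmod (indicator I x *\<^sub>R Der (F n) x - v x))\<^sup>2"
        using S.AE_J by eventually_elim simp
    qed
    with v(3) show ?thesis by simp
  qed
  have l_mint: "l x = l c + mint vs c x v" if x: "x \<in> I" for x
  proof -
    have "(cmod (mint vs c x (Der (F n)) - mint vs c x v))\<^sup>2
        \<le> measure vs {min x c..max x c} * (LINT x:I|vs. (cmod (Der (F n) x - v x))\<^sup>2)" for n
      unfolding S.mint_diff[OF S.L2on_L1loc[OF FD] S.L2on_L1loc[OF vL] x, symmetric]
      by (rule S.mint_L2on_bound[OF S.L2on_diff[OF FD vL]]) (use x c in \<open>auto simp: Ioo_e_min_max\<close>)
    from tendsto_zero_square_bound[OF vlim this]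
    have "(\<lambda>n. mint vs c x (Der (F n)) - mint vs c x v) \<longlonglongrightarrow> 0" .
    then have "(\<lambda>n. F n c + (mint vs c x (Der (F n)) - mint vs c x v) + mint vs c x v) \<longlonglongrightarrow> l c + 0 + mint vs c x v"
      by (intro tendsto_add tendsto_const lim[OF c])
    moreover have "F n c + (mint vs c x (Der (F n)) - mint vs c x v) + mint vs c x v = F n x" for n
      using Der(2)[OF FAC x, of n] by simp
    ultimately show ?thesis using LIMSEQ_unique[OF lim[OF x]] by simp
  qed
  have l_out: "l x = 0" if "x \<notin> I" for x using that by (simp add: l_def)
  have lL: "l \<in> L1loc a b chi"
    by (rule X.locbdd_L1loc[OF AC_locbdd[OF ACI(1)[OF S.L2on_L1loc[OF vL] l_mint l_out]]])
  have near: "(\<lambda>x. F n x - l x) \<in> X.L2on \<and> (LINT x:I|chi. (cmod (F n x - l x))\<^sup>2) \<le> e"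
    if le: "\<And>j. j \<ge> N \<Longrightarrow> H.sqn (\<lambda>x. F n x - F j x) \<le> e" for n N e
  proof -
    define w where "w j x = indicator I x *\<^sub>R F n x - indicator I x *\<^sub>R F j x" for j x
    define w' where "w' x = indicator I x *\<^sub>R F n x - indicator I x *\<^sub>R l x" for x
    have mF: "(\<lambda>x. indicator I x *\<^sub>R F j x) \<in> borel_measurable chi" for j
      by (rule X.L1loc_meas[OF X.L2on_L1loc[OF FL]])
    have ml: "(\<lambda>x. indicator I x *\<^sub>R l x) \<in> borel_measurable chi" by (rule X.L1loc_meas[OF lL])
    have sq: "(\<lambda>x. indicator I x *\<^sub>R (cmod (f x - g x))\<^sup>2) =
       (\<lambda>x. (cmod (indicator I x *\<^sub>R f x - indicator I x *\<^sub>R g x))\<^sup>2)" for f g :: "real \<Rightarrow> complex"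
      by (auto simp: indicator_def)
    have "integrable chi (\<lambda>x. (cmod (w' x))\<^sup>2) \<and> (\<integral>x. (cmod (w' x))\<^sup>2 \<partial>chi) \<le> e"
    proof (rule conjI)
      have 1: "w j \<in> borel_measurable chi" for j unfolding w_def[abs_def] using mF by measurable
      have 2: "w' \<in> borel_measurable chi" unfolding w'_def[abs_def] using mF ml by measurable
      have 3: "integrable chi (\<lambda>x. (cmod (w j x))\<^sup>2)" for j
        using X.L2on_square[OF X.L2on_diff[OF FL FL], of n j] unfolding set_integrable_def sq w_def .
      have 4: "AE x in chi. (\<lambda>j. w j x) \<longlonglongrightarrow> w' x"
        unfolding w_def w'_def using X.AE_J by eventually_elim (intro tendsto_intros lim)
      have 5: "eventually (\<lambda>j. (\<integral>x. (cmod (w j x))\<^sup>2 \<partial>chi) \<le> e) sequentially"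
        unfolding eventually_at_top_linorder w_def set_integral_indicator_cmod[symmetric]
        using le parts(1) by (meson order_trans)
      show "integrable chi (\<lambda>x. (cmod (w' x))\<^sup>2)" "(\<integral>x. (cmod (w' x))\<^sup>2 \<partial>chi) \<le> e"
        using L2_Fatou[OF 1 2 3 4 5] by auto
    qed
    then have "set_integrable chi I (\<lambda>x. (cmod (F n x - l x))\<^sup>2)" "(LINT x:I|chi. (cmod (F n x - l x))\<^sup>2) \<le> e"
      unfolding set_integrable_def sq set_integral_indicator_cmod w'_def by blast+
    then show ?thesis
      using X.L1loc_diff[OF X.L2on_L1loc[OF FL] lL, of n] by (simp add: X.L2on_def)
  qed
  obtain N0 where "\<And>m n. m \<ge> N0 \<Longrightarrow> n \<ge> N0 \<Longrightarrow> H.sqn (\<lambda>x. F m x - F n x) < 1"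
    using cauchy[of 1] by auto
  then have "(\<lambda>x. F N0 x - l x) \<in> X.L2on" using near[of N0 N0 1] less_imp_le by blast
  from X.L2on_diff[OF FL[of N0] this] have lL2: "l \<in> X.L2on" by simp
  note l = H1I[OF vL l_mint l_out lL2]
  have "(\<lambda>n. LINT x:I|chi. (cmod (F n x - l x))\<^sup>2) \<longlonglongrightarrow> 0"
  proof (rule LIMSEQ_I)
    fix e :: real assume "0 < e"
    then obtain N where N: "\<And>m n. m \<ge> N \<Longrightarrow> n \<ge> N \<Longrightarrow> H.sqn (\<lambda>x. F m x - F n x) < e / 2"
      using cauchy[of "e/2"] by auto
    have "norm ((LINT x:I|chi. (cmod (F n x - l x))\<^sup>2) - 0) < e" if "n \<ge> N" for n
    proof -
      have "0 \<le> (LINT x:I|chi. (cmod (F n x - l x))\<^sup>2)" by (simp add: set_lebesgue_integral_def)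
      moreover have "\<dots> \<le> e / 2" using near[of N n "e/2"] N[OF that] less_imp_le by blast
      ultimately show ?thesis using \<open>0 < e\<close> by simp
    qed
    then show "\<exists>no. \<forall>n\<ge>no. norm ((LINT x:I|chi. (cmod (F n x - l x))\<^sup>2) - 0) < e" by blast
  qed
  moreover have "H.sqn (\<lambda>x. F n x - l x) = (LINT x:I|chi. (cmod (F n x - l x))\<^sup>2) +
      (LINT x:I|vs. (cmod (Der (F n) x - v x))\<^sup>2)" for n
    by (rule sqn_diff_eq[OF F FD l(1) vL AE_I2[OF refl] l(2)])
  ultimately have "(\<lambda>n. H.sqn (\<lambda>x. F n x - l x)) \<longlonglongrightarrow> 0"
    using tendsto_add[OF _ vlim] by force
  with l(1) show ?thesis by blast
qed

sublocale HC: complete_semi_inner_space HH ip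
  by unfold_locales (rule H1_complete)

section \<open>Left-continuity and the equation for the quasi-derivative\<close>

abbreviation csr :: "real \<Rightarrow> complex" where
  "csr t \<equiv> complex_of_real (sr t)"

text \<open>The canonical representative of the quasi-derivative of \<open>f\<close>, when \<open>\<tau> f = g\<close>.\<close>

definition is_qd :: "(real \<Rightarrow> complex) \<Rightarrow> (real \<Rightarrow> complex) \<Rightarrow> (real \<Rightarrow> complex) \<Rightarrow> bool" where
  "is_qd f g f1 \<longleftrightarrow>
     (\<forall>x\<in>I. f1 x = f1 c + mint chi c x f - mint mr c x (\<lambda>t. csr t * g t)) \<and>
     (AE x in vs. Der f x = f1 x)"

abbreviation "qder \<equiv> qd a b c vs chi mr sr"
abbreviation "V \<equiv> Vw a b c vs chi mr sr"
abbreviation "TL \<equiv> Tloc a b c vs chi mr sr"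
abbreviation "TM \<equiv> Tmax a b c vs chi mr sr"
abbreviation "rep \<equiv> is_rep a b c vs chi mr sr"

lemma sr_locbdd: "(\<lambda>t. complex_of_real (sr t)) \<in> locbdd a b"
proof (rule locbdd_of_real[OF sign(1)])
  show "\<bar>sr x\<bar> \<le> 1" for x using sign(2)[of x] by auto
qed

lemma L1loc_sr: "h \<in> L1loc a b mr \<Longrightarrow> (\<lambda>t. csr t * h t) \<in> L1loc a b mr"
  using R.L1loc_mult_locbdd[OF _ sr_locbdd] by (simp add: mult.commute)

lemma sr_nonzero: "complex_of_real (sr t) \<noteq> 0"
  using sign(2)[of t] by auto

text \<open>As y increases to x the sets \<open>[y, x)\<close> shrink to the empty set, so even an
  atom at x does not disturb the limit; dominated convergence does the rest.\<close>

lemma mint_tendsto_left: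
  assumes M: "locally_finite_on a b c M" and h: "h \<in> L1loc a b M" and x: "x \<in> I"
  shows "((\<lambda>y. mint M c y h) \<longlongrightarrow> mint M c x h) (at_left x)"
proof -
  interpret M: locally_finite_on a b c M by (rule M)
  obtain p where p: "p \<in> I" "p < x" using Ioo_e_less[OF x] by blast
  have "((\<lambda>y. LINT t:{y..<x}|M. h t) \<longlongrightarrow> 0) (at_left x)"
  proof (rule tendsto_at_left_sequentially[OF p(2)])
    fix Y :: "nat \<Rightarrow> real"
    assume Y: "\<And>n. Y n < x" "\<And>n. p < Y n" "incseq Y" "Y \<longlonglongrightarrow> x"
    have "(\<lambda>n. \<integral>t. indicator {Y n..<x} t *\<^sub>R h t \<partial>M) \<longlonglongrightarrow> (\<integral>t. 0 \<partial>M)"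
    proof (rule integral_dominated_convergence)
      have YI: "Y n \<in> I" for n by (rule Ioo_e_convex[OF p(1) x]) (use Y(1,2)[of n] in auto)
      show "(\<lambda>t. indicator {Y n..<x} t *\<^sub>R h t) \<in> borel_measurable M" for n
        using M.L1loc_Ico[OF h YI x, of n] by (simp add: set_integrable_def)
      show "integrable M (\<lambda>t. norm (indicator {p..<x} t *\<^sub>R h t))"
        using M.L1loc_Ico[OF h p(1) x] unfolding set_integrable_def by (rule integrable_norm)
      show "AE t in M. (\<lambda>n. indicator {Y n..<x} t *\<^sub>R h t) \<longlonglongrightarrow> 0"
      proof (rule AE_I2, rule tendsto_eventually)
        fix t
        show "eventually (\<lambda>n. indicator {Y n..<x} t *\<^sub>R h t = 0) sequentially"
        proof (cases "t < x")
          case True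
          from order_tendstoD(1)[OF Y(4) True] show ?thesis by eventually_elim simp
        qed simp
      qed
      show "AE t in M. norm (indicator {Y n..<x} t *\<^sub>R h t) \<le> norm (indicator {p..<x} t *\<^sub>R h t)" for n
        using Y(2)[of n] by (auto simp: indicator_def)
    qed simp
    then show "(\<lambda>n. LINT t:{Y n..<x}|M. h t) \<longlonglongrightarrow> 0" by (simp add: set_lebesgue_integral_def)
  qed
  then have "((\<lambda>y. mint M c x h - (LINT t:{y..<x}|M. h t)) \<longlongrightarrow> mint M c x h - 0) (at_left x)"
    by (intro tendsto_intros)
  moreover have "eventually (\<lambda>y. mint M c x h - (LINT t:{y..<x}|M. h t) = mint M c y h) (at_left x)"
    using eventually_at_left_real[OF p(2)]
  proof eventually_elim
    case (elim y)
    then have "y \<in> I" using Ioo_e_convex[OF p(1) x] by auto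
    then have "(LINT t:{y..<x}|M. h t) = mint M c x h - mint M c y h"
      using M.mint_diff_Ico[OF h _ x, of y] elim by simp
    then show ?case by simp
  qed
  ultimately show ?thesis by (simp add: tendsto_cong)
qed

text \<open>Here the full support of \<open>vs\<close> enters: every interval \<open>(y, x)\<close> has positive measure.\<close>

lemma left_continuous_AE_eq:
  assumes F: "\<And>x. x \<in> I \<Longrightarrow> (F \<longlongrightarrow> F x) (at_left x)" and G: "\<And>x. x \<in> I \<Longrightarrow> (G \<longlongrightarrow> G x) (at_left x)"
    and ae: "AE x in vs. x \<in> I \<longrightarrow> F x = (G x :: complex)" and x: "x \<in> I"
  shows "F x = G x"
proof (rule ccontr)
  assume "F x \<noteq> G x"
  then have "F x - G x \<noteq> 0" by simp
  from tendsto_imp_eventually_ne[OF tendsto_diff[OF F[OF x] G[OF x]] this]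
  have "eventually (\<lambda>y. F y - G y \<noteq> 0) (at_left x)" .
  then obtain y0 where y0: "y0 < x" "\<And>y. y0 < y \<Longrightarrow> y < x \<Longrightarrow> F y \<noteq> G y"
    unfolding eventually_at_left[OF lt_ex[THEN someI_ex]] by auto
  obtain p where p: "p \<in> I" "p < x" using Ioo_e_less[OF x] by blast
  let ?q = "max y0 p"
  have q: "?q < x" "?q \<in> I" using y0 p by (auto intro: Ioo_e_convex[OF p(1) x])
  have "{?q<..<x} \<in> null_sets vs"
  proof -
    have "AE t in vs. t \<notin> {?q<..<x}"
      using ae by eventually_elim (use y0 Ioo_e_convex[OF q(2) x] in auto)
    then show ?thesis by (subst (asm) AE_iff_null_sets[symmetric]) (auto simp: S.sets_M)
  qed
  moreover have "emeasure vs {?q<..<x} > 0" using q x by (intro supp) (auto simp: Ioo_e_def)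
  ultimately show False by (auto simp: null_sets_def)
qed

end

section \<open>Quasi-derivatives\<close>

context locally_finite_on
begin

lemma L2on_indicator:
  assumes f: "f \<in> L2on" and A: "A \<in> sets borel"
  shows "(\<lambda>x. indicator A x *\<^sub>R f x) \<in> L2on"
proof (rule L2onI)
  have eq: "(\<lambda>x. indicator J x *\<^sub>R (indicator A x *\<^sub>R f x)) = (\<lambda>x. indicator A x *\<^sub>R (indicator J x *\<^sub>R f x))"
    by (auto simp: indicator_def)
  show "set_borel_measurable M J (\<lambda>x. indicator A x *\<^sub>R f x)"
    unfolding set_borel_measurable_def eq
    by (rule borel_measurable_scaleR[OF _ L1loc_meas[OF L2on_L1loc[OF f]]]) (use A in \<open>auto simp: sets_M\<close>)
  have eq2: "(\<lambda>x. indicator J x *\<^sub>R (cmod (indicator A x *\<^sub>R f x))\<^sup>2) = (\<lambda>x. indicator A x *\<^sub>R (indicator J x *\<^sub>R (cmod (f x))\<^sup>2))"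
    by (auto simp: indicator_def)
  show "set_integrable M J (\<lambda>x. (cmod (indicator A x *\<^sub>R f x))\<^sup>2)"
    unfolding set_integrable_def eq2
    by (rule integrable_mult_indicator) (use L2on_square[OF f] A in \<open>auto simp: sets_M set_integrable_def\<close>)
qed

lemma locbdd_L2on:
  assumes F: "F \<in> locbdd a b" and x: "x \<in> J" and y: "y \<in> J"
  shows "(\<lambda>t. indicator {x..<y} t *\<^sub>R F t) \<in> L2on"
proof (rule L2onI)
  have eq: "(\<lambda>t. indicator J t *\<^sub>R (indicator {x..<y} t *\<^sub>R F t)) = (\<lambda>t. indicator {x..<y} t *\<^sub>R (indicator J t *\<^sub>R F t))"
    by (auto simp: indicator_def)
  show "set_borel_measurable M J (\<lambda>t. indicator {x..<y} t *\<^sub>R F t)"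
    unfolding set_borel_measurable_def eq
    by (rule borel_measurable_scaleR[OF _ L1loc_meas[OF locbdd_L1loc[OF F]]]) (auto simp: sets_M)
  have "set_integrable M {x..<y} (\<lambda>t. F t * cnj (F t))"
    by (rule L1loc_Ico[OF locbdd_L1loc[OF locbdd_mult[OF F locbdd_cnj[OF F]]] x y])
  then have "integrable M (\<lambda>t. cmod (indicator {x..<y} t *\<^sub>R (F t * cnj (F t))))"
    unfolding set_integrable_def by (rule integrable_norm)
  also have "(\<lambda>t. cmod (indicator {x..<y} t *\<^sub>R (F t * cnj (F t)))) = (\<lambda>t. indicator J t *\<^sub>R (cmod (indicator {x..<y} t *\<^sub>R F t))\<^sup>2)"
    using Ioo_e_convex[OF x y] by (auto simp: indicator_def norm_mult power2_eq_square)
  finally show "set_integrable M J (\<lambda>t. (cmod (indicator {x..<y} t *\<^sub>R F t))\<^sup>2)"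
    by (simp add: set_integrable_def)
qed

end

context left_definite
begin

lemma rnd_mr:
  assumes "F \<in> ACloc a b c mr sr"
  shows "rnd a b c mr sr F \<in> L1loc a b mr"
    "\<And>x. x \<in> I \<Longrightarrow> F x = F c + mint mr c x (\<lambda>t. csr t * rnd a b c mr sr F t)"
proof -
  have "\<exists>h. h \<in> L1loc a b mr \<and> (\<forall>x\<in>I. F x = F c + mint mr c x (\<lambda>t. csr t * h t))"
    using assms by (auto simp: ACloc_def)
  from someI_ex[OF this] show "rnd a b c mr sr F \<in> L1loc a b mr"
    "\<And>x. x \<in> I \<Longrightarrow> F x = F c + mint mr c x (\<lambda>t. csr t * rnd a b c mr sr F t)"
    by (auto simp: rnd_def)
qed

text \<open>Two representatives agree \<open>vs\<close>-almost everywhere by uniqueness of the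
  derivative of \<open>f\<close>. Both are left-continuous as primitives for \<open>mr\<close>, so
  they agree at every point of the interval, and outside it both are zero by normalisation. This
  gives meaning to the \<open>THE\<close> in \<open>tau\<close> and \<open>qd\<close>.\<close>

lemma rep_unique:
  assumes F: "rep f F" and G: "rep f G"
  shows "F = G"
proof
  fix x
  have lc: "(F \<longlongrightarrow> F x) (at_left x)" if rp: "rep f F" and xI: "x \<in> I" for F x
  proof -
    define h where "h = rnd a b c mr sr F"
    have "F \<in> ACloc a b c mr sr" using rp by (simp add: is_rep_def)
    note h = rnd_mr[OF this, folded h_def]
    have "((\<lambda>y. F c + mint mr c y (\<lambda>t. csr t * h t)) \<longlongrightarrow> F x) (at_left x)"
      unfolding h(2)[OF xI]
      by (intro tendsto_intros mint_tendsto_left[OF R.locally_finite_on_axioms L1loc_sr[OF h(1)] xI])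
    moreover obtain p where "p \<in> I" "p < x" using Ioo_e_less[OF xI] by blast
    then have "eventually (\<lambda>y. F c + mint mr c y (\<lambda>t. csr t * h t) = F y) (at_left x)"
      using eventually_at_left_real[of p x] h(2) Ioo_e_convex[of p a b x, OF _ xI]
      by (auto elim!: eventually_mono)
    ultimately show ?thesis by (simp add: tendsto_cong)
  qed
  show "F x = G x"
  proof (cases "x \<in> I")
    case True
    obtain h where h: "h \<in> L1loc a b vs" "\<And>x. x \<in> I \<Longrightarrow> f x = f c + mint vs c x h"
      "AE x in vs. x \<in> I \<longrightarrow> F x = - h x + mint chi c x f" using F by (auto simp: is_rep_def)
    obtain k where k: "k \<in> L1loc a b vs" "\<And>x. x \<in> I \<Longrightarrow> f x = f c + mint vs c x k"
      "AE x in vs. x \<in> I \<longrightarrow> G x = - k x + mint chi c x f" using G by (auto simp: is_rep_def)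
    have "mint vs c x (\<lambda>t. h t - k t) = 0" if "x \<in> I" for x
      using h(2)[OF that] k(2)[OF that] S.mint_diff[OF h(1) k(1) that] by simp
    from S.density_unique_Ico[OF S.L1loc_diff[OF h(1) k(1)] this] have "AE x in vs. h x - k x = 0" .
    with h(3) k(3) have "AE x in vs. x \<in> I \<longrightarrow> F x = G x" by eventually_elim auto
    from left_continuous_AE_eq[OF lc[OF F] lc[OF G] this True] show ?thesis .
  next
    case False
    then show ?thesis using F G by (simp add: is_rep_def ACloc_def)
  qed
qed

lemma the_rep: "rep f F \<Longrightarrow> (THE F. rep f F) = F"
  using rep_unique by blast

text \<open>Together with \<open>is_qd_Tloc\<close> this trades the choice operators inside
  \<open>tau\<close> and \<open>qd\<close> for the explicit integral equation
  \<open>is_qd\<close>.\<close>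

lemma Tloc_is_qd:
  assumes "(f, g) \<in> TL"
  shows "f \<in> AC" "g \<in> AC" "is_qd f g (qder f)"
proof -
  show f: "f \<in> AC" and g: "g \<in> AC" using assms by (auto simp: Tloc_def)
  obtain F where F: "rep f F" using assms by (auto simp: Tloc_def Dtau_def)
  have FAC: "F \<in> ACloc a b c mr sr" using F by (simp add: is_rep_def)
  let ?r = "rnd a b c mr sr F"
  have ae: "AE x in mr. x \<in> I \<longrightarrow> ?r x = g x" and gL: "g \<in> L1loc a b mr"
    using assms the_rep[OF F] by (auto simp: Tloc_def tau_def)
  have "AE x in mr. complex_of_real (sr x) * ?r x = complex_of_real (sr x) * g x"
    using ae R.AE_J by eventually_elim simp
  then have FG: "F x = F c + mint mr c x (\<lambda>t. csr t * g t)" if "x \<in> I" for x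
    using rnd_mr(2)[OF FAC that] R.mint_cong_AE[OF L1loc_sr[OF rnd_mr(1)[OF FAC]] L1loc_sr[OF gL] _ that] by simp
  have qf: "qder f x = mint chi c x f - F x" for x
    using the_rep[OF F] by (simp add: qd_def)
  obtain h where h: "h \<in> L1loc a b vs" "\<And>x. x \<in> I \<Longrightarrow> f x = f c + mint vs c x h"
    "AE x in vs. x \<in> I \<longrightarrow> F x = - h x + mint chi c x f" using F by (auto simp: is_rep_def)
  have "AE x in vs. Der f x = h x" by (rule ACI(2)[OF h(1,2) AC_outside[OF f]])
  then have "AE x in vs. Der f x = qder f x"
    using h(3) S.AE_J by eventually_elim (simp add: qf)
  then show "is_qd f g (qder f)"
    unfolding is_qd_def qf using FG by auto
qed

lemma primitive_locbdd:
  assumes "f \<in> L1loc a b chi" "r \<in> L1loc a b mr"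
    and "\<And>x. x \<in> I \<Longrightarrow> F x = F c + mint chi c x f - mint mr c x r"
  shows "F \<in> locbdd a b"
proof -
  have "(\<lambda>x. F c + mint chi c x f - mint mr c x r) \<in> locbdd a b"
    by (intro locbdd_diff locbdd_add locbdd_const X.mint_locbdd R.mint_locbdd assms(1,2))
  then show ?thesis using assms(3) by (subst locbdd_cong) auto
qed

lemma is_qd_locbdd:
  assumes f: "f \<in> L1loc a b chi" and g: "g \<in> L1loc a b mr" and q: "is_qd f g f1"
  shows "f1 \<in> locbdd a b"
  using primitive_locbdd[OF f L1loc_sr[OF g]] q unfolding is_qd_def by blast

lemma is_qd_Tloc:
  assumes f: "f \<in> AC" and g: "g \<in> AC" and q: "is_qd f g f1"
  shows "(f, g) \<in> TL"
proof -
  have gL: "g \<in> L1loc a b mr" by (rule R.locbdd_L1loc[OF AC_locbdd[OF g]])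
  have fL: "f \<in> L1loc a b chi" by (rule X.locbdd_L1loc[OF AC_locbdd[OF f]])
  have f1L: "f1 \<in> L1loc a b vs" by (rule S.locbdd_L1loc[OF is_qd_locbdd[OF fL gL q]])
  \<comment> \<open>The representative is recovered by solving the definition of \<open>qd\<close>
    for it; the value 0 is the normalisation that \<open>ACloc\<close> demands.\<close>
  define F where "F x = (if x \<in> I then mint chi c x f - f1 x else 0)" for x
  have Fg: "F x = F c + mint mr c x (\<lambda>t. csr t * g t)" if "x \<in> I" for x
  proof -
    have "f1 x = f1 c + mint chi c x f - mint mr c x (\<lambda>t. csr t * g t)"
      using q that unfolding is_qd_def by blast
    then show ?thesis using that c by (simp add: F_def)
  qed
  have FAC: "F \<in> ACloc a b c mr sr"
    unfolding ACloc_def using gL Fg by (auto simp: F_def)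
  have "AE x in vs. Der f x = f1 x" using q by (simp add: is_qd_def)
  from S.mint_cong_AE[OF Der(1)[OF f] f1L this]
  have "f x = f c + mint vs c x f1" if "x \<in> I" for x using Der(2)[OF f that] that by simp
  then have F: "rep f F"
    unfolding is_rep_def using FAC f1L by (intro conjI bexI[of _ f1]) (auto simp: F_def)
  let ?r = "rnd a b c mr sr F"
  have *: "mint mr c x (\<lambda>t. csr t * ?r t - csr t * g t) = 0" if "x \<in> I" for x
    using R.mint_diff[OF L1loc_sr[OF rnd_mr(1)[OF FAC]] L1loc_sr[OF gL] that] rnd_mr(2)[OF FAC that] Fg[OF that] by simp
  have "AE x in mr. complex_of_real (sr x) * ?r x - complex_of_real (sr x) * g x = 0"
    by (rule R.density_unique_Ico[OF R.L1loc_diff[OF L1loc_sr[OF rnd_mr(1)[OF FAC]] L1loc_sr[OF gL]] *])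
  then have "AE x in mr. x \<in> I \<longrightarrow> tau a b c vs chi mr sr f x = g x"
    unfolding tau_def the_rep[OF F]
    by eventually_elim (use sr_nonzero in \<open>simp flip: right_diff_distrib\<close>)
  then show ?thesis using f g F gL by (auto simp: Tloc_def Dtau_def)
qed

lemma Tmax_iff: "(f, g) \<in> TM \<longleftrightarrow> f \<in> HH \<and> g \<in> HH \<and> (\<exists>f1. is_qd f g f1)"
  using Tloc_is_qd is_qd_Tloc H1_AC unfolding Tmax_def by blast

text \<open>\<open>F\<close> is a primitive for two measures at once. The atom hypotheses compare
  \<open>vs\<close> with each of \<open>chi\<close> and \<open>mr\<close> separately, so
  \<open>F\<close> is split into its two primitives and each product with \<open>k\<close> is
  treated on its own.\<close>

lemma quasi_derivative_parts:
  assumes f: "f \<in> L1loc a b chi" and r: "r \<in> L1loc a b mr"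
    and F: "\<And>x. x \<in> I \<Longrightarrow> F x = F c + mint chi c x f - mint mr c x r"
    and k: "k \<in> AC" and d: "d \<in> L1loc a b vs" "AE x in vs. Der k x = d x" and y: "y \<in> I"
  shows "F y * k y = F c * k c + mint chi c y (\<lambda>t. f t * k t) - mint mr c y (\<lambda>t. r t * k t)
           + mint vs c y (\<lambda>t. F t * d t)"
proof -
  define A where "A x = F c + mint chi c x f" for x
  define B where "B x = mint mr c x r" for x
  have kd: "k x = k c + mint vs c x d" if "x \<in> I" for x
    using Der(2)[OF k that] S.mint_cong_AE[OF Der(1)[OF k] d that] by simp
  have AL: "A \<in> locbdd a b" unfolding A_def[abs_def] by (intro locbdd_add locbdd_const X.mint_locbdd f)
  have BL: "B \<in> locbdd a b" unfolding B_def[abs_def] by (intro R.mint_locbdd r)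
  have "A y * k y = A c * k c + mint chi c y (\<lambda>t. f t * k t) + mint vs c y (\<lambda>t. A t * d t)"
    by (rule integration_by_parts[OF X.locally_finite_on_axioms S.locally_finite_on_axioms _ f d(1) _ kd y])
      (use atoms in \<open>auto simp: A_def\<close>)
  moreover have "B y * k y = B c * k c + mint mr c y (\<lambda>t. r t * k t) + mint vs c y (\<lambda>t. B t * d t)"
    by (rule integration_by_parts[OF R.locally_finite_on_axioms S.locally_finite_on_axioms _ r d(1) _ kd y])
      (use atoms in \<open>auto simp: B_def\<close>)
  moreover have "mint vs c y (\<lambda>t. F t * d t) = mint vs c y (\<lambda>t. A t * d t - B t * d t)"
  proof (rule S.mint_cong[OF _ y])
    fix t assume "t \<in> I"
    then have "F t = A t - B t" using F[of t] by (simp add: A_def B_def)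
    then show "F t * d t = A t * d t - B t * d t" by (simp add: left_diff_distrib)
  qed
  moreover have "\<dots> = mint vs c y (\<lambda>t. A t * d t) - mint vs c y (\<lambda>t. B t * d t)"
    by (rule S.mint_diff)
      (use S.L1loc_mult_locbdd[OF d(1) AL] S.L1loc_mult_locbdd[OF d(1) BL] y in \<open>auto simp: mult.commute\<close>)
  moreover have "F y = A y - B y" "A c = F c" "B c = 0" using F[OF y] by (simp_all add: A_def B_def)
  ultimately show ?thesis by algebra
qed

text \<open>The window for \<open>Der h\<close> is half-open because of the convention for
  \<open>mint\<close>: an atom of \<open>vs\<close> at \<open>\<alpha>\<close> can carry a nonzero
  derivative although \<open>h \<alpha> = 0\<close>, whereas one at \<open>\<beta>\<close>
  cannot.\<close>

definition test_fun :: "(real \<Rightarrow> complex) \<Rightarrow> bool" where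
  "test_fun h \<longleftrightarrow> h \<in> HH \<and> (\<exists>\<alpha>\<in>I. \<exists>\<beta>\<in>I. \<alpha> < \<beta> \<and> (\<forall>x. x \<le> \<alpha> \<or> \<beta> \<le> x \<longrightarrow> h x = 0) \<and>
     (AE t in vs. t \<notin> {\<alpha>..<\<beta>} \<longrightarrow> Der h t = 0))"

lemma test_fun_cnj: "test_fun h \<Longrightarrow> test_fun (\<lambda>x. cnj (h x))"
proof -
  assume "test_fun h"
  then obtain \<alpha> \<beta> where h: "h \<in> HH" "\<alpha> \<in> I" "\<beta> \<in> I" "\<alpha> < \<beta>" "\<forall>x. x \<le> \<alpha> \<or> \<beta> \<le> x \<longrightarrow> h x = 0"
    "AE t in vs. t \<notin> {\<alpha>..<\<beta>} \<longrightarrow> Der h t = 0" by (auto simp: test_fun_def)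
  have "AE t in vs. t \<notin> {\<alpha>..<\<beta>} \<longrightarrow> Der (\<lambda>x. cnj (h x)) t = 0"
    using h(6) H1_cnj(2)[OF h(1)] by eventually_elim simp
  then show ?thesis unfolding test_fun_def using h H1_cnj(1)[OF h(1)] by auto
qed

text \<open>Integration by parts evaluated at both ends of the support of \<open>k\<close> and
  subtracted. The boundary products vanish there and the constant \<open>F c * k c\<close>
  cancels.\<close>

lemma quasi_derivative_test:
  assumes f: "f \<in> L1loc a b chi" and r: "r \<in> L1loc a b mr"
    and F: "\<And>x. x \<in> I \<Longrightarrow> F x = F c + mint chi c x f - mint mr c x r"
    and k: "test_fun k"
  shows "(LINT t:I|chi. f t * k t) + (LINT t:I|vs. F t * Der k t) = (LINT t:I|mr. r t * k t)"
    "set_integrable mr I (\<lambda>t. r t * k t)" "set_integrable vs I (\<lambda>t. F t * Der k t)"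
proof -
  obtain \<alpha> \<beta> where H: "k \<in> HH" and ab: "\<alpha> \<in> I" "\<beta> \<in> I" "\<alpha> < \<beta>"
    and k0: "\<And>x. x \<le> \<alpha> \<or> \<beta> \<le> x \<Longrightarrow> k x = 0"
    and d0: "AE t in vs. t \<notin> {\<alpha>..<\<beta>} \<longrightarrow> Der k t = 0"
    using k by (auto simp: test_fun_def)
  note AC = H1_AC[OF H]
  have FL: "F \<in> locbdd a b" by (rule primitive_locbdd[OF f r F])
  have le: "\<alpha> \<le> \<beta>" using ab by simp
  have L: "(\<lambda>t. f t * k t) \<in> L1loc a b chi" "(\<lambda>t. r t * k t) \<in> L1loc a b mr"
    by (rule X.L1loc_mult_locbdd[OF f AC_locbdd[OF AC]], rule R.L1loc_mult_locbdd[OF r AC_locbdd[OF AC]])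
  have L3: "(\<lambda>t. F t * Der k t) \<in> L1loc a b vs"
    using S.L1loc_mult_locbdd[OF Der(1)[OF AC] FL] by (simp add: mult.commute)
  have z: "AE t in chi. t \<notin> {\<alpha>..<\<beta>} \<longrightarrow> f t * k t = 0" "AE t in mr. t \<notin> {\<alpha>..<\<beta>} \<longrightarrow> r t * k t = 0"
    using k0 by auto
  have z3: "AE t in vs. t \<notin> {\<alpha>..<\<beta>} \<longrightarrow> F t * Der k t = 0" using d0 by eventually_elim auto
  note i1 = X.integral_compact_support[OF L(1) ab(1,2) le z(1)]
  note i2 = R.integral_compact_support[OF L(2) ab(1,2) le z(2)]
  note i3 = S.integral_compact_support[OF L3 ab(1,2) le z3]
  show "set_integrable mr I (\<lambda>t. r t * k t)" "set_integrable vs I (\<lambda>t. F t * Der k t)"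
    by (rule i2(1), rule i3(1))
  have parts: "F c * k c + mint chi c y (\<lambda>t. f t * k t) - mint mr c y (\<lambda>t. r t * k t)
           + mint vs c y (\<lambda>t. F t * Der k t) = 0" if "y \<in> I" "k y = 0" for y
    using quasi_derivative_parts[OF f r F AC Der(1)[OF AC] AE_I2[OF refl] that(1)] that(2) by simp
  have "(LINT t:I|chi. f t * k t) + (LINT t:I|vs. F t * Der k t) - (LINT t:I|mr. r t * k t) =
    (F c * k c + mint chi c \<beta> (\<lambda>t. f t * k t) - mint mr c \<beta> (\<lambda>t. r t * k t)
           + mint vs c \<beta> (\<lambda>t. F t * Der k t)) -
    (F c * k c + mint chi c \<alpha> (\<lambda>t. f t * k t) - mint mr c \<alpha> (\<lambda>t. r t * k t)
           + mint vs c \<alpha> (\<lambda>t. F t * Der k t))"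
    unfolding i1(2) i2(2) i3(2) by simp
  also have "\<dots> = 0" using parts[OF ab(1)] parts[OF ab(2)] k0 by simp
  finally show "(LINT t:I|chi. f t * k t) + (LINT t:I|vs. F t * Der k t) = (LINT t:I|mr. r t * k t)"
    by simp
qed

end

section \<open>The weak formulation\<close>

context left_definite
begin

text \<open>The Green identity on which the weak form, the Lagrange identity and the boundary value
  argument all rest. Replacing \<open>f1\<close> by \<open>Der f\<close> under the
  \<open>vs\<close>-integral is legitimate almost everywhere and makes that term symmetric in
  \<open>f\<close> and \<open>k\<close>.\<close>

lemma is_qd_parts:
  assumes q: "is_qd f g f1" and f: "f \<in> HH" and g: "g \<in> HH" and k: "k \<in> HH" and y: "y \<in> I"
  shows "f1 y * k y = f1 c * k c + mint chi c y (\<lambda>t. f t * k t)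
    - mint mr c y (\<lambda>t. csr t * g t * k t) + mint vs c y (\<lambda>t. Der f t * Der k t)"
proof -
  note fL = H1_L1loc(1)[OF f] and gL = H1_L1loc(2)[OF g]
  note kL = Der(1)[OF H1_AC[OF k]]
  have q1: "\<And>x. x \<in> I \<Longrightarrow> f1 x = f1 c + mint chi c x f - mint mr c x (\<lambda>t. csr t * g t)"
    and q2: "AE x in vs. Der f x = f1 x" using q by (auto simp: is_qd_def)
  have "mint vs c y (\<lambda>t. f1 t * Der k t) = mint vs c y (\<lambda>t. Der f t * Der k t)"
  proof (rule S.mint_cong_AE[OF _ _ _ y])
    show "(\<lambda>t. f1 t * Der k t) \<in> L1loc a b vs"
      using S.L1loc_mult_locbdd[OF kL is_qd_locbdd[OF fL gL q]] by (simp add: mult.commute)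
    show "(\<lambda>t. Der f t * Der k t) \<in> L1loc a b vs"
      by (intro S.set_integrable_J_L1loc S.L2on_mult_integrable H1_Der f k) auto
    show "AE t in vs. f1 t * Der k t = Der f t * Der k t" using q2 by eventually_elim simp
  qed
  with quasi_derivative_parts[OF fL L1loc_sr[OF gL] q1 H1_AC[OF k] kL AE_I2[OF refl] y]
  show ?thesis by simp
qed

text \<open>The sesquilinear form of the signed measure, with the test function first, so that
  \<open>rho h\<close> is the linear functional to which Riesz is applied.\<close>

definition rho :: "(real \<Rightarrow> complex) \<Rightarrow> (real \<Rightarrow> complex) \<Rightarrow> complex" where
  "rho h v = (LINT t:I|mr. csr t * v t * cnj (h t))"

lemma weak_form_test:
  assumes f: "f \<in> HH" and g: "g \<in> HH" and h: "test_fun h"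
    and F: "\<And>x. x \<in> I \<Longrightarrow> F x = F c + mint chi c x f - mint mr c x (\<lambda>t. csr t * g t)"
  shows "(LINT t:I|chi. f t * cnj (h t)) + (LINT t:I|vs. F t * cnj (Der h t)) = rho h g"
    "set_integrable vs I (\<lambda>t. F t * cnj (Der h t))"
proof -
  note fL = H1_L1loc(1)[OF f] and gL = H1_L1loc(2)[OF g]
  note T = quasi_derivative_test[OF fL L1loc_sr[OF gL] F test_fun_cnj[OF h]]
  have hH: "h \<in> HH" using h by (simp add: test_fun_def)
  have FL: "F \<in> locbdd a b" by (rule primitive_locbdd[OF fL L1loc_sr[OF gL] F])
  have ae: "AE t in vs. F t * Der (\<lambda>x. cnj (h x)) t = F t * cnj (Der h t)"
    using H1_cnj(2)[OF hH] by eventually_elim simp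
  have L: "(\<lambda>t. F t * cnj (Der h t)) \<in> L1loc a b vs"
    using S.L1loc_mult_locbdd[OF S.L1loc_cnj[OF Der(1)[OF H1_AC[OF hH]]] FL] by (simp add: mult.commute)
  note L' = S.set_integrable_J_L1loc[OF T(3)]
  have "(LINT t:I|vs. F t * Der (\<lambda>x. cnj (h x)) t) = (LINT t:I|vs. F t * cnj (Der h t))"
    by (rule S.set_integral_cong_L1loc[OF L' L ae]) auto
  with T(1) show "(LINT t:I|chi. f t * cnj (h t)) + (LINT t:I|vs. F t * cnj (Der h t)) = rho h g"
    by (simp add: rho_def)
  have m: "set_borel_measurable vs I (\<lambda>t. F t * Der (\<lambda>x. cnj (h x)) t)" "set_borel_measurable vs I (\<lambda>t. F t * cnj (Der h t))"
    using S.L1loc_set_meas[OF L'] S.L1loc_set_meas[OF L] by auto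
  show "set_integrable vs I (\<lambda>t. F t * cnj (Der h t))"
    using T(3) unfolding S.set_integrable_cong_AE_J[OF m ae] .
qed

lemma is_qd_weak_form:
  assumes q: "is_qd f g f1" and f: "f \<in> HH" and g: "g \<in> HH" and h: "test_fun h"
  shows "ip f h = rho h g"
proof -
  have q1: "\<And>x. x \<in> I \<Longrightarrow> f1 x = f1 c + mint chi c x f - mint mr c x (\<lambda>t. csr t * g t)"
    and q2: "AE x in vs. Der f x = f1 x" using q by (auto simp: is_qd_def)
  have hH: "h \<in> HH" using h by (simp add: test_fun_def)
  note W = weak_form_test[OF f g h q1]
  have "(LINT t:I|vs. Der f t * cnj (Der h t)) = (LINT t:I|vs. f1 t * cnj (Der h t))"
  proof (rule S.set_integral_cong_L1loc)
    show "(\<lambda>t. Der f t * cnj (Der h t)) \<in> L1loc a b vs"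
      by (intro S.set_integrable_J_L1loc S.L2on_mult_integrable S.L2on_cnj H1_Der f hH) auto
    show "(\<lambda>t. f1 t * cnj (Der h t)) \<in> L1loc a b vs" by (rule S.set_integrable_J_L1loc[OF W(2)])
    show "AE t in vs. Der f t * cnj (Der h t) = f1 t * cnj (Der h t)" using q2 by eventually_elim simp
  qed auto
  with W(1) show ?thesis by (simp add: ip_eq)
qed

lemma vs_Ico_positive:
  assumes "\<alpha> \<in> I" "\<beta> \<in> I" "\<alpha> < \<beta>"
  shows "0 < measure vs {\<alpha>..<\<beta>}" "emeasure vs {\<alpha>..<\<beta>} < \<infinity>"
proof -
  have "emeasure vs {\<alpha><..<\<beta>} \<le> emeasure vs {\<alpha>..<\<beta>}" by (intro emeasure_mono) (auto simp: S.sets_M)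
  moreover have "emeasure vs {\<alpha><..<\<beta>} > 0" by (rule supp) (use assms in \<open>auto simp: Ioo_e_def\<close>)
  ultimately have pos: "emeasure vs {\<alpha>..<\<beta>} > 0" by simp
  have "emeasure vs {\<alpha>..<\<beta>} \<le> emeasure vs {\<alpha>..\<beta>}" by (intro emeasure_mono) (auto simp: S.sets_M)
  then show fin: "emeasure vs {\<alpha>..<\<beta>} < \<infinity>" using S.finite_Icc[OF assms(1,2)] by (rule le_less_trans)
  show "0 < measure vs {\<alpha>..<\<beta>}" using pos fin by (simp add: measure_def enn2real_positive_iff)
qed

text \<open>The primitive starts at zero in \<open>\<alpha>\<close>; the vanishing mean brings it
  back to zero at \<open>\<beta>\<close>, so it has compact support.\<close>

lemma test_fun_primitive:
  assumes ab: "\<alpha> \<in> I" "\<beta> \<in> I" "\<alpha> < \<beta>" and \<phi>: "\<phi> \<in> S.L2on" and zero: "\<And>t. t \<notin> {\<alpha>..<\<beta>} \<Longrightarrow> \<phi> t = 0"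
    and mean: "(LINT t:{\<alpha>..<\<beta>}|vs. \<phi> t) = 0"
  obtains h where "test_fun h" "AE t in vs. Der h t = \<phi> t"
proof -
  note \<phi>L = S.L2on_L1loc[OF \<phi>]
  define h where "h x = (if x \<in> I then mint vs c x \<phi> - mint vs c \<alpha> \<phi> else 0)" for x
  have h1: "h x = h c + mint vs c x \<phi>" if "x \<in> I" for x using that c by (simp add: h_def)
  have h2: "h x = 0" if "x \<notin> I" for x using that by (simp add: h_def)
  have h0: "h x = 0" if "x \<le> \<alpha> \<or> \<beta> \<le> x" for x
  proof (cases "x \<in> I")
    case True
    have z: "(LINT t:{p..<q}|vs. \<phi> t) = 0" if "q \<le> \<alpha> \<or> \<beta> \<le> p" for p q
    proof -
      have "indicator {p..<q} t *\<^sub>R \<phi> t = 0" for t using that zero[of t] by (auto simp: indicator_def)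
      then show ?thesis unfolding set_lebesgue_integral_def by (simp only: Bochner_Integration.integral_zero)
    qed
    show ?thesis
    proof (cases "x \<le> \<alpha>")
      case xa: True
      then show ?thesis using S.mint_diff_Ico[OF \<phi>L True ab(1) xa] z[of \<alpha> x] True by (simp add: h_def)
    next
      case False
      with that have xb: "\<beta> \<le> x" by simp
      show ?thesis using S.mint_diff_Ico[OF \<phi>L ab(2) True xb] S.mint_diff_Ico[OF \<phi>L ab(1,2)] z[of x \<beta>] mean ab(3) True xb
        by (simp add: h_def)
    qed
  qed (rule h2)
  have "(\<lambda>x. mint vs c x \<phi> - mint vs c \<alpha> \<phi>) \<in> locbdd a b"
    by (intro locbdd_diff S.mint_locbdd locbdd_const \<phi>L)
  then have "h \<in> locbdd a b" by (subst locbdd_cong[where G="\<lambda>x. mint vs c x \<phi> - mint vs c \<alpha> \<phi>"]) (auto simp: h_def)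
  from X.locbdd_L2on[OF this ab(1,2)] have "(\<lambda>t. indicator {\<alpha>..<\<beta>} t *\<^sub>R h t) \<in> X.L2on" .
  also have "(\<lambda>t. indicator {\<alpha>..<\<beta>} t *\<^sub>R h t) = h"
    using h0 by (auto simp: indicator_def fun_eq_iff)
  finally have hL: "h \<in> X.L2on" .
  have hH: "h \<in> HH" by (rule H1I(1)[OF \<phi> h1 h2 hL])
  have hD: "AE t in vs. Der h t = \<phi> t" by (rule H1I(2)[OF \<phi> h1 h2 hL])
  have "AE t in vs. t \<notin> {\<alpha>..<\<beta>} \<longrightarrow> Der h t = 0"
    using hD by eventually_elim (use zero in auto)
  then have "test_fun h" unfolding test_fun_def using hH ab h0 by blast
  then show ?thesis using that hD by blast
qed

text \<open>The du Bois-Reymond argument: testing with a primitive of \<open>w - mean w\<close> shows that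
  \<open>w = f' - \<integral> f dchi + \<integral> g drho\<close> is locally, hence globally, constant.\<close>

lemma weak_form_imp_Tmax:
  assumes f: "f \<in> HH" and g: "g \<in> HH" and weak: "\<And>h. test_fun h \<Longrightarrow> ip f h = rho h g"
  shows "(f, g) \<in> TM"
proof -
  note fL = H1_L1loc(1)[OF f] and gL = H1_L1loc(2)[OF g]
  \<comment> \<open>The candidate quasi-derivative up to an additive constant, normalised to vanish
    at \<open>c\<close>.\<close>
  define F where "F x = mint chi c x f - mint mr c x (\<lambda>t. csr t * g t)" for x
  have Fc: "F x = F c + mint chi c x f - mint mr c x (\<lambda>t. csr t * g t)" for x
    by (simp add: F_def)
  have FL: "F \<in> locbdd a b"
    unfolding F_def[abs_def] by (intro locbdd_diff X.mint_locbdd R.mint_locbdd fL L1loc_sr gL)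
  define w where "w t = Der f t - F t" for t
  have wL: "w \<in> L1loc a b vs"
    unfolding w_def[abs_def] by (intro S.L1loc_diff Der(1) H1_AC f S.locbdd_L1loc FL)
  have orth: "(LINT t:I|vs. w t * cnj (Der h t)) = 0" "set_integrable vs I (\<lambda>t. w t * cnj (Der h t))" if h: "test_fun h" for h
  proof -
    have hH: "h \<in> HH" using h by (simp add: test_fun_def)
    note W = weak_form_test[OF f g h Fc]
    have i: "set_integrable vs I (\<lambda>t. Der f t * cnj (Der h t))"
      by (intro S.L2on_mult_integrable S.L2on_cnj H1_Der f hH) auto
    have "(LINT t:I|vs. w t * cnj (Der h t)) = (LINT t:I|vs. Der f t * cnj (Der h t)) - (LINT t:I|vs. F t * cnj (Der h t))"
      unfolding w_def left_diff_distrib by (rule set_integral_diff(2)[OF i W(2)])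
    also have "(LINT t:I|vs. Der f t * cnj (Der h t)) = (LINT t:I|vs. F t * cnj (Der h t))"
      using trans[OF W(1) weak[OF h, symmetric]] unfolding ip_eq add_left_cancel by (rule sym)
    also have "\<dots> - \<dots> = 0" by simp
    finally show "(LINT t:I|vs. w t * cnj (Der h t)) = 0" .
    show "set_integrable vs I (\<lambda>t. w t * cnj (Der h t))"
      unfolding w_def left_diff_distrib by (rule set_integral_diff(1)[OF i W(2)])
  qed
  have const: "\<exists>\<kappa>. AE t in vs. t \<in> {\<alpha>..<\<beta>} \<longrightarrow> w t = \<kappa>" if ab: "\<alpha> \<in> I" "\<beta> \<in> I" "\<alpha> < \<beta>" for \<alpha> \<beta>
  proof -
    define m where "m = measure vs {\<alpha>..<\<beta>}"
    have m: "m > 0" and fin: "emeasure vs {\<alpha>..<\<beta>} < \<infinity>" unfolding m_def using vs_Ico_positive[OF ab] by auto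
    define \<kappa> where "\<kappa> = (LINT t:{\<alpha>..<\<beta>}|vs. w t) / m"
    \<comment> \<open>This is \<open>w - \<kappa>\<close> cut to the window. It is written as a
      difference because the two parts are square-integrable for different reasons:
      \<open>Der f\<close> globally, \<open>F + \<kappa>\<close> only as a locally bounded function
      on a compact window.\<close>
    define \<phi> where "\<phi> t = indicator {\<alpha>..<\<beta>} t *\<^sub>R Der f t - indicator {\<alpha>..<\<beta>} t *\<^sub>R (F t + \<kappa>)" for t
    have \<phi>_in: "\<phi> t = w t - \<kappa>" if "t \<in> {\<alpha>..<\<beta>}" for t using that by (simp add: \<phi>_def w_def)
    have \<phi>_out: "\<phi> t = 0" if "t \<notin> {\<alpha>..<\<beta>}" for t using that by (simp add: \<phi>_def)
    have \<phi>: "\<phi> \<in> S.L2on"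
      unfolding \<phi>_def[abs_def]
      by (intro S.L2on_diff S.L2on_indicator H1_Der f S.locbdd_L2on locbdd_add FL locbdd_const ab) auto
    have sub: "{\<alpha>..<\<beta>} \<subseteq> I" using Ioo_e_convex[OF ab(1,2)] by auto
    have ci: "set_integrable vs {\<alpha>..<\<beta>} (\<lambda>_. k)" "(LINT t:{\<alpha>..<\<beta>}|vs. k) = m * k" for k :: complex
      using fin by (auto simp: set_integrable_def set_lebesgue_integral_def S.sets_M m_def scaleR_conv_of_real
          intro!: integrable_mult_left)
    have mean: "(LINT t:{\<alpha>..<\<beta>}|vs. \<phi> t) = 0"
    proof -
      have "(LINT t:{\<alpha>..<\<beta>}|vs. \<phi> t) = (LINT t:{\<alpha>..<\<beta>}|vs. w t - \<kappa>)"
        by (rule set_lebesgue_integral_cong) (auto simp: S.sets_M \<phi>_in)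
      also have "\<dots> = (LINT t:{\<alpha>..<\<beta>}|vs. w t) - m * \<kappa>"
        by (subst set_integral_diff(2)[OF S.L1loc_Ico[OF wL ab(1,2)] ci(1)]) (simp add: ci(2))
      also have "\<dots> = 0" using m by (simp add: \<kappa>_def)
      finally show ?thesis .
    qed
    obtain h where h: "test_fun h" "AE t in vs. Der h t = \<phi> t"
      using test_fun_primitive[OF ab \<phi> \<phi>_out mean] by blast
    have i\<phi>: "set_integrable vs I (\<lambda>t. \<phi> t * cnj (\<phi> t))"
      by (rule S.L2on_mult_integrable[OF \<phi> S.L2on_cnj[OF \<phi>]]) auto
    have i2: "set_integrable vs I (\<lambda>t. \<kappa> * cnj (\<phi> t))"
    proof (rule set_integrable_mult_right)
      have "set_integrable vs {\<alpha>..<\<beta>} (\<lambda>t. cnj (\<phi> t))"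
        by (rule S.L1loc_Ico[OF S.L2on_L1loc[OF S.L2on_cnj[OF \<phi>]] ab(1,2)])
      also have "set_integrable vs {\<alpha>..<\<beta>} (\<lambda>t. cnj (\<phi> t)) = set_integrable vs I (\<lambda>t. cnj (\<phi> t))"
        unfolding set_integrable_def
        by (rule Bochner_Integration.integrable_cong) (use \<phi>_out sub in \<open>auto simp: indicator_def\<close>)
      finally show "set_integrable vs I (\<lambda>t. cnj (\<phi> t))" .
    qed
    have mean_cnj: "(LINT t:I|vs. \<kappa> * cnj (\<phi> t)) = 0"
    proof -
      have "(LINT t:I|vs. \<kappa> * cnj (\<phi> t)) = \<kappa> * (LINT t:I|vs. cnj (\<phi> t))" by simp
      also have "(LINT t:I|vs. cnj (\<phi> t)) = (\<integral>t. cnj (indicator {\<alpha>..<\<beta>} t *\<^sub>R \<phi> t) \<partial>vs)"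
        unfolding set_lebesgue_integral_def
        by (rule Bochner_Integration.integral_cong) (use \<phi>_out sub in \<open>auto simp: indicator_def\<close>)
      also have "\<dots> = cnj (LINT t:{\<alpha>..<\<beta>}|vs. \<phi> t)"
        unfolding set_lebesgue_integral_def by (rule Bochner_Integration.integral_cnj)
      finally show ?thesis by (simp add: mean)
    qed
    \<comment> \<open>On the window \<open>w = \<phi> + \<kappa>\<close>, and the constant pairs to
      zero with the mean-free \<open>\<phi>\<close>. What remains is the squared norm of
      \<open>\<phi>\<close>.\<close>
    have "0 = (LINT t:I|vs. w t * cnj (Der h t))" using orth(1)[OF h(1)] by simp
    also have "\<dots> = (LINT t:I|vs. \<phi> t * cnj (\<phi> t) + \<kappa> * cnj (\<phi> t))"
    proof (rule S.set_integral_cong_L1loc)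
      show "(\<lambda>t. w t * cnj (Der h t)) \<in> L1loc a b vs" by (rule S.set_integrable_J_L1loc[OF orth(2)[OF h(1)]])
      show "(\<lambda>t. \<phi> t * cnj (\<phi> t) + \<kappa> * cnj (\<phi> t)) \<in> L1loc a b vs"
        by (intro S.set_integrable_J_L1loc set_integral_add i\<phi> i2)
      show "AE t in vs. w t * cnj (Der h t) = \<phi> t * cnj (\<phi> t) + \<kappa> * cnj (\<phi> t)"
        using h(2)
      proof eventually_elim
        case (elim t)
        show ?case
        proof (cases "t \<in> {\<alpha>..<\<beta>}")
          case True
          then have "w t = \<phi> t + \<kappa>" by (simp add: \<phi>_in)
          then show ?thesis by (simp add: elim distrib_right)
        qed (simp add: elim \<phi>_out)
      qed
    qed auto
    also have "\<dots> = (LINT t:I|vs. \<phi> t * cnj (\<phi> t))"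
      using set_integral_add(2)[OF i\<phi> i2] mean_cnj by simp
    finally have "(LINT t:I|vs. (cmod (\<phi> t))\<^sup>2) = 0"
      using S.set_integral_cmod_square[of I \<phi>] by simp
    then have "AE t in vs. indicator I t *\<^sub>R (cmod (\<phi> t))\<^sup>2 = 0"
      using integral_nonneg_eq_0_iff_AE[OF S.L2on_square[OF \<phi>, unfolded set_integrable_def]]
      by (simp add: set_lebesgue_integral_def)
    then have "AE t in vs. t \<in> {\<alpha>..<\<beta>} \<longrightarrow> w t = \<kappa>"
      by eventually_elim (use sub \<phi>_in in auto)
    then show ?thesis by blast
  qed
  \<comment> \<open>The reference window \<open>[p, c)\<close> has positive \<open>vs\<close>-mass,
    so the constant on any larger window must be the same \<open>\<kappa>\<close>.\<close>
  obtain p where p: "p \<in> I" "p < c" using Ioo_e_less[OF c] by blast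
  obtain \<kappa> where \<kappa>: "AE t in vs. t \<in> {p..<c} \<longrightarrow> w t = \<kappa>" using const[OF p(1) c p(2)] by blast
  have mint0: "mint vs c x (\<lambda>t. w t - \<kappa>) = 0" if x: "x \<in> I" for x
  proof -
    let ?\<alpha> = "min p x" and ?\<beta> = "max c x"
    have ab: "?\<alpha> \<in> I" "?\<beta> \<in> I" "?\<alpha> < ?\<beta>" using p c x by (auto simp: Ioo_e_min_max)
    obtain \<kappa>' where \<kappa>': "AE t in vs. t \<in> {?\<alpha>..<?\<beta>} \<longrightarrow> w t = \<kappa>'" using const[OF ab] by blast
    have "\<kappa>' = \<kappa>"
    proof (rule ccontr)
      assume ne: "\<kappa>' \<noteq> \<kappa>"
      have "AE t in vs. t \<notin> {p..<c}" using \<kappa> \<kappa>' by eventually_elim (use ne in auto)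
      then have "{p..<c} \<in> null_sets vs" by (subst (asm) AE_iff_null_sets[symmetric]) (auto simp: S.sets_M)
      then show False using vs_Ico_positive(1)[OF p(1) c p(2)] by (auto simp: null_sets_def measure_def)
    qed
    have "mint vs c x (\<lambda>t. w t - \<kappa>) = (\<integral>t. S.kern x t *\<^sub>R (w t - \<kappa>) \<partial>vs)"
      by (rule S.mint_kern(2)[OF S.L1loc_diff[OF wL S.locbdd_L1loc[OF locbdd_const]] x])
    also have "\<dots> = 0"
    proof (rule integral_eq_zero_AE)
      show "AE t in vs. S.kern x t *\<^sub>R (w t - \<kappa>) = 0"
        using \<kappa>' by eventually_elim (use \<open>\<kappa>' = \<kappa>\<close> p in \<open>auto simp: S.kern_cases\<close>)
    qed
    finally show ?thesis .
  qed
  have w: "AE t in vs. w t - \<kappa> = 0"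
    by (rule S.density_unique_Ico[OF S.L1loc_diff[OF wL S.locbdd_L1loc[OF locbdd_const]] mint0])
  have "AE t in vs. Der f t = \<kappa> + F t" using w by eventually_elim (simp add: w_def algebra_simps)
  then have "is_qd f g (\<lambda>x. \<kappa> + F x)"
    unfolding is_qd_def by (auto simp: F_def)
  with f g show ?thesis by (auto simp: Tmax_iff)
qed

end

section \<open>Bounded functionals and the maximal relation\<close>

context left_definite
begin

lemma rho_cnj: "cnj (rho h v) = rho v h"
proof -
  have "cnj (rho h v) = (\<integral>t. cnj (indicator I t *\<^sub>R (csr t * v t * cnj (h t))) \<partial>mr)"
    unfolding rho_def set_lebesgue_integral_def by (rule Bochner_Integration.integral_cnj[symmetric])
  also have "\<dots> = rho v h"
    unfolding rho_def set_lebesgue_integral_def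
    by (rule Bochner_Integration.integral_cong) (auto simp: mult_ac)
  finally show ?thesis .
qed

section \<open>Bounded functionals on H1\<close>

definition bounded_functional :: "((real \<Rightarrow> complex) \<Rightarrow> complex) \<Rightarrow> bool" where
  "bounded_functional \<phi> \<longleftrightarrow>
     (\<forall>f\<in>HH. \<forall>g\<in>HH. \<phi> (\<lambda>x. f x + g x) = \<phi> f + \<phi> g) \<and>
     (\<forall>f\<in>HH. \<forall>k. \<phi> (\<lambda>x. k * f x) = k * \<phi> f) \<and>
     (\<exists>K\<ge>0. \<forall>f\<in>HH. (cmod (\<phi> f))\<^sup>2 \<le> K * H.sqn f)"

lemma bounded_functionalI:
  assumes "\<And>f g. f \<in> HH \<Longrightarrow> g \<in> HH \<Longrightarrow> \<phi> (\<lambda>x. f x + g x) = \<phi> f + \<phi> g"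
    and "\<And>f k. f \<in> HH \<Longrightarrow> \<phi> (\<lambda>x. k * f x) = k * \<phi> f"
    and "0 \<le> K" "\<And>f. f \<in> HH \<Longrightarrow> (cmod (\<phi> f))\<^sup>2 \<le> K * H.sqn f"
  shows "bounded_functional \<phi>"
  using assms unfolding bounded_functional_def by blast

lemma bounded_functional_riesz:
  assumes "bounded_functional \<phi>"
  obtains w where "w \<in> HH" "\<And>f. f \<in> HH \<Longrightarrow> \<phi> f = ip f w"
proof -
  obtain K where "\<forall>f\<in>HH. (cmod (\<phi> f))\<^sup>2 \<le> K * H.sqn f" using assms by (auto simp: bounded_functional_def)
  then show ?thesis
    using HC.riesz_representation[of \<phi> K] assms that unfolding bounded_functional_def by blast
qed

lemma bounded_functional_add:
  assumes "bounded_functional \<phi>" "bounded_functional \<psi>"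
  shows "bounded_functional (\<lambda>f. \<phi> f + \<psi> f)"
proof -
  obtain K where K: "0 \<le> K" "\<And>f. f \<in> HH \<Longrightarrow> (cmod (\<phi> f))\<^sup>2 \<le> K * H.sqn f"
    using assms(1) by (auto simp: bounded_functional_def)
  obtain L where L: "0 \<le> L" "\<And>f. f \<in> HH \<Longrightarrow> (cmod (\<psi> f))\<^sup>2 \<le> L * H.sqn f"
    using assms(2) by (auto simp: bounded_functional_def)
  show ?thesis
  proof (rule bounded_functionalI)
    show "0 \<le> 2 * K + 2 * L" using K L by simp
    fix f assume f: "f \<in> HH"
    show "(cmod (\<phi> f + \<psi> f))\<^sup>2 \<le> (2 * K + 2 * L) * H.sqn f"
      using cmod_add_square_le[of "\<phi> f" "\<psi> f"] K(2)[OF f] L(2)[OF f] by (simp add: algebra_simps)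
  qed (use assms in \<open>auto simp: bounded_functional_def algebra_simps\<close>)
qed

lemma bounded_functional_eval:
  assumes x: "x \<in> I"
  shows "bounded_functional (\<lambda>f. f x * \<kappa>)"
proof -
  obtain K where K: "0 \<le> K" "\<And>f y. f \<in> HH \<Longrightarrow> y \<in> {x..x} \<Longrightarrow> (cmod (f y))\<^sup>2 \<le> K * H.sqn f"
    by (rule evaluation_bound[OF x x]) (rule that)
  show ?thesis
  proof (rule bounded_functionalI)
    show "0 \<le> K * (cmod \<kappa>)\<^sup>2" using K by simp
    fix f assume f: "f \<in> HH"
    have "(cmod (f x * \<kappa>))\<^sup>2 = (cmod (f x))\<^sup>2 * (cmod \<kappa>)\<^sup>2" by (simp add: norm_mult power_mult_distrib)
    also have "\<dots> \<le> K * H.sqn f * (cmod \<kappa>)\<^sup>2" using K(2)[OF f, of x] by (intro mult_right_mono) auto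
    finally show "(cmod (f x * \<kappa>))\<^sup>2 \<le> K * (cmod \<kappa>)\<^sup>2 * H.sqn f" by (simp add: mult_ac)
  qed (auto simp: algebra_simps)
qed

lemma bounded_functional_chi:
  assumes g: "g \<in> X.L2on" and A: "A \<in> sets borel" "A \<subseteq> I"
  shows "bounded_functional (\<lambda>f. LINT t:A|chi. g t * f t)"
proof (rule bounded_functionalI)
  fix f h assume f: "f \<in> HH" and h: "h \<in> HH"
  show "(LINT t:A|chi. g t * (f t + h t)) = (LINT t:A|chi. g t * f t) + (LINT t:A|chi. g t * h t)"
    unfolding distrib_left
    by (rule set_integral_add(2)) (intro X.L2on_mult_integrable g H1_L2 f h A)+
next
  fix f k
  have "(\<lambda>t. g t * (k * f t)) = (\<lambda>t. k * (g t * f t))" by (auto simp: mult_ac)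
  then show "(LINT t:A|chi. g t * (k * f t)) = k * (LINT t:A|chi. g t * f t)" by simp
next
  fix f assume f: "f \<in> HH"
  have "(cmod (LINT t:A|chi. g t * f t))\<^sup>2 \<le> (LINT t:I|chi. (cmod (g t))\<^sup>2) * (LINT t:I|chi. (cmod (f t))\<^sup>2)"
    by (rule X.L2on_Cauchy_Schwarz[OF g H1_L2[OF f] A])
  also have "\<dots> \<le> (LINT t:I|chi. (cmod (g t))\<^sup>2) * H.sqn f"
    by (intro mult_left_mono sqn_ge) (simp add: set_lebesgue_integral_def)
  finally show "(cmod (LINT t:A|chi. g t * f t))\<^sup>2 \<le> (LINT t:I|chi. (cmod (g t))\<^sup>2) * H.sqn f" .
qed (simp add: set_lebesgue_integral_def)

lemma bounded_functional_vs:
  assumes g: "g \<in> S.L2on" and A: "A \<in> sets borel" "A \<subseteq> I"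
  shows "bounded_functional (\<lambda>f. LINT t:A|vs. g t * Der f t)"
proof (rule bounded_functionalI)
  have L: "(\<lambda>t. g t * d t) \<in> L1loc a b vs" if "d \<in> S.L2on" for d
    by (intro S.set_integrable_J_L1loc S.L2on_mult_integrable g that) auto
  {
    fix f h assume f: "f \<in> HH" and h: "h \<in> HH"
    have ae: "AE t in vs. g t * Der (\<lambda>x. f x + h x) t = g t * (Der f t + Der h t)"
      using H1_add(2)[OF f h] by eventually_elim simp
    have "(LINT t:A|vs. g t * Der (\<lambda>x. f x + h x) t) = (LINT t:A|vs. g t * (Der f t + Der h t))"
      by (rule S.set_integral_cong_L1loc[OF L L ae A]) (intro H1_Der H1_add S.L2on_add f h)+
    also have "\<dots> = (LINT t:A|vs. g t * Der f t) + (LINT t:A|vs. g t * Der h t)"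
      unfolding distrib_left
      by (rule set_integral_add(2)) (intro S.L2on_mult_integrable g H1_Der f h A)+
    finally show "(LINT t:A|vs. g t * Der (\<lambda>x. f x + h x) t) = (LINT t:A|vs. g t * Der f t) + (LINT t:A|vs. g t * Der h t)" .
  next
    fix f k assume f: "f \<in> HH"
    have ae: "AE t in vs. g t * Der (\<lambda>x. k * f x) t = g t * (k * Der f t)"
      using H1_cmult(2)[OF f, of k] by eventually_elim simp
    have "(LINT t:A|vs. g t * Der (\<lambda>x. k * f x) t) = (LINT t:A|vs. g t * (k * Der f t))"
      by (rule S.set_integral_cong_L1loc[OF L L ae A]) (intro H1_Der H1_cmult S.L2on_cmult f)+
    also have "(\<lambda>t. g t * (k * Der f t)) = (\<lambda>t. k * (g t * Der f t))" by (auto simp: mult_ac)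
    finally show "(LINT t:A|vs. g t * Der (\<lambda>x. k * f x) t) = k * (LINT t:A|vs. g t * Der f t)" by simp
  }
next
  fix f assume f: "f \<in> HH"
  have "(cmod (LINT t:A|vs. g t * Der f t))\<^sup>2 \<le> (LINT t:I|vs. (cmod (g t))\<^sup>2) * (LINT t:I|vs. (cmod (Der f t))\<^sup>2)"
    by (rule S.L2on_Cauchy_Schwarz[OF g H1_Der[OF f] A])
  also have "\<dots> \<le> (LINT t:I|vs. (cmod (g t))\<^sup>2) * H.sqn f"
    by (intro mult_left_mono sqn_ge) (simp add: set_lebesgue_integral_def)
  finally show "(cmod (LINT t:A|vs. g t * Der f t))\<^sup>2 \<le> (LINT t:I|vs. (cmod (g t))\<^sup>2) * H.sqn f" .
qed (simp add: set_lebesgue_integral_def)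

text \<open>The norm contains no integral against \<open>mr\<close>. On a compact window the uniform
  bound for point evaluations replaces it, with the local mass of \<open>r\<close> as
  constant.\<close>

lemma bounded_functional_mr:
  assumes r: "r \<in> L1loc a b mr" and ab: "\<alpha> \<in> I" "\<beta> \<in> I"
  shows "bounded_functional (\<lambda>f. LINT t:{\<alpha>..<\<beta>}|mr. r t * f t)"
proof -
  obtain K where K: "0 \<le> K" "\<And>f x. f \<in> HH \<Longrightarrow> x \<in> {\<alpha>..\<beta>} \<Longrightarrow> (cmod (f x))\<^sup>2 \<le> K * H.sqn f"
    by (rule evaluation_bound[OF ab]) (rule that)
  define m where "m = (LINT t:{\<alpha>..<\<beta>}|mr. cmod (r t))"
  have ri: "set_integrable mr {\<alpha>..<\<beta>} (\<lambda>t. r t * f t)" if "f \<in> HH" for f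
    by (rule R.L1loc_Ico[OF R.L1loc_mult_locbdd[OF r AC_locbdd[OF H1_AC[OF that]]] ab])
  show ?thesis
  proof (rule bounded_functionalI)
    fix f h assume f: "f \<in> HH" and h: "h \<in> HH"
    show "(LINT t:{\<alpha>..<\<beta>}|mr. r t * (f t + h t)) = (LINT t:{\<alpha>..<\<beta>}|mr. r t * f t) + (LINT t:{\<alpha>..<\<beta>}|mr. r t * h t)"
      unfolding distrib_left by (rule set_integral_add(2)[OF ri[OF f] ri[OF h]])
  next
    fix f k
    have "(\<lambda>t. r t * (k * f t)) = (\<lambda>t. k * (r t * f t))" by (auto simp: mult_ac)
    then show "(LINT t:{\<alpha>..<\<beta>}|mr. r t * (k * f t)) = k * (LINT t:{\<alpha>..<\<beta>}|mr. r t * f t)" by simp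
  next
    show "0 \<le> m\<^sup>2 * K" using K by simp
    fix f assume f: "f \<in> HH"
    have s: "0 \<le> K * H.sqn f" using K(1) H.sqn_nonneg[OF f] by simp
    have bd: "cmod (f t) \<le> sqrt (K * H.sqn f)" if "t \<in> {\<alpha>..<\<beta>}" for t
      using K(2)[OF f, of t] that by (intro real_le_rsqrt) auto
    have "integrable mr (\<lambda>t. norm (indicator {\<alpha>..<\<beta>} t *\<^sub>R r t))"
      using R.L1loc_Ico[OF r ab] unfolding set_integrable_def by (rule integrable_norm)
    then have ri': "integrable mr (\<lambda>t. indicator {\<alpha>..<\<beta>} t *\<^sub>R cmod (r t))" by simp
    have "cmod (LINT t:{\<alpha>..<\<beta>}|mr. r t * f t) \<le> (\<integral>t. indicator {\<alpha>..<\<beta>} t *\<^sub>R cmod (r t) * sqrt (K * H.sqn f) \<partial>mr)"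
      unfolding set_lebesgue_integral_def
    proof (rule Bochner_Integration.integral_norm_bound_integral)
      show "integrable mr (\<lambda>t. indicator {\<alpha>..<\<beta>} t *\<^sub>R (r t * f t))" using ri[OF f] by (simp add: set_integrable_def)
      show "integrable mr (\<lambda>t. indicator {\<alpha>..<\<beta>} t *\<^sub>R cmod (r t) * sqrt (K * H.sqn f))"
        using ri' by (rule integrable_mult_left)
      show "norm (indicator {\<alpha>..<\<beta>} t *\<^sub>R (r t * f t)) \<le> indicator {\<alpha>..<\<beta>} t *\<^sub>R cmod (r t) * sqrt (K * H.sqn f)" for t
        using bd[of t] s by (auto simp: indicator_def norm_mult intro!: mult_left_mono)
    qed
    also have "\<dots> = m * sqrt (K * H.sqn f)"
      unfolding m_def set_lebesgue_integral_def by (rule integral_mult_left_zero)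
    finally have "(cmod (LINT t:{\<alpha>..<\<beta>}|mr. r t * f t))\<^sup>2 \<le> (m * sqrt (K * H.sqn f))\<^sup>2"
      by (intro power_mono) auto
    also have "\<dots> = m\<^sup>2 * K * H.sqn f" using s by (simp add: power_mult_distrib)
    finally show "(cmod (LINT t:{\<alpha>..<\<beta>}|mr. r t * f t))\<^sup>2 \<le> m\<^sup>2 * K * H.sqn f" .
  qed
qed

lemma bounded_functional_rho:
  assumes h: "test_fun h"
  shows "bounded_functional (rho h)"
proof -
  obtain \<alpha> \<beta> where H: "h \<in> HH" and ab: "\<alpha> \<in> I" "\<beta> \<in> I"
    and h0: "\<And>x. x \<le> \<alpha> \<or> \<beta> \<le> x \<Longrightarrow> h x = 0"
    using h by (auto simp: test_fun_def)
  define r where "r t = csr t * cnj (h t)" for t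
  have r: "r \<in> L1loc a b mr"
    unfolding r_def[abs_def]
    by (intro L1loc_sr R.L1loc_cnj R.locbdd_L1loc AC_locbdd H1_AC H)
  have "rho h v = (LINT t:{\<alpha>..<\<beta>}|mr. r t * v t)" for v
    unfolding rho_def set_lebesgue_integral_def
    by (rule Bochner_Integration.integral_cong)
      (use h0 Ioo_e_convex[OF ab] in \<open>auto simp: indicator_def r_def\<close>)
  then have "rho h = (\<lambda>v. LINT t:{\<alpha>..<\<beta>}|mr. r t * v t)" by auto
  with bounded_functional_mr[OF r ab] show ?thesis by simp
qed

section \<open>Linearity, closedness and the adjoint inside the maximal relation\<close>

lemma Tmax_subset: "(f, g) \<in> TM \<Longrightarrow> f \<in> HH" "(f, g) \<in> TM \<Longrightarrow> g \<in> HH"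
  by (auto simp: Tmax_iff)

lemma Tmax_qder: "(f, g) \<in> TM \<Longrightarrow> is_qd f g (qder f)"
  using Tloc_is_qd(3) by (simp add: Tmax_def)

lemma Tmax_weak: "(f, g) \<in> TM \<Longrightarrow> test_fun h \<Longrightarrow> ip f h = rho h g"
  using is_qd_weak_form[OF Tmax_qder] Tmax_subset by blast

text \<open>All measures are real, so in the weak form the conjugation can be moved onto the test
  function, which remains a test function. This matches the bilinear \<open>V\<close> with the
  sesquilinear inner product.\<close>

lemma Tmax_cnj:
  assumes "(f, g) \<in> TM"
  shows "((\<lambda>x. cnj (f x)), (\<lambda>x. cnj (g x))) \<in> TM"
proof (rule weak_form_imp_Tmax)
  note fg = Tmax_subset[OF assms]
  show "(\<lambda>x. cnj (f x)) \<in> HH" "(\<lambda>x. cnj (g x)) \<in> HH" by (rule H1_cnj[OF fg(1)], rule H1_cnj[OF fg(2)])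
  fix h assume h: "test_fun h"
  then have hH: "h \<in> HH" by (simp add: test_fun_def)
  have "ip (\<lambda>x. cnj (f x)) h = (LINT x:I|chi. cnj (f x) * cnj (h x)) + (LINT x:I|vs. cnj (Der f x) * cnj (Der h x))"
    by (rule ip_Der_cong[OF S.L2on_cnj[OF H1_Der[OF fg(1)]] H1_Der[OF hH] H1_cnj(1)[OF fg(1)] hH H1_cnj(2)[OF fg(1)] AE_I2[OF refl]])
  also have "\<dots> = ip (\<lambda>x. cnj (h x)) f"
    using ip_Der_cong[OF S.L2on_cnj[OF H1_Der[OF hH]] H1_Der[OF fg(1)] H1_cnj(1)[OF hH] fg(1) H1_cnj(2)[OF hH] AE_I2[OF refl]]
    by (simp add: mult.commute)
  also have "\<dots> = cnj (ip f (\<lambda>x. cnj (h x)))" by (rule H.ip_cnj[OF fg(1) H1_cnj(1)[OF hH]])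
  also have "\<dots> = cnj (rho (\<lambda>x. cnj (h x)) g)" using Tmax_weak[OF assms test_fun_cnj[OF h]] by simp
  also have "\<dots> = rho h (\<lambda>x. cnj (g x))"
    unfolding rho_cnj by (simp add: rho_def mult_ac)
  finally show "ip (\<lambda>x. cnj (f x)) h = rho h (\<lambda>x. cnj (g x))" .
qed

text \<open>For each fixed test function the weak form is a linear condition on the pair, so every
  closure property is checked there instead of on quasi-derivatives.\<close>

lemma Tmax_linear: "linear_relation HH TM"
  unfolding linear_relation_def
proof (intro conjI ballI allI)
  show "TM \<subseteq> HH \<times> HH" using Tmax_subset by auto
  have rho_add: "rho h (\<lambda>x. f x + g x) = rho h f + rho h g" if "test_fun h" "f \<in> HH" "g \<in> HH" for h f g
    using bounded_functional_rho[OF that(1)] that(2,3) by (simp add: bounded_functional_def)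
  have rho_scale: "rho h (\<lambda>x. k * f x) = k * rho h f" if "test_fun h" "f \<in> HH" for h f k
    using bounded_functional_rho[OF that(1)] that(2) by (simp add: bounded_functional_def)
  show "((\<lambda>_. 0), (\<lambda>_. 0)) \<in> TM"
  proof (rule weak_form_imp_Tmax)
    fix h assume h: "test_fun h"
    then have "h \<in> HH" by (simp add: test_fun_def)
    then show "ip (\<lambda>_. 0) h = rho h (\<lambda>_. 0)"
      using H.ip_scale[OF zero_H1, of h 0] rho_scale[OF h zero_H1, of 0] by simp
  qed (rule zero_H1)+
  fix p assume p: "p \<in> TM"
  obtain f g where [simp]: "p = (f, g)" by (cases p)
  note fg = Tmax_subset[OF p[simplified]]
  {
    fix k :: complex
    show "((\<lambda>x. k * fst p x), (\<lambda>x. k * snd p x)) \<in> TM"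
    proof (simp, rule weak_form_imp_Tmax)
      fix h assume h: "test_fun h"
      then have "h \<in> HH" by (simp add: test_fun_def)
      then show "ip (\<lambda>x. k * f x) h = rho h (\<lambda>x. k * g x)"
        using H.ip_scale[OF fg(1)] rho_scale[OF h fg(2)] Tmax_weak[OF p[simplified] h] by simp
    qed (use fg H.scale_mem in auto)
  }
  fix q assume q: "q \<in> TM"
  obtain f' g' where [simp]: "q = (f', g')" by (cases q)
  note fg' = Tmax_subset[OF q[simplified]]
  show "((\<lambda>x. fst p x + fst q x), (\<lambda>x. snd p x + snd q x)) \<in> TM"
  proof (simp, rule weak_form_imp_Tmax)
    fix h assume h: "test_fun h"
    then have "h \<in> HH" by (simp add: test_fun_def)
    then show "ip (\<lambda>x. f x + f' x) h = rho h (\<lambda>x. g x + g' x)"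
      using H.ip_add[OF fg(1) fg'(1)] rho_add[OF h fg(2) fg'(2)] Tmax_weak[OF p[simplified] h]
        Tmax_weak[OF q[simplified] h] by simp
  qed (use fg fg' H.add_mem in auto)
qed

lemma Tmax_closed: "closed_relation (H1_norm a b c vs chi) HH TM"
  unfolding closed_relation_def
proof (intro allI impI, elim conjE)
  fix F G u v
  assume FG: "\<forall>n. (F n, G n) \<in> TM" and u: "u \<in> HH" and v: "v \<in> HH"
    and Fu: "(\<lambda>n. H1_norm a b c vs chi (\<lambda>x. F n x - u x)) \<longlonglongrightarrow> 0"
    and Gv: "(\<lambda>n. H1_norm a b c vs chi (\<lambda>x. G n x - v x)) \<longlonglongrightarrow> 0"
  have F: "F n \<in> HH" and G: "G n \<in> HH" for n using FG Tmax_subset by blast+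
  have sq: "(H1_norm a b c vs chi f)\<^sup>2 = H.sqn f" if "f \<in> HH" for f
    using H.sqn_nonneg[OF that] by (simp add: H1_norm_def H.sqn_def)
  have Fu2: "(\<lambda>n. H.sqn (\<lambda>x. F n x - u x)) \<longlonglongrightarrow> 0"
    using tendsto_power[OF Fu, of 2] sq[OF H.diff_mem[OF F u]] by simp
  have Gv2: "(\<lambda>n. H.sqn (\<lambda>x. G n x - v x)) \<longlonglongrightarrow> 0"
    using tendsto_power[OF Gv, of 2] sq[OF H.diff_mem[OF G v]] by simp
  show "(u, v) \<in> TM"
  proof (rule weak_form_imp_Tmax[OF u v])
    fix h assume h: "test_fun h"
    then have hH: "h \<in> HH" by (simp add: test_fun_def)
    note bf = bounded_functional_rho[OF h]
    obtain K where K: "0 \<le> K" "\<And>f. f \<in> HH \<Longrightarrow> (cmod (rho h f))\<^sup>2 \<le> K * H.sqn f"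
      using bf by (auto simp: bounded_functional_def)
    have rd: "rho h (\<lambda>x. G n x - v x) = rho h (G n) - rho h v" for n
    proof -
      have "rho h (\<lambda>x. G n x + (-1) * v x) = rho h (G n) + rho h (\<lambda>x. (-1) * v x)"
        using bf[unfolded bounded_functional_def, THEN conjunct1, rule_format, OF G H.scale_mem[OF v]] .
      moreover have "rho h (\<lambda>x. (-1) * v x) = (-1) * rho h v"
        using bf v unfolding bounded_functional_def by blast
      ultimately show ?thesis by simp
    qed
    have "(\<lambda>n. rho h (G n) - rho h v) \<longlonglongrightarrow> 0"
      by (rule tendsto_zero_square_bound[OF Gv2, of _ K]) (use K(2)[OF H.diff_mem[OF G v]] in \<open>simp add: rd\<close>)
    moreover have "(\<lambda>n. ip (F n) h - ip u h) \<longlonglongrightarrow> 0"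
      by (rule tendsto_zero_square_bound[OF Fu2, of _ "H.sqn h"])
        (use H.Cauchy_Schwarz[OF H.diff_mem[OF F u] hH] H.ip_diff[OF F u hH] in \<open>simp add: mult.commute\<close>)
    ultimately have "(\<lambda>n. (rho h (G n) - rho h v) - (ip (F n) h - ip u h)) \<longlonglongrightarrow> 0 - 0" by (rule tendsto_diff)
    then have "(\<lambda>n. ip u h - rho h v) \<longlonglongrightarrow> 0"
      using Tmax_weak[OF FG[rule_format] h] by simp
    then show "ip u h = rho h v" by (simp add: LIMSEQ_const_iff)
  qed
qed

text \<open>Hermitian symmetry of \<open>rho\<close> turns the defining property of the Riesz vector
  \<open>k\<close> into the weak form for \<open>(k, h)\<close>.\<close>

lemma test_fun_in_range:
  assumes h: "test_fun h"
  obtains k where "(k, h) \<in> TM" "\<And>v. v \<in> HH \<Longrightarrow> ip v k = rho h v"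
proof -
  have hH: "h \<in> HH" using h by (simp add: test_fun_def)
  obtain k where k: "k \<in> HH" "\<And>v. v \<in> HH \<Longrightarrow> rho h v = ip v k"
    by (rule bounded_functional_riesz[OF bounded_functional_rho[OF h]]) (rule that)
  have "(k, h) \<in> TM"
  proof (rule weak_form_imp_Tmax[OF k(1) hH])
    fix e assume "test_fun e"
    then have eH: "e \<in> HH" by (simp add: test_fun_def)
    have "ip k e = cnj (rho h e)" using H.ip_cnj[OF eH k(1)] k(2)[OF eH] by simp
    also have "\<dots> = rho e h" by (rule rho_cnj)
    finally show "ip k e = rho e h" .
  qed
  then show ?thesis using that k by simp
qed

lemma adjoint_subset_Tmax:
  assumes u: "u \<in> HH" and v: "v \<in> HH" and adj: "\<And>f g. (f, g) \<in> TM \<Longrightarrow> ip v f = ip u g"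
  shows "(u, v) \<in> TM"
proof (rule weak_form_imp_Tmax[OF u v])
  fix h assume h: "test_fun h"
  obtain k where k: "(k, h) \<in> TM" "\<And>v. v \<in> HH \<Longrightarrow> ip v k = rho h v"
    by (rule test_fun_in_range[OF h]) (rule that)
  show "ip u h = rho h v" using adj[OF k(1)] k(2)[OF v] by simp
qed

end

section \<open>Boundary values and the adjoint\<close>

context left_definite
begin

abbreviation "I_right \<equiv> {t\<in>I. c \<le> t}"
abbreviation "I_left \<equiv> {t\<in>I. t < c}"

lemma H1_products_integrable:
  assumes "f \<in> HH" "g \<in> HH"
  shows "set_integrable chi I (\<lambda>t. f t * g t)" "set_integrable vs I (\<lambda>t. Der f t * Der g t)"
  by (rule X.L2on_mult_integrable[OF H1_L2 H1_L2], use assms in auto)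
    (rule S.L2on_mult_integrable[OF H1_Der H1_Der], use assms in auto)

text \<open>In the difference of the two Green identities the \<open>mr\<close>-integrals cancel.
  The remaining integrands are products of square-integrable functions, so limits exist at both ends
  even where the \<open>mr\<close>-integrals alone need not converge.\<close>

lemma Lagrange_limits:
  assumes p: "(u, v) \<in> TM" and q: "(f, g) \<in> TM"
  obtains La Lb where "(V (u, v) (f, g) \<longlongrightarrow> La) (at_lend a)" "(V (u, v) (f, g) \<longlongrightarrow> Lb) (at_rend b)"
    "Lb - La = ip v (\<lambda>x. cnj (f x)) - ip u (\<lambda>x. cnj (g x))"
proof -
  note pH = Tmax_subset[OF p] and qH = Tmax_subset[OF q]
  define B where "B x = v x * qder f x - qder u x * g x" for x
  have V_eq: "V (u, v) (f, g) = B" by (auto simp: Vw_def B_def)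
  define W where "W x = B c + mint chi c x (\<lambda>t. f t * v t) + mint vs c x (\<lambda>t. Der f t * Der v t)
     - mint chi c x (\<lambda>t. u t * g t) - mint vs c x (\<lambda>t. Der u t * Der g t)" for x
  have VW: "B x = W x" if x: "x \<in> I" for x
  proof -
    \<comment> \<open>The \<open>mr\<close>-terms are symmetric in the two second components, which
      causes the cancellation.\<close>
    have "mint mr c x (\<lambda>t. csr t * g t * v t) = mint mr c x (\<lambda>t. csr t * v t * g t)"
      by (simp add: mult_ac)
    then show ?thesis
      using is_qd_parts[OF Tmax_qder[OF q] qH pH(2) x] is_qd_parts[OF Tmax_qder[OF p] pH qH(2) x]
      unfolding W_def B_def by (simp add: mult.commute[of "v _"])
  qed
  note i = H1_products_integrable[OF qH(1) pH(2)] H1_products_integrable[OF pH(1) qH(2)]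
  have "(W \<longlongrightarrow> B c + (LINT t:I_right|chi. f t * v t) + (LINT t:I_right|vs. Der f t * Der v t)
     - (LINT t:I_right|chi. u t * g t) - (LINT t:I_right|vs. Der u t * Der g t)) (at_rend b)" (is "(W \<longlongrightarrow> ?Lb) _")
    unfolding W_def[abs_def]
    by (intro tendsto_intros X.mint_tendsto_rend S.mint_tendsto_rend i)
  then have b: "(B \<longlongrightarrow> ?Lb) (at_rend b)"
    by (rule Lim_transform_eventually) (use eventually_at_rend[OF c] VW in \<open>auto elim!: eventually_mono\<close>)
  have "(W \<longlongrightarrow> B c + (- (LINT t:I_left|chi. f t * v t)) + (- (LINT t:I_left|vs. Der f t * Der v t))
     - (- (LINT t:I_left|chi. u t * g t)) - (- (LINT t:I_left|vs. Der u t * Der g t))) (at_lend a)" (is "(W \<longlongrightarrow> ?La) _")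
    unfolding W_def[abs_def]
    by (intro tendsto_add tendsto_diff tendsto_const X.mint_tendsto_lend S.mint_tendsto_lend i)
  then have a: "(B \<longlongrightarrow> ?La) (at_lend a)"
    by (rule Lim_transform_eventually) (use eventually_at_lend[OF c] VW in \<open>auto elim!: eventually_mono\<close>)
  have 1: "ip v (\<lambda>x. cnj (f x)) = (LINT t:I|chi. f t * v t) + (LINT t:I|vs. Der f t * Der v t)"
    using ip_Der_cong[OF H1_Der[OF pH(2)] S.L2on_cnj[OF H1_Der[OF qH(1)]] pH(2) H1_cnj(1)[OF qH(1)] AE_I2[OF refl] H1_cnj(2)[OF qH(1)]]
    by (simp add: mult.commute)
  have 2: "ip u (\<lambda>x. cnj (g x)) = (LINT t:I|chi. u t * g t) + (LINT t:I|vs. Der u t * Der g t)"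
    using ip_Der_cong[OF H1_Der[OF pH(1)] S.L2on_cnj[OF H1_Der[OF qH(2)]] pH(1) H1_cnj(1)[OF qH(2)] AE_I2[OF refl] H1_cnj(2)[OF qH(2)]]
    by simp
  have "?Lb - ?La = ip v (\<lambda>x. cnj (f x)) - ip u (\<lambda>x. cnj (g x))"
    unfolding 1 2 X.integral_split_at_base[OF i(1), symmetric] S.integral_split_at_base[OF i(2), symmetric]
      X.integral_split_at_base[OF i(3), symmetric] S.integral_split_at_base[OF i(4), symmetric]
    by simp
  then show ?thesis using that a b unfolding V_eq by blast
qed

text \<open>\<open>k\<close> only has to lie in H1 and satisfies no differential equation, so this
  cut-off exists for every \<open>g\<close>; it will be applied to a second component.\<close>

lemma left_cutoff:
  assumes g: "g \<in> HH"
  obtains \<alpha> k where "\<alpha> \<in> I" "\<alpha> < c" "k \<in> HH" "\<And>x. x \<le> \<alpha> \<Longrightarrow> k x = 0" "\<And>x. c \<le> x \<Longrightarrow> k x = g x"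
proof -
  obtain \<alpha> where \<alpha>: "\<alpha> \<in> I" "\<alpha> < c" using Ioo_e_less[OF c] by blast
  define m where "m = measure vs {\<alpha>..<c}"
  have m: "m > 0" "emeasure vs {\<alpha>..<c} < \<infinity>" unfolding m_def using vs_Ico_positive[OF \<alpha>(1) c \<alpha>(2)] by auto
  \<comment> \<open>The constant density \<open>g c / m\<close> on a window of mass \<open>m\<close>
    lifts the primitive from 0 at \<open>\<alpha>\<close> to \<open>g c\<close> at \<open>c\<close>;
    from there on it follows \<open>g\<close>.\<close>
  define d where "d t = indicator {\<alpha>..<c} t *\<^sub>R (g c / m) + indicator {c..} t *\<^sub>R Der g t" for t
  have d: "d \<in> S.L2on"
    unfolding d_def[abs_def]
    by (intro S.L2on_add S.locbdd_L2on locbdd_const \<alpha> c S.L2on_indicator H1_Der g) auto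
  define k where "k x = (if x \<in> I then g c + mint vs c x d else 0)" for x
  have k1: "k x = k c + mint vs c x d" if "x \<in> I" for x using that c by (simp add: k_def)
  have k2: "k x = 0" if "x \<notin> I" for x using that by (simp add: k_def)
  have right: "k x = g x" if x: "c \<le> x" for x
  proof (cases "x \<in> I")
    case True
    have "(LINT t:{c..<x}|vs. d t) = (LINT t:{c..<x}|vs. Der g t)"
      by (rule set_lebesgue_integral_cong) (auto simp: S.sets_M d_def)
    then have "mint vs c x d = mint vs c x (Der g)"
      using S.mint_diff_Ico[OF S.L2on_L1loc[OF d] c True x] S.mint_diff_Ico[OF S.L2on_L1loc[OF H1_Der[OF g]] c True x]
      by simp
    then show ?thesis using True Der(2)[OF H1_AC[OF g] True] by (simp add: k_def)
  next
    case False
    then show ?thesis using k2 AC_outside[OF H1_AC[OF g]] by simp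
  qed
  have left: "k x = 0" if x: "x \<le> \<alpha>" for x
  proof (cases "x \<in> I")
    case True
    have "mint vs c x d = - (LINT t:{x..<c}|vs. d t)"
      using x \<alpha>(2) by (simp add: mint_def)
    also have "(LINT t:{x..<c}|vs. d t) = (\<integral>t. indicator {\<alpha>..<c} t *\<^sub>R (g c / m) \<partial>vs)"
      unfolding set_lebesgue_integral_def
      by (rule Bochner_Integration.integral_cong) (use x in \<open>auto simp: d_def indicator_def\<close>)
    also have "\<dots> = g c"
      using m by (simp add: m_def[symmetric] scaleR_conv_of_real)
    finally show ?thesis using True by (simp add: k_def)
  qed (rule k2)
  have "(\<lambda>x. g c + mint vs c x d) \<in> locbdd a b"
    by (intro locbdd_add S.mint_locbdd locbdd_const S.L2on_L1loc d)
  then have "k \<in> locbdd a b" by (subst locbdd_cong[where G="\<lambda>x. g c + mint vs c x d"]) (auto simp: k_def)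
  then have "(\<lambda>t. indicator {\<alpha>..<c} t *\<^sub>R k t + indicator {c..} t *\<^sub>R g t) \<in> X.L2on"
    by (intro X.L2on_add X.locbdd_L2on \<alpha> c X.L2on_indicator H1_L2 g) auto
  also have "(\<lambda>t. indicator {\<alpha>..<c} t *\<^sub>R k t + indicator {c..} t *\<^sub>R g t) = k"
    using left right by (auto simp: indicator_def fun_eq_iff)
  finally have kL: "k \<in> X.L2on" .
  have "k \<in> HH" by (rule H1I(1)[OF d k1 k2 kL])
  then show ?thesis using that \<alpha> left right by blast
qed

text \<open>With \<open>k\<close> the cut-off of \<open>g\<tau>\<close>, the right boundary value \<open>V((u,v),(g,g\<tau>))(b)\<close> equals
  \<open>\<phi> v - ip u (cnj k)\<close> for a bounded functional \<open>\<phi>\<close>. Its Riesz representative \<open>w\<close> satisfies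
  \<open>(w, cnj k) \<in> Tmax\<close>, so the boundary value vanishes on the adjoint.\<close>

lemma right_boundary_value:
  assumes p: "(u, v) \<in> TM" and adj: "\<And>f g. (f, g) \<in> TM \<Longrightarrow> ip v f = ip u g"
    and q: "(g, h) \<in> TM"
  shows "(V (u, v) (g, h) \<longlongrightarrow> 0) (at_rend b)"
proof -
  note pH = Tmax_subset[OF p] and qH = Tmax_subset[OF q]
  define g1 where "g1 = qder g"
  define u1 where "u1 = qder u"
  have qg: "is_qd g h g1" and qu: "is_qd u v u1"
    unfolding g1_def u1_def using Tmax_qder[OF q] Tmax_qder[OF p] .
  obtain \<alpha> k where \<alpha>: "\<alpha> \<in> I" "\<alpha> < c" and k: "k \<in> HH"
    and kl: "\<And>x. x \<le> \<alpha> \<Longrightarrow> k x = 0" and kr: "\<And>x. c \<le> x \<Longrightarrow> k x = h x"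
    by (rule left_cutoff[OF qH(2)]) (rule that)
  have I_right: "I_right \<in> sets borel" "I_right \<subseteq> I" by auto
  have kL: "(\<lambda>t. csr t * k t) \<in> L1loc a b mr"
    by (intro L1loc_sr R.locbdd_L1loc AC_locbdd H1_AC k)
  \<comment> \<open>The first three terms are the Green identity of \<open>(g, h)\<close> on
    \<open>[c, b)\<close>. On a test function they give the \<rho>-integral of \<open>h\<close>,
    equivalently of \<open>k\<close>, over the right half; the last term adds the left half of the
    integral of \<open>k\<close>.\<close>
  define \<phi> where "\<phi> x = (x c * g1 c + (LINT t:I_right|chi. g t * x t)) + ((LINT t:I_right|vs. Der g t * Der x t)
      + (LINT t:{\<alpha>..<c}|mr. csr t * k t * x t))" for x
  have "bounded_functional \<phi>"
    unfolding \<phi>_def[abs_def]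
    by (intro bounded_functional_add bounded_functional_eval[OF c] bounded_functional_chi[OF H1_L2[OF qH(1)] I_right]
        bounded_functional_vs[OF H1_Der[OF qH(1)] I_right] bounded_functional_mr[OF kL \<alpha>(1) c])
  then obtain w where w: "w \<in> HH" "\<And>x. x \<in> HH \<Longrightarrow> \<phi> x = ip x w"
    by (rule bounded_functional_riesz) (rule that)
  have "(w, \<lambda>x. cnj (k x)) \<in> TM"
  proof (rule weak_form_imp_Tmax[OF w(1) H1_cnj(1)[OF k]])
    fix e assume e: "test_fun e"
    obtain \<beta> where eH: "e \<in> HH" and \<beta>: "\<beta> \<in> I" and e0: "\<And>x. \<beta> \<le> x \<Longrightarrow> e x = 0"
      using e by (auto simp: test_fun_def)
    note gL = H1_L1loc(1)[OF qH(1)] and hL = H1_L1loc(2)[OF qH(2)]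
    have int_h: "set_integrable mr I (\<lambda>t. csr t * h t * e t)"
      by (rule quasi_derivative_test(2)[OF gL L1loc_sr[OF hL] _ e, of g1]) (use qg in \<open>simp add: is_qd_def\<close>)
    \<comment> \<open>Only integrability is extracted: the primitive used here has
      \<open>chi\<close>-density zero and \<open>mr\<close>-density that of
      \<open>k\<close>.\<close>
    have int_k: "set_integrable mr I (\<lambda>t. csr t * k t * e t)"
    proof -
      have zL: "(\<lambda>_. 0) \<in> L1loc a b chi" by (intro X.locbdd_L1loc locbdd_const)
      show ?thesis
        by (rule quasi_derivative_test(2)[OF zL kL _ e, of "\<lambda>x. mint chi c x (\<lambda>_. 0) - mint mr c x (\<lambda>t. csr t * k t)"]) simp
    qed
    note i = H1_products_integrable[OF qH(1) eH]
    \<comment> \<open>By the Green identity \<open>E\<close> equals \<open>g1 * e\<close>, hence is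
      zero near \<open>b\<close>. Each term converges, so the limit of the sum is zero.\<close>
    define E where "E x = g1 c * e c + mint chi c x (\<lambda>t. g t * e t) - mint mr c x (\<lambda>t. csr t * h t * e t)
        + mint vs c x (\<lambda>t. Der g t * Der e t)" for x
    have "(E \<longlongrightarrow> g1 c * e c + (LINT t:I_right|chi. g t * e t) - (LINT t:I_right|mr. csr t * h t * e t)
        + (LINT t:I_right|vs. Der g t * Der e t)) (at_rend b)" (is "(_ \<longlongrightarrow> ?L) _")
      unfolding E_def[abs_def]
      by (intro tendsto_intros X.mint_tendsto_rend R.mint_tendsto_rend S.mint_tendsto_rend i int_h)
    moreover have "eventually (\<lambda>x. E x = 0) (at_rend b)"
      using eventually_at_rend[OF \<beta>]
    proof eventually_elim
      case (elim x)
      then show ?case using is_qd_parts[OF qg qH eH, of x] e0[of x] by (simp add: E_def)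
    qed
    ultimately have "((\<lambda>x. 0) \<longlongrightarrow> ?L) (at_rend b)"
      by (rule Lim_transform_eventually)
    from tendsto_unique[OF at_rend_neq_bot this tendsto_const]
    have "g1 c * e c + (LINT t:I_right|chi. g t * e t) + (LINT t:I_right|vs. Der g t * Der e t)
        = (LINT t:I_right|mr. csr t * h t * e t)" by (simp add: algebra_simps)
    also have "\<dots> = (LINT t:I_right|mr. csr t * k t * e t)"
      by (rule set_lebesgue_integral_cong) (auto simp: R.sets_M kr)
    finally have "\<phi> e = (LINT t:I_right|mr. csr t * k t * e t)
        + (LINT t:{\<alpha>..<c}|mr. csr t * k t * e t)"
      by (simp add: \<phi>_def algebra_simps)
    also have "(LINT t:{\<alpha>..<c}|mr. csr t * k t * e t) = (LINT t:I_left|mr. csr t * k t * e t)"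
      unfolding set_lebesgue_integral_def
      by (rule Bochner_Integration.integral_cong)
        (use kl Ioo_e_convex[OF \<alpha>(1) c] in \<open>auto simp: indicator_def\<close>)
    also have "(LINT t:I_right|mr. csr t * k t * e t) + (LINT t:I_left|mr. csr t * k t * e t)
        = (LINT t:I|mr. csr t * k t * e t)"
      using R.integral_split_at_base[OF int_k] by (simp add: add.commute)
    also have "\<dots> = rho (\<lambda>x. cnj (k x)) e"
      by (simp add: rho_def mult_ac)
    finally have "\<phi> e = rho (\<lambda>x. cnj (k x)) e" .
    then have "ip w e = cnj (rho (\<lambda>x. cnj (k x)) e)" using H.ip_cnj[OF eH w(1)] w(2)[OF eH] by simp
    then show "ip w e = rho e (\<lambda>x. cnj (k x))" by (simp only: rho_cnj)
  qed
  \<comment> \<open>The one place in this proof where the adjoint condition enters, for the pair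
    just constructed.\<close>
  from adj[OF this] w(2)[OF pH(2)] have \<phi>v: "\<phi> v = ip u (\<lambda>x. cnj (k x))" by simp
  have ipk: "ip u (\<lambda>x. cnj (k x)) = (LINT t:I|chi. u t * k t) + (LINT t:I|vs. Der u t * Der k t)"
    using ip_Der_cong[OF H1_Der[OF pH(1)] S.L2on_cnj[OF H1_Der[OF k]] pH(1) H1_cnj(1)[OF k] AE_I2[OF refl] H1_cnj(2)[OF k]]
    by simp
  note iu = H1_products_integrable[OF pH(1) k] and ig = H1_products_integrable[OF qH(1) pH(2)]
  let ?m = "LINT t:{\<alpha>..<c}|mr. csr t * v t * k t"
  \<comment> \<open>To the left of \<open>\<alpha>\<close> the cut-off vanishes, so there the
    \<open>mr\<close>-integral is frozen at \<open>- ?m\<close> and \<open>E\<close>, which equals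
    \<open>u1 * k\<close>, is zero. Its limit at \<open>a\<close> evaluates the left half of the
    form.\<close>
  define E where "E x = u1 c * k c + mint chi c x (\<lambda>t. u t * k t) + ?m + mint vs c x (\<lambda>t. Der u t * Der k t)" for x
  have "(E \<longlongrightarrow> u1 c * k c + (- (LINT t:I_left|chi. u t * k t)) + ?m
      + (- (LINT t:I_left|vs. Der u t * Der k t))) (at_lend a)" (is "(_ \<longlongrightarrow> ?L) _")
    unfolding E_def[abs_def]
    by (intro tendsto_add tendsto_const X.mint_tendsto_lend S.mint_tendsto_lend iu)
  moreover have "eventually (\<lambda>x. E x = 0) (at_lend a)"
    using eventually_at_lend[OF \<alpha>(1)]
  proof eventually_elim
    case (elim x)
    then have x: "x \<in> I" by simp
    have "mint mr c x (\<lambda>t. csr t * v t * k t) = - (LINT t:{x..<c}|mr. csr t * v t * k t)"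
      using elim \<alpha>(2) by (simp add: mint_def)
    also have "(LINT t:{x..<c}|mr. csr t * v t * k t) = ?m"
      unfolding set_lebesgue_integral_def
      by (rule Bochner_Integration.integral_cong) (use kl elim in \<open>auto simp: indicator_def\<close>)
    finally show ?case using is_qd_parts[OF qu pH k x] kl[of x] elim by (simp add: E_def)
  qed
  ultimately have "((\<lambda>x. 0) \<longlongrightarrow> ?L) (at_lend a)"
    by (rule Lim_transform_eventually)
  from tendsto_unique[OF at_lend_neq_bot this tendsto_const]
  have u1k: "u1 c * k c + ?m = (LINT t:I_left|chi. u t * k t) + (LINT t:I_left|vs. Der u t * Der k t)"
    by (simp add: algebra_simps)
  define B where "B x = v x * g1 x - u1 x * h x" for x
  have V_eq: "V (u, v) (g, h) = B" by (auto simp: Vw_def B_def g1_def u1_def)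
  \<comment> \<open>The difference of the Green identities of \<open>(g, h)\<close> against
    \<open>v\<close> and of \<open>(u, v)\<close> against \<open>k\<close>. Beyond \<open>c\<close>
    the functions \<open>k\<close> and \<open>h\<close> coincide, so the \<open>mr\<close>-integrals
    cancel and the difference equals \<open>B\<close>.\<close>
  define W where "W x = g1 c * v c + mint chi c x (\<lambda>t. g t * v t) + mint vs c x (\<lambda>t. Der g t * Der v t)
      - (u1 c * k c + mint chi c x (\<lambda>t. u t * k t) + mint vs c x (\<lambda>t. Der u t * Der k t))" for x
  have VW: "B x = W x" if x: "x \<in> I" "c < x" for x
  proof -
    have "mint mr c x (\<lambda>t. csr t * h t * v t) = mint mr c x (\<lambda>t. csr t * v t * k t)"
      unfolding mint_def using x(2)
      by (simp, intro set_lebesgue_integral_cong) (auto simp: R.sets_M kr)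
    then show ?thesis
      using is_qd_parts[OF qg qH pH(2) x(1)] is_qd_parts[OF qu pH k x(1)] kr[of x] x(2)
      unfolding B_def W_def by (simp add: mult.commute[of "v _"])
  qed
  have "(W \<longlongrightarrow> g1 c * v c + (LINT t:I_right|chi. g t * v t) + (LINT t:I_right|vs. Der g t * Der v t)
      - (u1 c * k c + (LINT t:I_right|chi. u t * k t) + (LINT t:I_right|vs. Der u t * Der k t))) (at_rend b)"
    (is "(_ \<longlongrightarrow> ?L) _")
    unfolding W_def[abs_def]
    by (intro tendsto_intros X.mint_tendsto_rend S.mint_tendsto_rend iu ig)
  \<comment> \<open>The identity for \<open>\<phi> v\<close> covers the whole interval; subtracting
    the left-half identity \<open>u1k\<close> removes \<open>?m\<close> and the left integrals and
    leaves exactly the right half.\<close>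
  also have "?L = 0"
  proof -
    have "(LINT t:{\<alpha>..<c}|mr. csr t * k t * v t) = ?m" by (simp add: mult_ac)
    then have "g1 c * v c + (LINT t:I_right|chi. g t * v t) + (LINT t:I_right|vs. Der g t * Der v t) + ?m = \<phi> v"
      by (simp add: \<phi>_def algebra_simps)
    also have "\<dots> = (LINT t:I_left|chi. u t * k t) + (LINT t:I_right|chi. u t * k t) +
        ((LINT t:I_left|vs. Der u t * Der k t) + (LINT t:I_right|vs. Der u t * Der k t))"
      unfolding \<phi>v ipk X.integral_split_at_base[OF iu(1)] S.integral_split_at_base[OF iu(2)] ..
    finally show ?thesis using u1k by algebra
  qed
  finally have "(B \<longlongrightarrow> 0) (at_rend b)"
    by (rule Lim_transform_eventually) (use eventually_at_rend[OF c] VW in \<open>auto elim!: eventually_mono\<close>)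
  then show ?thesis by (simp only: V_eq)
qed

text \<open>On the adjoint the right boundary value vanishes by the Riesz argument and the Lagrange
  identity equates the left value with it. Conversely, two vanishing boundary values reduce the
  Lagrange identity to the adjoint condition.\<close>

lemma Tmax_adjoint:
  "adjoint_rel ip HH TM = {p \<in> TM. \<forall>q \<in> TM.
     (V p q \<longlongrightarrow> 0) (at_lend a) \<and> (V p q \<longlongrightarrow> 0) (at_rend b)}" (is "_ = ?R")
proof (intro set_eqI iffI)
  fix p assume "p \<in> adjoint_rel ip HH TM"
  then obtain u v where p: "p = (u, v)" and u: "u \<in> HH" and v: "v \<in> HH"
    and "\<forall>(f, g)\<in>TM. ip v f = ip u g"
    by (auto simp: adjoint_rel_def)
  then have adj: "\<And>f g. (f, g) \<in> TM \<Longrightarrow> ip v f = ip u g" by blast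
  have uv: "(u, v) \<in> TM" by (rule adjoint_subset_Tmax[OF u v adj])
  have "(V p q \<longlongrightarrow> 0) (at_lend a) \<and> (V p q \<longlongrightarrow> 0) (at_rend b)"
    if "q \<in> TM" for q
  proof -
    obtain f g where q: "q = (f, g)" by (cases q)
    have fg: "(f, g) \<in> TM" using that q by simp
    obtain La Lb where L: "(V (u, v) (f, g) \<longlongrightarrow> La) (at_lend a)"
      "(V (u, v) (f, g) \<longlongrightarrow> Lb) (at_rend b)"
      "Lb - La = ip v (\<lambda>x. cnj (f x)) - ip u (\<lambda>x. cnj (g x))"
      by (rule Lagrange_limits[OF uv fg]) (rule that)
    have r: "(V (u, v) (f, g) \<longlongrightarrow> 0) (at_rend b)"
      by (rule right_boundary_value[OF uv adj fg])
    have "Lb = 0" by (rule tendsto_unique[OF at_rend_neq_bot L(2) r])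
    \<comment> \<open>The adjoint condition is taken at the conjugated pair because the Lagrange
      identity conjugates the second argument.\<close>
    moreover have "Lb = La" using L(3) adj[OF Tmax_cnj[OF fg]] by simp
    ultimately show ?thesis using L(1) r by (simp add: p q)
  qed
  with uv show "p \<in> ?R"
    by (simp add: p)
next
  fix p assume "p \<in> ?R"
  then obtain u v where p: "p = (u, v)" and uv: "(u, v) \<in> TM" and V0: "\<And>q. q \<in> TM \<Longrightarrow>
     (V (u, v) q \<longlongrightarrow> 0) (at_lend a)" "\<And>q. q \<in> TM \<Longrightarrow> (V (u, v) q \<longlongrightarrow> 0) (at_rend b)"
    by (cases p) auto
  have "ip v f = ip u g" if fg: "(f, g) \<in> TM" for f g
  proof -
    \<comment> \<open>Conjugating beforehand makes the two conjugations in the Lagrange identity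
      cancel, leaving the inner products with \<open>f\<close> and \<open>g\<close>.\<close>
    note q = Tmax_cnj[OF fg]
    let ?V = "V (u, v) ((\<lambda>x. cnj (f x)), (\<lambda>x. cnj (g x)))"
    obtain La Lb where L: "(?V \<longlongrightarrow> La) (at_lend a)" "(?V \<longlongrightarrow> Lb) (at_rend b)"
      "Lb - La = ip v (\<lambda>x. cnj (cnj (f x))) - ip u (\<lambda>x. cnj (cnj (g x)))"
      by (rule Lagrange_limits[OF uv q]) (rule that)
    have "La = 0" by (rule tendsto_unique[OF at_lend_neq_bot L(1) V0(1)[OF q]])
    moreover have "Lb = 0" by (rule tendsto_unique[OF at_rend_neq_bot L(2) V0(2)[OF q]])
    ultimately show ?thesis using L(3) by simp
  qed
  then show "p \<in> adjoint_rel ip HH TM"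
    using Tmax_subset[OF uv] by (auto simp: adjoint_rel_def p)
qed

end

theorem theorem3p1:
  fixes a b :: ereal and c :: real
    and vs chi mr :: "real measure" and sr :: "real \<Rightarrow> real"
  assumes ab: "a < b" and c: "c \<in> Ioo_e a b"
    and sets: "sets vs = sets borel" "sets chi = sets borel" "sets mr = sets borel"
    and on_ab: "emeasure vs (- Ioo_e a b) = 0" "emeasure chi (- Ioo_e a b) = 0"
               "emeasure mr (- Ioo_e a b) = 0"
    and locfin: "\<And>x y. a < ereal x \<Longrightarrow> ereal y < b \<Longrightarrow>
                   emeasure vs {x..y} < \<infinity> \<and> emeasure chi {x..y} < \<infinity> \<and> emeasure mr {x..y} < \<infinity>"
    and sign: "sr \<in> borel_measurable borel" "\<And>x. sr x = 1 \<or> sr x = -1"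
    and supp: "\<And>x y. a < ereal x \<Longrightarrow> x < y \<Longrightarrow> ereal y < b \<Longrightarrow> emeasure vs {x<..<y} > 0"
    and chi_nz: "emeasure chi (Ioo_e a b) \<noteq> 0"
    and atoms: "\<And>x. x \<in> Ioo_e a b \<Longrightarrow> emeasure vs {x} = 0 \<or> emeasure chi {x} = 0"
               "\<And>x. x \<in> Ioo_e a b \<Longrightarrow> emeasure vs {x} = 0 \<or> emeasure mr {x} = 0"
  shows "linear_relation (H1 a b c vs chi) (Tmax a b c vs chi mr sr) \<and>
         closed_relation (H1_norm a b c vs chi) (H1 a b c vs chi) (Tmax a b c vs chi mr sr) \<and>
         adjoint_rel (H1_inner a b c vs chi) (H1 a b c vs chi) (Tmax a b c vs chi mr sr) =
           {p \<in> Tmax a b c vs chi mr sr. \<forall>q \<in> Tmax a b c vs chi mr sr.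
              (Vw a b c vs chi mr sr p q \<longlongrightarrow> 0) (at_lend a) \<and>
              (Vw a b c vs chi mr sr p q \<longlongrightarrow> 0) (at_rend b)}"
proof -
  interpret left_definite a b c vs chi mr sr
    by (rule left_definite.intro) (fact assms)+
  show ?thesis using Tmax_linear Tmax_closed Tmax_adjoint by blast
qed

end
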